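(* Let $f:\mathbb{R}^d\to\mathbb{R}$ be $\ell$-gradient Lipschitz, analytic, and with compact sub-level sets, and let $g_0$ be an $(L,B,c)$-well-behaved function for $f$ with parameters $\eta,\beta>0$. If $\eta<\frac1{2\ell}$ and $\beta<\frac{1-2\eta\ell}{B}$, then for the iterates $\mathbf{x}_k$ of $g_0$, $\lim_{k\to\infty}\mathbf{x}_k$ exists and is a stationary point of $f$.
   Context: $f$ is $\ell$-gradient Lipschitz if $\|\nabla f(\mathbf{x})-\nabla f(\mathbf{y})\|\le \ell\|\mathbf{x}-\mathbf{y}\|$ for all $\mathbf{x},\mathbf{y}\in\mathbb{R}^d$. A stationary point is a point where $\nabla f=0$. Dynamical system: for $\eta,\beta>0$, $q_x:\mathbb{R}^d\times\mathbb{R}\to\mathbb{R}^d$ and $q_h:\mathbb{R}\to\mathbb{R}$, let $g_0(\mathbf{x},h)=(\mathbf{x}-\eta\, q_x(\mathbf{x},h),\ \beta\, q_h(h))$ on $\mathbb{R}^{d+1}$, with iterates $(\mathbf{x}_{k+1},h_{k+1})=g_0(\mathbf{x}_k,h_k)$ from an arbitrary initial point $(\mathbf{x}_0,h_0)\in\mathbb{R}^d\times\mathbb{R}$. For a $C^2$, $\ell$-gradient Lipschitz $f$, a map $g_0$ of this form is $(L,B,c)$-well-behaved (for $f$) if: (i) $q_x,q_h\in C^1$ and $q_h(0)=0$; (ii) for all $h\in\mathbb{R}$, $q_x(\cdot,h)$ is $L$-Lipschitz and $0<\frac{\partial q_h(h)}{\partial h}\le B$; (iii) for all $(\mathbf{x},h)\in\mathbb{R}^{d+1}$,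 $\|q_x(\mathbf{x},h)-\nabla f(\mathbf{x})\|\le c|h|$. *)

theory Defs
  imports "HOL-Analysis.Analysis"
begin

definition gradient :: "('a::real_inner \<Rightarrow> real) \<Rightarrow> 'a \<Rightarrow> 'a" where
  "gradient f x = (THE D. GDERIV f x :> D)"

definition stationary_point :: "('a::real_inner \<Rightarrow> real) \<Rightarrow> 'a \<Rightarrow> bool" where
  "stationary_point f x \<longleftrightarrow> f differentiable (at x) \<and> gradient f x = 0"

definition gradient_lipschitz :: "real \<Rightarrow> ('a::real_inner \<Rightarrow> real) \<Rightarrow> bool" where
  "gradient_lipschitz l f \<longleftrightarrow>
     (\<forall>x. f differentiable (at x)) \<and> l-lipschitz_on UNIV (gradient f)"

text \<open>
  Real analyticity on the whole space: around every point, \<open>f\<close> is the sum of a power series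
  in the coordinates. The series is summed unconditionally over the multi-indices
  \<open>\<alpha> :: 'n \<Rightarrow> nat\<close>; for real series this is the same as absolute convergence.
\<close>

definition real_analytic :: "(real ^ 'n \<Rightarrow> real) \<Rightarrow> bool" where
  "real_analytic f \<longleftrightarrow>
     (\<forall>a. \<exists>r>0. \<exists>coef :: ('n \<Rightarrow> nat) \<Rightarrow> real. \<forall>x\<in>ball a r.
        ((\<lambda>\<alpha>. coef \<alpha> * (\<Prod>i\<in>UNIV. (x $ i - a $ i) ^ \<alpha> i)) has_sum f x) UNIV)"

text \<open>
  The library notion \<open>C1_differentiable_on\<close> covers only functions of one real variable. Here the
  derivative is continuous with respect to the operator norm.
\<close>

definition C1 :: "('a::real_normed_vector \<Rightarrow> 'b::real_normed_vector) \<Rightarrow> bool" where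
  "C1 f \<longleftrightarrow>
     (\<exists>f' :: 'a \<Rightarrow> 'a \<Rightarrow>\<^sub>L 'b.
        (\<forall>x. (f has_derivative blinfun_apply (f' x)) (at x)) \<and> continuous_on UNIV f')"

definition step_map ::
  "real \<Rightarrow> real \<Rightarrow> ('a::real_vector \<times> real \<Rightarrow> 'a) \<Rightarrow> (real \<Rightarrow> real) \<Rightarrow> 'a \<times> real \<Rightarrow> 'a \<times> real" where
  "step_map \<eta> \<beta> q\<^sub>x q\<^sub>h = (\<lambda>(x, h). (x - \<eta> *\<^sub>R q\<^sub>x (x, h), \<beta> * q\<^sub>h h))"

text \<open>
  Since \<open>\<eta>\<close> and \<open>\<beta>\<close> are nonzero, \<open>g\<close> determines \<open>q\<^sub>x\<close> and \<open>q\<^sub>h\<close>, so the existential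
  quantifiers below leave no choice.
\<close>

definition well_behaved ::
  "real \<Rightarrow> real \<Rightarrow> real \<Rightarrow> real \<Rightarrow> real \<Rightarrow> ('a::real_inner \<Rightarrow> real) \<Rightarrow> ('a \<times> real \<Rightarrow> 'a \<times> real) \<Rightarrow> bool"
where
  "well_behaved L B c \<eta> \<beta> f g \<longleftrightarrow>
     \<eta> > 0 \<and> \<beta> > 0 \<and>
     (\<exists>q\<^sub>x q\<^sub>h. g = step_map \<eta> \<beta> q\<^sub>x q\<^sub>h \<and>
        C1 q\<^sub>x \<and> q\<^sub>h C1_differentiable_on UNIV \<and> q\<^sub>h 0 = 0 \<and>
        (\<forall>h. L-lipschitz_on UNIV (\<lambda>x. q\<^sub>x (x, h)) \<and> 0 < deriv q\<^sub>h h \<and> deriv q\<^sub>h h \<le> B) \<and>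
        (\<forall>x h. norm (q\<^sub>x (x, h) - gradient f x) \<le> c * \<bar>h\<bar>))"

end

theory Submission
  imports Defs "HOL-Complex_Analysis.Complex_Analysis"
begin

text \<open>
  The iterates converge because real analytic functions satisfy Lojasiewicz's inequality
  \<open>\<bar>f x - f a\<bar> powr \<theta> \<le> C * norm (gradient f x)\<close> near every point \<open>a\<close>, with \<open>\<theta> < 1\<close>: adding a geometric
  tail to \<open>f\<close> gives a Lyapunov function \<open>V\<close> which decreases by a multiple of \<open>(norm (q k))\<^sup>2\<close> in each step, and
  by the inequality the step lengths are dominated by the sum of a geometric sequence and of the
  decrements of \<open>(V - lim V) powr (1 - \<theta>)\<close>, so the orbit cannot leave a neighbourhood of a limit point.

  Lojasiewicz's inequality is proved for the complexification \<open>F\<close> of \<open>f\<close>. If \<open>F\<close> is a monomial times a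
  unit, it is an elementary estimate; by the chain rule it descends along finitely many
  holomorphic maps whose images cover a neighbourhood of the base point. So it suffices to transform every
  holomorphic germ locally into such a normal form, by coordinate changes, power
  substitutions and blow-ups. Induct on the number of variables and on the order \<open>d\<close> in the last variable
  \<open>x\<^sub>n\<close>. A translation of \<open>x\<^sub>n\<close> removes the coefficient of \<open>x\<^sub>n ^ (d - 1)\<close>. Then make the other coefficients monomials
  whose (weighted) exponents are comparable, and blow up. The order drops in every chart, since a polynomial of degree
  \<open>d\<close> without term of degree \<open>d - 1\<close> is the power of a linear form only if it is a multiple of \<open>x\<^sub>n ^ d\<close>.
\<close>

text \<open>Complex germs serve two purposes: Cauchy integrals give division by a coordinate with a
  holomorphic quotient, and \<open>x \<mapsto> x ^ N\<close> is onto near 0, where real even powers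
  would miss the negative half-line. The obstacle to the induction on the order is that a blow-up
  splits off a power of the exceptional coordinate, which must have normal crossings together with
  the rest. Hence the statements that are proved by induction concern products \<open>E * g\<close>,
  where \<open>E\<close> is independent of the last coordinate and collects these powers. The
  weights come from the substitution \<open>x\<^sub>n = x\<^sub>j * (y + \<mu>)\<close>: to split
  off \<open>x\<^sub>j ^ d\<close>, the coefficient of \<open>x\<^sub>n ^ i\<close> must itself
  supply \<open>x\<^sub>j ^ (d - i)\<close>. In the dynamics the exponent
  \<open>1 - \<theta>\<close> is natural because the derivative of
  \<open>w powr (1 - \<theta>)\<close> is a multiple of \<open>w powr (- \<theta>)\<close>, which
  Lojasiewicz's inequality bounds from below by the reciprocal of the gradient norm; a decrement of
  order \<open>(norm q)\<^sup>2\<close> thus pays for a length of order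
  \<open>norm q\<close>.\<close>

no_notation fps_nth (infixl \<open>$\<close> 75)

text \<open>\<open>nhds\<close> rather than \<open>at\<close>: the origin belongs to the
  neighbourhood, so a germ identity can be evaluated at 0 itself.\<close>

abbreviation near_0 :: "('a::{zero, topological_space} \<Rightarrow> bool) \<Rightarrow> bool" (binder \<open>\<forall>\<^sub>0\<close> 10) where
  "near_0 P \<equiv> eventually P (nhds 0)"

section \<open>Holomorphic germs in several variables\<close>

text \<open>Without the conjugation of a Hermitian product, so that \<open>cdot p\<close> is complex
  linear.\<close>

definition cdot :: "complex^'n \<Rightarrow> complex^'n \<Rightarrow> complex" where
  "cdot p v = (\<Sum>i\<in>UNIV. p $ i * v $ i)"

lemma bounded_bilinear_cdot: "bounded_bilinear (cdot :: complex^'n \<Rightarrow> complex^'n \<Rightarrow> complex)"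
proof
  show "\<exists>K. \<forall>a b. norm (cdot a b :: complex) \<le> norm a * norm (b :: complex^'n) * K"
  proof (intro exI allI)
    fix a b :: "complex^'n"
    have "norm (cdot a b) \<le> (\<Sum>i\<in>UNIV. norm (a $ i) * norm (b $ i))"
      unfolding cdot_def by (rule order_trans[OF norm_sum]) (simp add: norm_mult)
    also have "\<dots> \<le> (\<Sum>i\<in>(UNIV::'n set). norm a * norm b)"
      by (intro sum_mono mult_mono Finite_Cartesian_Product.norm_nth_le) auto
    finally show "norm (cdot a b) \<le> norm a * norm b * real CARD('n)"
      by (simp add: mult.commute)
  qed
qed (simp_all add: cdot_def sum.distrib sum_distrib_left algebra_simps scaleR_sum_right)

lift_definition cdotL :: "complex^'n \<Rightarrow> (complex^'n) \<Rightarrow>\<^sub>L complex" is cdot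
  by (rule bounded_bilinear.bounded_linear_right[OF bounded_bilinear_cdot])

lemma bounded_linear_cdotL: "bounded_linear cdotL"
  by transfer (rule bounded_bilinear_cdot)

lemma blinfun_apply_cdotL [simp]: "blinfun_apply (cdotL p) = cdot p"
  by (rule cdotL.rep_eq)

lemma cdot_axis [simp]: "cdot (axis n c) v = c * v $ n"
  by (simp add: cdot_def axis_def if_distrib[of "\<lambda>x. x * _"] cong: if_cong)

lemma cdot_axis_right [simp]: "cdot p (axis n c) = p $ n * c"
  by (simp add: cdot_def axis_def if_distrib[of "\<lambda>x. _ * x"] cong: if_cong)

lemma cdot_0 [simp]: "cdot 0 v = 0" "cdot p 0 = 0"
  by (simp_all add: cdot_def)

lemma cdot_add_left: "cdot (p + q) v = cdot p v + cdot q v"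
  and cdot_diff_left: "cdot (p - q) v = cdot p v - cdot q v"
  and cdot_smult_left: "cdot (c *s p) v = c * cdot p v"
  and cdot_smult_right: "cdot p (c *s v) = c * cdot p v"
  by (simp_all add: cdot_def sum.distrib sum_subtractf sum_distrib_left algebra_simps)

lemma has_derivative_vecI:
  fixes \<phi> :: "'a::real_normed_vector \<Rightarrow> 'b::euclidean_space^'n"
  assumes "\<And>i. ((\<lambda>x. \<phi> x $ i) has_derivative (\<lambda>v. \<phi>' v $ i)) (at x)"
  shows "(\<phi> has_derivative \<phi>') (at x)"
  unfolding has_derivative_componentwise_within[of \<phi>]
proof
  fix b :: "'b^'n" assume "b \<in> Basis"
  then obtain i c where "b = axis i c" by (auto simp: Basis_vec_def)
  then show "((\<lambda>x. \<phi> x \<bullet> b) has_derivative (\<lambda>v. \<phi>' v \<bullet> b)) (at x)"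
    using has_derivative_inner_left[OF assms, of i c] by (simp add: inner_axis)
qed

lemma isCont_vec_nth: "isCont f x \<Longrightarrow> isCont (\<lambda>x. f x $ i) x"
  unfolding isCont_def by (rule tendsto_vec_nth)

lemma isCont_vecI: "(\<And>i. isCont (\<lambda>x. f x $ i) x) \<Longrightarrow> isCont f x"
  unfolding isCont_def by (rule vec_tendstoI)

lemma isCont_smult: "isCont f x \<Longrightarrow> isCont g x \<Longrightarrow> isCont (\<lambda>x. f x *s g x :: complex^'n) x"
  by (intro isCont_vecI) (simp add: isCont_vec_nth)

text \<open>Complex differentiability: the real derivative is complex linear, given by the vector \<open>p\<close> of
  partial derivatives.\<close>

definition has_cgrad ::
  "(complex^'n \<Rightarrow> complex) \<Rightarrow> complex^'n \<Rightarrow> complex^'n \<Rightarrow> bool" where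
  "has_cgrad f p x \<longleftrightarrow> (f has_derivative cdot p) (at x)"

text \<open>A notion for germs at 0. The continuous gradient field is what parameter integrals and
  the inverse function theorem consume.\<close>

definition holo :: "(complex^'n \<Rightarrow> complex) \<Rightarrow> bool" where
  "holo f \<longleftrightarrow> (\<exists>p. \<forall>\<^sub>0 x. has_cgrad f (p x) x \<and> isCont p x)"

lemma has_cgrad_imp_isCont: "has_cgrad f p x \<Longrightarrow> isCont f x"
  unfolding has_cgrad_def by (rule has_derivative_continuous)

lemma has_cgrad_cong: "has_cgrad f p x \<Longrightarrow> \<forall>\<^sub>F y in nhds x. f y = g y \<Longrightarrow> has_cgrad g p x"
  unfolding has_cgrad_def
  by (erule has_derivative_transform_eventually)
     (auto simp: eventually_at_filter elim: eventually_mono dest: eventually_nhds_x_imp_x)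

lemma holo_cong:
  assumes "holo f" "\<forall>\<^sub>0 x. f x = g x"
  shows "holo g"
proof -
  obtain p where p: "\<forall>\<^sub>0 x. has_cgrad f (p x) x \<and> isCont p x"
    using assms(1) unfolding holo_def by blast
  have "\<forall>\<^sub>0 x. \<forall>\<^sub>F y in nhds x. f y = g y"
    using assms(2) by (simp add: eventually_eventually)
  with p have "\<forall>\<^sub>0 x. has_cgrad g (p x) x \<and> isCont p x"
    by eventually_elim (auto intro: has_cgrad_cong)
  then show ?thesis unfolding holo_def by blast
qed

lemma holo_eventually_isCont: "holo f \<Longrightarrow> \<forall>\<^sub>0 x. isCont f x"
  unfolding holo_def by (auto elim!: eventually_mono dest: has_cgrad_imp_isCont)

lemma holo_isCont: "holo f \<Longrightarrow> isCont f 0"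
  using eventually_nhds_x_imp_x[OF holo_eventually_isCont] .

lemma has_cgrad_mult:
  assumes "has_cgrad f p x" "has_cgrad g q x"
  shows "has_cgrad (\<lambda>x. f x * g x) (f x *s q + g x *s p) x"
  using has_derivative_mult[OF assms[unfolded has_cgrad_def]]
  unfolding has_cgrad_def
  by (rule has_derivative_eq_rhs) (simp add: fun_eq_iff cdot_add_left cdot_smult_left)

lemma has_cgrad_add:
  assumes "has_cgrad f p x" "has_cgrad g q x"
  shows "has_cgrad (\<lambda>x. f x + g x) (p + q) x"
  using has_derivative_add[OF assms[unfolded has_cgrad_def]]
  unfolding has_cgrad_def
  by (rule has_derivative_eq_rhs) (simp add: fun_eq_iff cdot_add_left)

lemma has_cgrad_const: "has_cgrad (\<lambda>x. c) 0 x"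
  unfolding has_cgrad_def
  by (rule has_derivative_eq_rhs[OF has_derivative_const]) (simp add: fun_eq_iff)

lemma has_cgrad_nth: "has_cgrad (\<lambda>x. x $ i) (axis i 1) x"
  unfolding has_cgrad_def
  by (rule has_derivative_eq_rhs[OF bounded_linear.has_derivative[OF bounded_linear_vec_nth has_derivative_ident]])
     (simp add: fun_eq_iff)

lemma holo_const [simp, intro]: "holo (\<lambda>x. c)"
  unfolding holo_def by (rule exI[of _ "\<lambda>_. 0"]) (simp add: has_cgrad_const)

lemma holo_nth [simp, intro]: "holo (\<lambda>x. x $ i)"
  unfolding holo_def by (rule exI[of _ "\<lambda>_. axis i 1"]) (simp add: has_cgrad_nth)

lemma holo_add [intro]: assumes "holo f" "holo g" shows "holo (\<lambda>x. f x + g x)"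
proof -
  obtain p q where "\<forall>\<^sub>0 x. has_cgrad f (p x) x \<and> isCont p x"
    "\<forall>\<^sub>0 x. has_cgrad g (q x) x \<and> isCont q x"
    using assms unfolding holo_def by blast
  then have "\<forall>\<^sub>0 x. has_cgrad (\<lambda>x. f x + g x) (p x + q x) x \<and> isCont (\<lambda>x. p x + q x) x"
    by eventually_elim (blast intro: has_cgrad_add isCont_add)
  then show ?thesis unfolding holo_def by (intro exI[of _ "\<lambda>x. p x + q x"])
qed

lemma holo_mult [intro]: assumes "holo f" "holo g" shows "holo (\<lambda>x. f x * g x)"
proof -
  obtain p q where "\<forall>\<^sub>0 x. has_cgrad f (p x) x \<and> isCont p x"
    "\<forall>\<^sub>0 x. has_cgrad g (q x) x \<and> isCont q x"
    using assms unfolding holo_def by blast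
  then have "\<forall>\<^sub>0 x. has_cgrad (\<lambda>x. f x * g x) (f x *s q x + g x *s p x) x \<and>
      isCont (\<lambda>x. f x *s q x + g x *s p x) x"
    by eventually_elim
      (intro conjI has_cgrad_mult isCont_add isCont_smult; blast dest: has_cgrad_imp_isCont)
  then show ?thesis unfolding holo_def by (intro exI[of _ "\<lambda>x. f x *s q x + g x *s p x"])
qed

lemma holo_uminus [intro]: "holo f \<Longrightarrow> holo (\<lambda>x. - f x)"
  using holo_mult[OF holo_const[of "-1"], of f] by simp

lemma holo_diff [intro]: "holo f \<Longrightarrow> holo g \<Longrightarrow> holo (\<lambda>x. f x - g x)"
  using holo_add[of f "\<lambda>x. - g x"] by (simp add: holo_uminus)

lemma holo_sum [intro]: "(\<And>i. i \<in> A \<Longrightarrow> holo (f i)) \<Longrightarrow> holo (\<lambda>x. \<Sum>i\<in>A. f i x)"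
  by (induction A rule: infinite_finite_induct) auto

lemma holo_prod [intro]: "(\<And>i. i \<in> A \<Longrightarrow> holo (f i)) \<Longrightarrow> holo (\<lambda>x. \<Prod>i\<in>A. f i x)"
  by (induction A rule: infinite_finite_induct) auto

lemma holo_power [intro]: "holo f \<Longrightarrow> holo (\<lambda>x. f x ^ k)"
  by (induction k) auto

lemma holo_eventually_nonzero:
  assumes "holo f" "f 0 \<noteq> 0"
  shows "\<forall>\<^sub>0 x. f x \<noteq> 0"
  using holo_isCont[OF assms(1)] assms(2)
  by (auto simp: isCont_def tendsto_at_iff_tendsto_nhds intro: tendsto_imp_eventually_ne)

lemma has_cgrad_compose:
  fixes \<phi> :: "complex^'m \<Rightarrow> complex^'n"
  assumes f: "has_cgrad f p (\<phi> x)" and \<phi>: "\<And>i. has_cgrad (\<lambda>x. \<phi> x $ i) (q i) x"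
  shows "has_cgrad (\<lambda>x. f (\<phi> x)) (\<Sum>i\<in>UNIV. p $ i *s q i) x"
proof -
  have "(\<phi> has_derivative (\<lambda>v. \<chi> i. cdot (q i) v)) (at x)"
    by (rule has_derivative_vecI) (use \<phi> in \<open>simp add: has_cgrad_def fun_eq_iff\<close>)
  from diff_chain_at[OF this f[unfolded has_cgrad_def]]
  have "((\<lambda>x. f (\<phi> x)) has_derivative (\<lambda>v. cdot p (\<chi> i. cdot (q i) v))) (at x)"
    by (simp add: o_def)
  then show ?thesis
    unfolding has_cgrad_def
    by (rule has_derivative_eq_rhs, intro ext)
       (simp add: cdot_def sum_distrib_left sum_distrib_right mult.assoc, rule sum.swap)
qed

definition holomap :: "(complex^'m \<Rightarrow> complex^'n) \<Rightarrow> bool" where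
  "holomap \<phi> \<longleftrightarrow> (\<forall>i. holo (\<lambda>x. \<phi> x $ i))"

lemma holomap_isCont: "holomap \<phi> \<Longrightarrow> isCont \<phi> 0"
  unfolding holomap_def by (intro isCont_vecI holo_isCont) auto

text \<open>Continuity at 0 alone is asked, so that a choice of roots, which may jump elsewhere, is
  allowed too.\<close>

lemma eventually_compose:
  assumes "isCont \<phi> 0" "\<phi> 0 = 0" "\<forall>\<^sub>0 x. P x"
  shows "\<forall>\<^sub>0 x. P (\<phi> x)"
proof -
  have "filterlim \<phi> (nhds 0) (nhds 0)"
    using assms(1,2) by (metis tendsto_at_iff_tendsto_nhds isCont_def)
  then show ?thesis using assms(3) by (simp add: filterlim_iff)
qed

lemma holo_compose:
  fixes \<phi> :: "complex^'m \<Rightarrow> complex^'n"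
  assumes f: "holo f" and \<phi>: "holomap \<phi>" "\<phi> 0 = 0"
  shows "holo (\<lambda>x. f (\<phi> x))"
proof -
  obtain p where p: "\<forall>\<^sub>0 x. has_cgrad f (p x) x \<and> isCont p x"
    using f unfolding holo_def by blast
  have "\<exists>q. \<forall>i. \<forall>\<^sub>0 x. has_cgrad (\<lambda>x. \<phi> x $ i) (q i x) x \<and> isCont (q i) x"
    using \<phi>(1) unfolding holomap_def holo_def by (intro choice allI) blast
  then obtain q where "\<And>i. \<forall>\<^sub>0 x. has_cgrad (\<lambda>x. \<phi> x $ i) (q i x) x \<and> isCont (q i) x"
    by blast
  then have "\<forall>\<^sub>0 x. \<forall>i. has_cgrad (\<lambda>x. \<phi> x $ i) (q i x) x \<and> isCont (q i) x"
    by (rule eventually_all_finite)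
  moreover have "\<forall>\<^sub>0 x. has_cgrad f (p (\<phi> x)) (\<phi> x) \<and> isCont p (\<phi> x)"
    by (rule eventually_compose[OF holomap_isCont[OF \<phi>(1)] \<phi>(2) p])
  ultimately have "\<forall>\<^sub>0 x. has_cgrad (\<lambda>x. f (\<phi> x)) (\<Sum>i\<in>UNIV. p (\<phi> x) $ i *s q i x) x \<and>
      isCont (\<lambda>x. \<Sum>i\<in>UNIV. p (\<phi> x) $ i *s q i x) x"
  proof eventually_elim
    case (elim x)
    have "isCont \<phi> x"
      by (rule isCont_vecI) (rule has_cgrad_imp_isCont, use elim in blast)
    moreover have "isCont p (\<phi> x)" using elim by blast
    ultimately have p: "isCont (\<lambda>x. p (\<phi> x)) x" by (rule isCont_o2)
    show ?case
    proof
      show "has_cgrad (\<lambda>x. f (\<phi> x)) (\<Sum>i\<in>UNIV. p (\<phi> x) $ i *s q i x) x"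
        using elim by (intro has_cgrad_compose[of f "p (\<phi> x)" \<phi> x]) auto
      show "isCont (\<lambda>x. \<Sum>i\<in>UNIV. p (\<phi> x) $ i *s q i x) x"
        by (rule isCont_sum) (intro ballI isCont_smult isCont_vec_nth[OF p], use elim in blast)
    qed
  qed
  then show ?thesis unfolding holo_def by (intro exI[of _ "\<lambda>x. \<Sum>i\<in>UNIV. p (\<phi> x) $ i *s q i x"])
qed

lemma holomap_compose:
  "holomap \<phi> \<Longrightarrow> holomap \<psi> \<Longrightarrow> \<psi> 0 = 0 \<Longrightarrow> holomap (\<lambda>x. \<phi> (\<psi> x))"
  unfolding holomap_def using holo_compose[of "\<lambda>x. \<phi> x $ _" \<psi>] by (auto simp: holomap_def)

section \<open>One-coordinate slices and polydiscs\<close>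

definition vupd :: "'a^'n \<Rightarrow> 'n \<Rightarrow> 'a \<Rightarrow> 'a^'n" where
  "vupd x n c = (\<chi> i. if i = n then c else x $ i)"

lemma vupd_nth: "vupd x n c $ i = (if i = n then c else x $ i)"
  by (simp add: vupd_def)

lemma vupd_nth_same [simp]: "vupd x n c $ n = c"
  and vupd_nth_other [simp]: "i \<noteq> n \<Longrightarrow> vupd x n c $ i = x $ i"
  and vupd_vupd [simp]: "vupd (vupd x n c) n d = vupd x n d"
  and vupd_triv [simp]: "vupd x n (x $ n) = x"
  by (simp_all add: vupd_def vec_eq_iff)

lemma vupd_0_0 [simp]: "vupd 0 n 0 = 0"
  by (simp add: vupd_def vec_eq_iff)

lemma holomap_vupd: "holo f \<Longrightarrow> holomap (\<lambda>x. vupd x n (f x))"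
  unfolding holomap_def
proof
  fix i show "holo f \<Longrightarrow> holo (\<lambda>x. vupd x n (f x) $ i)"
    by (cases "i = n") simp_all
qed

text \<open>Unlike balls, these neighbourhoods are stable under \<open>vupd\<close> with values of
  modulus below \<open>r\<close>, so circles in one coordinate stay inside.\<close>

definition polydisc :: "real \<Rightarrow> (complex^'n) set" where
  "polydisc r = {x. \<forall>i. norm (x $ i) < r}"

lemma mem_polydisc: "x \<in> polydisc r \<longleftrightarrow> (\<forall>i. norm (x $ i) < r)"
  by (simp add: polydisc_def)

lemma polydisc_eq_INT: "polydisc r = (\<Inter>i. (\<lambda>x. x $ i) -` ball 0 r)"
  by (auto simp: polydisc_def)

lemma open_polydisc: "open (polydisc r)"
  unfolding polydisc_eq_INT
  by (intro open_INT finite ballI open_vimage open_ball continuous_intros)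

lemma convex_polydisc: "convex (polydisc r)"
  unfolding polydisc_eq_INT
  by (intro convex_INT convex_linear_vimage convex_ball bounded_linear.linear bounded_linear_vec_nth)

lemma eventually_nhds_0_polydisc:
  "eventually P (nhds (0::complex^'n)) \<longleftrightarrow> (\<exists>r>0. \<forall>x\<in>polydisc r. P x)"
proof
  assume "eventually P (nhds (0::complex^'n))"
  then obtain e where e: "e > 0" "\<And>x. dist x 0 < e \<Longrightarrow> P x"
    unfolding eventually_nhds_metric by blast
  have "P x" if "x \<in> polydisc (e / real CARD('n))" for x :: "complex^'n"
  proof -
    have "norm x \<le> (\<Sum>i\<in>UNIV. norm (x $ i))"
      unfolding norm_vec_def by (rule L2_set_le_sum) simp
    also have "\<dots> < (\<Sum>i\<in>(UNIV::'n set). e / real CARD('n))"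
      using that by (intro sum_strict_mono) (auto simp: mem_polydisc)
    finally show ?thesis using e by simp
  qed
  then show "\<exists>r>0. \<forall>x\<in>polydisc r. P x" using e(1)
    by (intro exI[of _ "e / real CARD('n)"]) auto
next
  assume "\<exists>r>0. \<forall>x\<in>polydisc r. P x"
  then obtain r where "r > 0" "\<forall>x\<in>polydisc r. P x" by blast
  then show "eventually P (nhds (0::complex^'n))"
    unfolding eventually_nhds by (intro exI[of _ "polydisc r"]) (auto simp: open_polydisc mem_polydisc)
qed

lemma holo_polydisc:
  assumes "holo f"
  shows "\<exists>r>0. \<exists>p. (\<forall>x\<in>polydisc r. has_cgrad f (p x) x) \<and> continuous_on (polydisc r) p"
  using assms continuous_at_imp_continuous_on unfolding holo_def eventually_nhds_0_polydisc
  by blast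

lemma holoI_polydisc:
  assumes "r > 0" "\<And>x. x \<in> polydisc r \<Longrightarrow> has_cgrad f (p x) x" "continuous_on (polydisc r) p"
  shows "holo f"
  unfolding holo_def eventually_nhds_0_polydisc
  using assms continuous_on_eq_continuous_at[OF open_polydisc] by blast

section \<open>Cauchy integrals in one coordinate\<close>

text \<open>Leibniz's rule yields a real derivative; it is complex linear because the bounded linear
  \<open>cdotL\<close> commutes with the integral.\<close>

lemma holo_param_integral:
  fixes G :: "complex^'n \<Rightarrow> real \<Rightarrow> complex" and P :: "complex^'n \<Rightarrow> real \<Rightarrow> complex^'n"
  assumes r: "r > 0"
    and G: "\<And>x t. x \<in> polydisc r \<Longrightarrow> t \<in> {0..1} \<Longrightarrow> has_cgrad (\<lambda>x. G x t) (P x t) x"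
    and contG: "\<And>x. x \<in> polydisc r \<Longrightarrow> continuous_on {0..1} (G x)"
    and contP: "continuous_on (polydisc r \<times> {0..1}) (\<lambda>(x, t). P x t)"
  shows "holo (\<lambda>x. integral {0..1} (G x))"
proof (rule holoI_polydisc[OF r])
  show "continuous_on (polydisc r) (\<lambda>x. integral {0..1} (P x))"
    using integral_continuous_on_param[of "polydisc r" 0 1 P] contP by (simp add: cbox_interval)
  fix x :: "complex^'n" assume x: "x \<in> polydisc r"
  have "((\<lambda>x. integral (cbox 0 1) (G x)) has_derivative integral (cbox 0 1) (\<lambda>t. cdotL (P x t)))
      (at x within polydisc r)"
  proof (rule leibniz_rule[OF _ _ _ x convex_polydisc])
    show "((\<lambda>x. G x t) has_derivative blinfun_apply (cdotL (P x t))) (at x within polydisc r)"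
      if "x \<in> polydisc r" "t \<in> cbox 0 1" for x t
      using G[of x t] that by (simp add: has_cgrad_def cbox_interval has_derivative_at_withinI)
    show "G x integrable_on cbox 0 1" if "x \<in> polydisc r" for x
      using contG[OF that] by (simp add: cbox_interval integrable_continuous_interval)
    show "continuous_on (polydisc r \<times> cbox 0 1) (\<lambda>(x, t). cdotL (P x t))"
      using bounded_linear.continuous_on[OF bounded_linear_cdotL contP]
      by (simp add: cbox_interval case_prod_unfold)
  qed
  moreover have "integral {0..1} (\<lambda>t. cdotL (P x t)) = cdotL (integral {0..1} (P x))"
  proof -
    have "continuous_on {0..1} (P x)"
      using continuous_on_compose2[OF contP, of "{0..1}" "Pair x"] x
      by (force intro: continuous_intros)
    then show ?thesis
      using integral_linear[OF integrable_continuous_interval bounded_linear_cdotL, of 0 1 "P x"]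
      by (simp add: o_def)
  qed
  ultimately show "has_cgrad (\<lambda>x. integral {0..1} (G x)) (integral {0..1} (P x)) x"
    using x by (simp add: has_cgrad_def cbox_interval at_within_open[OF _ open_polydisc])
qed

lemma polydisc_mono: "r \<le> s \<Longrightarrow> polydisc r \<subseteq> polydisc s"
  unfolding polydisc_def by (auto intro: less_le_trans)

lemma vupd_polydisc: "x \<in> polydisc r \<Longrightarrow> norm c < r \<Longrightarrow> vupd x n c \<in> polydisc r"
  by (simp add: mem_polydisc vupd_nth)

lemma has_cgrad_vupd:
  assumes "has_cgrad f p (vupd x n c)"
  shows "has_cgrad (\<lambda>x. f (vupd x n c)) (vupd p n 0) x"
proof -
  have "has_cgrad (\<lambda>x. f (vupd x n c)) (\<Sum>i\<in>UNIV. p $ i *s (if i = n then 0 else axis i 1)) x"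
    by (rule has_cgrad_compose[where \<phi> = "\<lambda>x. vupd x n c", OF assms])
       (auto simp: vupd_nth has_cgrad_const has_cgrad_nth)
  also have "(\<Sum>i\<in>UNIV. p $ i *s (if i = n then 0 else axis i 1)) = vupd p n 0"
  proof (rule vec_eq_iff[THEN iffD2], rule allI)
    fix i
    have "(\<Sum>j\<in>UNIV. p $ j *s (if j = n then 0 else axis j 1)) $ i =
        (\<Sum>j\<in>UNIV. if j = i then if i = n then 0 else p $ i else 0)"
      unfolding sum_component by (rule sum.cong) (auto simp: axis_def)
    then show "(\<Sum>j\<in>UNIV. p $ j *s (if j = n then 0 else axis j 1)) $ i = vupd p n 0 $ i"
      by (simp add: vupd_nth)
  qed
  finally show ?thesis .
qed

lemma has_cgrad_comp_field:
  assumes "(g has_field_derivative g') (at (x $ n))"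
  shows "has_cgrad (\<lambda>x. g (x $ n)) (axis n g') x"
proof -
  have "((\<lambda>x. g (x $ n)) has_derivative (\<lambda>v. g' * cdot (axis n 1) v)) (at x)"
    using diff_chain_at[OF has_cgrad_nth[unfolded has_cgrad_def] assms[unfolded has_field_derivative_def]]
    by (simp add: o_def)
  then show ?thesis
    unfolding has_cgrad_def by (rule has_derivative_eq_rhs) (simp add: fun_eq_iff)
qed

text \<open>On the circle \<open>x $ n\<close> is overwritten by \<open>\<zeta>\<close>, so it
  enters through the kernel only. The weight \<open>w\<close> lets one statement serve both Cauchy's
  formula (\<open>w = 1\<close>) and division by a coordinate
  (\<open>w \<zeta> = 1 / \<zeta>\<close>).\<close>

lemma holo_contour_integral:
  fixes f :: "complex^'n \<Rightarrow> complex"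
  assumes \<rho>: "0 < \<rho>" "\<rho> < r"
    and f: "\<And>x. x \<in> polydisc r \<Longrightarrow> has_cgrad f (p x) x" "continuous_on (polydisc r) p"
    and w: "continuous_on (sphere 0 \<rho>) w"
  shows "holo (\<lambda>x. contour_integral (circlepath 0 \<rho>) (\<lambda>\<zeta>. f (vupd x n \<zeta>) * w \<zeta> / (\<zeta> - x $ n) ^ m))"
proof -
  define z where "z = circlepath 0 \<rho>"
  define z' where "z' = (\<lambda>t. 2 * pi * \<i> * \<rho> * exp (2 * of_real pi * \<i> * of_real t))"
  have nz: "norm (z t) = \<rho>" for t
    using \<rho> by (simp add: z_def circlepath norm_mult)
  have cz: "continuous_on A z" "continuous_on A z'" for A
    unfolding z_def z'_def circlepath by (auto intro!: continuous_intros)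
  have cf: "continuous_on (polydisc r) f"
    by (intro continuous_at_imp_continuous_on ballI) (use f(1) has_cgrad_imp_isCont in blast)
  have sub: "polydisc \<rho> \<subseteq> (polydisc r :: (complex^'n) set)"
    using \<rho> by (intro polydisc_mono) simp
  have zx: "z t \<noteq> x $ n" if "x \<in> polydisc \<rho>" for t and x :: "complex^'n"
    using nz[of t] that by (auto simp: mem_polydisc)
  have vr: "vupd x n (z t) \<in> polydisc r" if "x \<in> polydisc \<rho>" for x :: "complex^'n" and t
    using that sub nz[of t] \<rho> by (intro vupd_polydisc) auto
  define G where "G x t = f (vupd x n (z t)) * w (z t) / (z t - x $ n) ^ m * z' t" for x t
  \<comment> \<open>Product rule: the kernel contributes the \<open>n\<close>-th component, and the
    slice contributes \<open>p\<close> with its \<open>n\<close>-th component erased.\<close>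
  define P where "P x t = (w (z t) * z' t) *s (f (vupd x n (z t)) *s axis n (of_nat m / (z t - x $ n) ^ Suc m) +
     (1 / (z t - x $ n) ^ m) *s vupd (p (vupd x n (z t))) n 0)" for x t
  let ?D = "polydisc \<rho> \<times> {0..1} :: ((complex^'n) \<times> real) set"
  have cv: "continuous_on ?D (\<lambda>y. vupd (fst y) n (z (snd y)))"
    unfolding vupd_def
  proof (rule continuous_on_vec_lambda)
    fix i show "continuous_on ?D (\<lambda>y. if i = n then z (snd y) else fst y $ i)"
      by (cases "i = n") (auto intro!: continuous_intros continuous_on_compose2[OF cz(1)])
  qed
  have cfv: "continuous_on ?D (\<lambda>y. f (vupd (fst y) n (z (snd y))))"
    by (rule continuous_on_compose2[OF cf cv]) (use vr in auto)
  have cpv: "continuous_on ?D (\<lambda>y. p (vupd (fst y) n (z (snd y))))"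
    by (rule continuous_on_compose2[OF f(2) cv]) (use vr in auto)
  have cwz: "continuous_on ?D (\<lambda>y. w (z (snd y)))"
    by (rule continuous_on_compose2[OF w], rule continuous_on_compose2[OF cz(1)])
       (auto simp: nz intro: continuous_intros)
  have cz': "continuous_on ?D (\<lambda>y. z (snd y))" "continuous_on ?D (\<lambda>y. z' (snd y))"
    by (auto intro!: continuous_on_compose2[OF cz(1)] continuous_on_compose2[OF cz(2)] continuous_intros)
  have P: "has_cgrad (\<lambda>x. G x t) (P x t) x" if "x \<in> polydisc \<rho>" for x t
  proof -
    have "((\<lambda>u. 1 / (z t - u) ^ m) has_field_derivative of_nat m / (z t - x $ n) ^ Suc m) (at (x $ n))"
      using zx[OF that, of t]
      by (auto intro!: derivative_eq_intros simp: divide_simps power_add[symmetric] power_Suc[symmetric] simp del: power_Suc)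
         (cases m; simp add: algebra_simps)
    from has_cgrad_mult[OF has_cgrad_const[of "w (z t) * z' t"]
        has_cgrad_mult[OF has_cgrad_vupd[OF f(1)[OF vr[OF that, of t]]] has_cgrad_comp_field[OF this]]]
    show ?thesis by (simp add: G_def P_def mult_ac)
  qed
  have "holo (\<lambda>x. integral {0..1} (G x))"
  proof (rule holo_param_integral[OF \<rho>(1) P])
    have "continuous_on ?D (\<lambda>(x, t). G x t)"
      unfolding G_def case_prod_unfold
      by (intro continuous_intros cfv cwz cz') (use zx in auto)
    then show "continuous_on {0..1} (G x)" if "x \<in> polydisc \<rho>" for x
      using continuous_on_compose2[of ?D "\<lambda>(x, t). G x t" "{0..1}" "Pair x"] that
      by (force intro: continuous_intros)
    have "continuous_on ?D (\<lambda>y. P (fst y) (snd y))"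
    proof -
      have "continuous_on ?D (\<lambda>y. \<chi> i. P (fst y) (snd y) $ i)"
      proof (rule continuous_on_vec_lambda)
        fix i show "continuous_on ?D (\<lambda>y. P (fst y) (snd y) $ i)"
          unfolding P_def
          by (cases "i = n"; simp add: axis_def; intro continuous_intros cfv cwz cz' cpv)
             (use zx in auto)
      qed
      then show ?thesis by simp
    qed
    then show "continuous_on ?D (\<lambda>(x, t). P x t)" by (simp add: case_prod_unfold)
  qed auto
  moreover have "(\<lambda>x. integral {0..1} (G x)) =
      (\<lambda>x. contour_integral (circlepath 0 \<rho>) (\<lambda>\<zeta>. f (vupd x n \<zeta>) * w \<zeta> / (\<zeta> - x $ n) ^ m))"
    by (simp add: contour_integral_integral vector_derivative_circlepath z_def z'_def
        G_def[abs_def])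
  ultimately show ?thesis by simp
qed

lemma has_field_derivative_slice:
  assumes "has_cgrad f p (vupd x n t)"
  shows "((\<lambda>t. f (vupd x n t)) has_field_derivative p $ n) (at t)"
proof -
  have "((\<lambda>t. vupd x n t) has_derivative (\<lambda>h. axis n h)) (at t)"
  proof (rule has_derivative_vecI)
    fix i show "((\<lambda>t. vupd x n t $ i) has_derivative (\<lambda>h. axis n h $ i)) (at t)"
      by (cases "i = n") (simp_all add: axis_def)
  qed
  from diff_chain_at[OF this assms[unfolded has_cgrad_def]] show ?thesis
    by (simp add: o_def has_field_derivative_def)
qed

lemma holomorphic_on_slice:
  assumes "\<And>x. x \<in> polydisc r \<Longrightarrow> has_cgrad f (p x) x" "x \<in> polydisc r"
  shows "(\<lambda>t. f (vupd x n t)) holomorphic_on ball 0 r"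
proof (rule holomorphic_onI)
  fix t :: complex assume "t \<in> ball 0 r"
  then have "has_cgrad f (p (vupd x n t)) (vupd x n t)"
    using assms by (auto intro: vupd_polydisc)
  from has_field_derivative_slice[OF this]
  show "(\<lambda>t. f (vupd x n t)) field_differentiable at t within ball 0 r"
    using field_differentiable_at_within field_differentiable_def by blast
qed

lemma holo_cauchy:
  fixes f :: "complex^'n \<Rightarrow> complex"
  assumes "holo f"
  obtains r where "r > 0"
    "\<And>w m. continuous_on (sphere 0 r) w \<Longrightarrow>
      holo (\<lambda>x. contour_integral (circlepath 0 r) (\<lambda>z. f (vupd x n z) * w z / (z - x $ n) ^ m))"
    "\<And>x. x \<in> polydisc r \<Longrightarrow> continuous_on (cball 0 r) (\<lambda>t. f (vupd x n t))"
    "\<And>x. x \<in> polydisc r \<Longrightarrow> (\<lambda>t. f (vupd x n t)) holomorphic_on ball 0 r"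
proof -
  obtain s p where s: "s > 0" "\<And>x. x \<in> polydisc s \<Longrightarrow> has_cgrad f (p x) x" "continuous_on (polydisc s) p"
    using holo_polydisc[OF assms] by blast
  define r where "r = s / 2"
  have r: "0 < r" "r < s" using s(1) by (auto simp: r_def)
  have hol: "(\<lambda>t. f (vupd x n t)) holomorphic_on ball 0 s" if "x \<in> polydisc r" for x
    using that r polydisc_mono[of r s] by (intro holomorphic_on_slice[OF s(2)]) auto
  show thesis
  proof (rule that[OF r(1) holo_contour_integral[OF r s(2,3)]])
    fix x :: "complex^'n" assume x: "x \<in> polydisc r"
    show "continuous_on (cball 0 r) (\<lambda>t. f (vupd x n t))"
      by (rule continuous_on_subset[OF holomorphic_on_imp_continuous_on[OF hol[OF x]]]) (use r in auto)
    show "(\<lambda>t. f (vupd x n t)) holomorphic_on ball 0 r"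
      by (rule holomorphic_on_subset[OF hol[OF x]]) (use r in auto)
  qed
qed

text \<open>The slice is differentiated at its own point \<open>x $ n\<close>, so this is the
  iterated partial derivative in direction \<open>n\<close>; Cauchy's formula presents it as a
  parameter integral.\<close>

lemma holo_higher_deriv:
  assumes "holo f"
  shows "holo (\<lambda>x. (deriv ^^ k) (\<lambda>t. f (vupd x n t)) (x $ n))"
proof -
  obtain r where r: "r > 0"
    and h: "\<And>w m. continuous_on (sphere 0 r) w \<Longrightarrow>
      holo (\<lambda>x. contour_integral (circlepath 0 r) (\<lambda>z. f (vupd x n z) * w z / (z - x $ n) ^ m))"
    and c: "\<And>x. x \<in> polydisc r \<Longrightarrow> continuous_on (cball 0 r) (\<lambda>t. f (vupd x n t))"
      "\<And>x. x \<in> polydisc r \<Longrightarrow> (\<lambda>t. f (vupd x n t)) holomorphic_on ball 0 r"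
    using holo_cauchy[OF assms] by blast
  show ?thesis
  proof (rule holo_cong[OF holo_mult[OF holo_const h[OF continuous_on_const]]])
    show "\<forall>\<^sub>0 x. fact k / (2 * pi * \<i>) * contour_integral (circlepath 0 r)
        (\<lambda>z. f (vupd x n z) * 1 / (z - x $ n) ^ Suc k) = (deriv ^^ k) (\<lambda>t. f (vupd x n t)) (x $ n)"
      unfolding eventually_nhds_0_polydisc
    proof (intro exI[of _ r] conjI ballI r)
      fix x :: "complex^'a" assume x: "x \<in> polydisc r"
      then have "x $ n \<in> ball 0 r" by (simp add: mem_polydisc)
      from Cauchy_higher_derivative_integral_circlepath(2)[OF c[OF x] this]
      show "fact k / (2 * pi * \<i>) * contour_integral (circlepath 0 r)
        (\<lambda>z. f (vupd x n z) * 1 / (z - x $ n) ^ Suc k) = (deriv ^^ k) (\<lambda>t. f (vupd x n t)) (x $ n)"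
        by simp
    qed
  qed
qed

text \<open>Partial fractions: \<open>1 / (z - u) - 1 / z = u / (z * (z - u))\<close>. Subtracting
  Cauchy's formulas at \<open>u = x $ n\<close> and at 0 leaves \<open>x $ n\<close> times a Cauchy
  integral with weight \<open>1 / z\<close>, which is holomorphic also where
  \<open>x $ n = 0\<close>.\<close>

lemma holo_expand:
  assumes "holo f"
  obtains g where "holo g" "\<forall>\<^sub>0 x. f x = f (vupd x n 0) + x $ n * g x"
proof -
  obtain r where r: "r > 0"
    and h: "\<And>w m. continuous_on (sphere 0 r) w \<Longrightarrow>
      holo (\<lambda>x. contour_integral (circlepath 0 r) (\<lambda>z. f (vupd x n z) * w z / (z - x $ n) ^ m))"
    and c: "\<And>x. x \<in> polydisc r \<Longrightarrow> continuous_on (cball 0 r) (\<lambda>t. f (vupd x n t))"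
      "\<And>x. x \<in> polydisc r \<Longrightarrow> (\<lambda>t. f (vupd x n t)) holomorphic_on ball 0 r"
    using holo_cauchy[OF assms] by blast
  define g where "g x = 1 / (2 * pi * \<i>) * contour_integral (circlepath 0 r)
      (\<lambda>z. f (vupd x n z) * (1 / z) / (z - x $ n) ^ 1)" for x
  have "holo g" unfolding g_def
    by (intro holo_mult holo_const h continuous_intros) (use r in auto)
  moreover have "\<forall>\<^sub>0 x. f x = f (vupd x n 0) + x $ n * g x"
    unfolding eventually_nhds_0_polydisc
  proof (intro exI[of _ r] conjI ballI r)
    fix x :: "complex^'a" assume x: "x \<in> polydisc r"
    show "f x = f (vupd x n 0) + x $ n * g x"
    proof (cases "x $ n = 0")
      case True
      then have "vupd x n 0 = x" by (metis vupd_triv)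
      with True show ?thesis by simp
    next
      case False
      have C: "((\<lambda>z. f (vupd x n z) / (z - u)) has_contour_integral (2 * of_real pi * \<i> * f (vupd x n u)))
          (circlepath 0 r)" if "norm u < r" for u
        by (rule Cauchy_integral_circlepath[OF c[OF x]]) (use that in auto)
      have "norm (x $ n) < r" "norm (0::complex) < r" using x r by (auto simp: mem_polydisc)
      note CC = has_contour_integral_div[OF has_contour_integral_diff[OF C[OF this(1)] C[OF this(2)]], of "x $ n"]
      have "((\<lambda>z. f (vupd x n z) * (1 / z) / (z - x $ n) ^ 1) has_contour_integral
          ((2 * of_real pi * \<i> * f (vupd x n (x $ n)) - 2 * of_real pi * \<i> * f (vupd x n 0)) / (x $ n))) (circlepath 0 r)"
      proof (rule has_contour_integral_eq[OF CC])
        fix z assume "z \<in> path_image (circlepath 0 r)"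
        then have "z \<noteq> 0" "z \<noteq> x $ n" using x r by (auto simp: mem_polydisc)
        then show "(f (vupd x n z) / (z - x $ n) - f (vupd x n z) / (z - 0)) / x $ n =
            f (vupd x n z) * (1 / z) / (z - x $ n) ^ 1"
          using False by (simp add: divide_simps) (simp add: algebra_simps)
      qed
      from contour_integral_unique[OF this] False show ?thesis
        unfolding g_def by (simp add: divide_simps) (simp add: algebra_simps)
    qed
  qed
  ultimately show ?thesis by (rule that)
qed

section \<open>Zero divisors and implicit functions\<close>

lemma has_field_derivative_line:
  assumes "has_cgrad f p (v + t *s u)"
  shows "((\<lambda>t. f (v + t *s u)) has_field_derivative cdot p u) (at t)"
proof -
  have "((\<lambda>t. v + t *s u) has_derivative (\<lambda>h. h *s u)) (at t)"
    by (rule has_derivative_vecI) (auto intro!: derivative_eq_intros)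
  from diff_chain_at[OF this assms[unfolded has_cgrad_def]] show ?thesis
    by (simp add: o_def has_field_derivative_def cdot_smult_right mult_commute_abs)
qed

lemma open_convex_line_polydisc:
  fixes u v :: "complex^'n"
  shows "open {t. v + t *s u \<in> polydisc r}" "convex {t. v + t *s u \<in> polydisc r}"
proof -
  have "continuous_on UNIV (\<lambda>t. (\<chi> i. v $ i + t * u $ i) :: complex^'n)"
    by (intro continuous_intros)
  note c = this
  have eq: "(\<lambda>t. (\<chi> i. v $ i + t * u $ i) :: complex^'n) = (\<lambda>t. v + t *s u)"
    by (simp add: fun_eq_iff vec_eq_iff)
  from open_vimage[OF open_polydisc c[unfolded eq]] show "open {t. v + t *s u \<in> polydisc r}"
    by (simp add: vimage_def)
  show "convex {t. v + t *s u \<in> polydisc r}"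
  proof (rule convexI, clarify)
    fix x y :: complex and a b :: real
    assume *: "v + x *s u \<in> polydisc r" "v + y *s u \<in> polydisc r" "0 \<le> a" "0 \<le> b" "a + b = 1"
    have "v + (a *\<^sub>R x + b *\<^sub>R y) *s u = a *\<^sub>R (v + x *s u) + b *\<^sub>R (v + y *s u)"
      using *(5) by (simp add: vec_eq_iff algebra_simps flip: scaleR_add_left)
    then show "v + (a *\<^sub>R x + b *\<^sub>R y) *s u \<in> polydisc r"
      using convexD[OF convex_polydisc *] by simp
  qed
qed

lemma holomorphic_on_line:
  assumes "\<And>x. x \<in> polydisc r \<Longrightarrow> has_cgrad f (p x) x"
  shows "(\<lambda>t. f (v + t *s u)) holomorphic_on {t. v + t *s u \<in> polydisc r}"
  using has_field_derivative_line[OF assms] field_differentiable_at_within field_differentiable_def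
  by (blast intro: holomorphic_onI)

text \<open>Joining any point \<open>w\<close> by a complex line to a point \<open>v\<close> with
  \<open>g v \<noteq> 0\<close> reduces this to the identity theorem in one variable; the line meets
  a polydisc in a convex, hence connected, set.\<close>

lemma holo_zero_divisor:
  fixes f g :: "complex^'n \<Rightarrow> complex"
  assumes "holo f" "holo g" "\<forall>\<^sub>0 x. f x * g x = 0"
  shows "(\<forall>\<^sub>0 x. f x = 0) \<or> (\<forall>\<^sub>0 x. g x = 0)"
proof (rule disjCI)
  assume nz: "\<not> (\<forall>\<^sub>0 x. g x = 0)"
  obtain p q where "\<forall>\<^sub>0 x. has_cgrad f (p x) x \<and> isCont p x"
    "\<forall>\<^sub>0 x. has_cgrad g (q x) x \<and> isCont q x"
    using assms unfolding holo_def by blast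
  with assms(3) have "\<forall>\<^sub>0 x. has_cgrad f (p x) x \<and> has_cgrad g (q x) x \<and> f x * g x = 0"
    by eventually_elim auto
  then obtain r where r: "r > 0" and f: "\<And>x. x \<in> polydisc r \<Longrightarrow> has_cgrad f (p x) x"
    and g: "\<And>x. x \<in> polydisc r \<Longrightarrow> has_cgrad g (q x) x"
    and fg: "\<And>x. x \<in> polydisc r \<Longrightarrow> f x * g x = 0"
    unfolding eventually_nhds_0_polydisc by blast
  obtain v where v: "v \<in> polydisc r" "g v \<noteq> 0"
    using nz r unfolding eventually_nhds_0_polydisc by blast
  show "\<forall>\<^sub>0 x. f x = 0"
    unfolding eventually_nhds_0_polydisc
  proof (intro exI[of _ r] conjI r ballI)
    fix w :: "complex^'n" assume w: "w \<in> polydisc r"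
    define T where "T = {t. v + t *s (w - v) \<in> polydisc r}"
    have T: "open T" "connected T"
      unfolding T_def by (intro open_convex_line_polydisc convex_connected)+
    have hg: "(\<lambda>t. g (v + t *s (w - v))) holomorphic_on T"
      and hf: "(\<lambda>t. f (v + t *s (w - v))) holomorphic_on T"
      unfolding T_def by (intro holomorphic_on_line[OF g] holomorphic_on_line[OF f]; assumption)+
    have 01: "0 \<in> T" "1 \<in> T" using v w by (auto simp: T_def)
    define T' where "T' = {t\<in>T. g (v + t *s (w - v)) \<noteq> 0}"
    have "open T'"
      using continuous_open_preimage[OF holomorphic_on_imp_continuous_on[OF hg] T(1) open_Compl[OF closed_singleton, of 0]]
      by (simp add: T'_def Int_def vimage_def)
    have "f (v + 1 *s (w - v)) = 0"
    proof (rule analytic_continuation_open[of T' T _ "\<lambda>_. 0" 1, OF \<open>open T'\<close> T(1) _ T(2) _ hf])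
      show "T' \<noteq> {}" using 01 v by (auto simp: T'_def)
      show "f (v + z *s (w - v)) = 0" if "z \<in> T'" for z
        using that fg[of "v + z *s (w - v)"] by (auto simp: T'_def T_def)
    qed (use 01 in \<open>auto simp: T'_def\<close>)
    then show "f w = 0" by simp
  qed
qed

lemma axis_component: "axis n c $ i = (if i = n then c else 0)"
  by (simp add: axis_def)

text \<open>Inverse function theorem for \<open>\<Psi>\<close>, which replaces \<open>x $ n\<close>
  by \<open>D x\<close>: the preimage of a point with \<open>n\<close>-th coordinate 0 lies on
  \<open>D = 0\<close>, and its \<open>n\<close>-th coordinate is the solution. That theorem gives a
  real derivative of the inverse, so complex linearity has to be recovered.\<close>

lemma holo_implicit:
  fixes D :: "complex^'n \<Rightarrow> complex"
  assumes D: "holo D" "D 0 = 0" "deriv (\<lambda>t. D (vupd 0 n t)) 0 \<noteq> 0"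
  shows "\<exists>\<tau>. holo \<tau> \<and> \<tau> 0 = 0 \<and> (\<forall>\<^sub>0 x. D (vupd x n (\<tau> x)) = 0)"
proof -
  obtain r p where r: "r > 0" "\<And>x. x \<in> polydisc r \<Longrightarrow> has_cgrad D (p x) x" "continuous_on (polydisc r) p"
    using holo_polydisc[OF D(1)] by blast
  have 0: "0 \<in> polydisc r" using r(1) by (simp add: mem_polydisc)
  have pn: "p 0 $ n \<noteq> 0"
    using has_field_derivative_slice[of D "p 0" 0 n 0] r(2)[OF 0] D(3) by (auto dest: DERIV_imp_deriv)
  have bl_axis: "bounded_linear (axis n :: complex \<Rightarrow> complex^'n)"
    by (intro linear_conv_bounded_linear[THEN iffD1] linearI) (auto simp: vec_eq_iff axis_def)
  define axisL where "axisL = Blinfun (axis n :: complex \<Rightarrow> complex^'n)"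
  have axisL: "blinfun_apply axisL = axis n"
    unfolding axisL_def by (rule bounded_linear_Blinfun_apply[OF bl_axis])
  define \<Psi> where "\<Psi> = (\<lambda>x. vupd x n (D x))"
  define \<Psi>' where "\<Psi>' x = id_blinfun + (axisL o\<^sub>L cdotL (p x - axis n 1))" for x
  have \<Psi>'_apply: "blinfun_apply (\<Psi>' x) v = vupd v n (cdot (p x) v)" for x v
    by (simp add: \<Psi>'_def axisL blinfun.bilinear_simps cdot_diff_left vec_eq_iff vupd_nth axis_component)
  have der: "(\<Psi> has_derivative blinfun_apply (\<Psi>' x)) (at x)" if x: "x \<in> polydisc r" for x
  proof (rule has_derivative_vecI)
    fix i show "((\<lambda>x. \<Psi> x $ i) has_derivative (\<lambda>v. blinfun_apply (\<Psi>' x) v $ i)) (at x)"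
      using r(2)[OF x] has_cgrad_nth[of i x]
      by (cases "i = n") (simp_all add: \<Psi>_def \<Psi>'_apply has_cgrad_def fun_eq_iff cdot_axis[abs_def])
  qed
  have cont: "continuous_on (polydisc r) \<Psi>'"
    unfolding \<Psi>'_def
    by (intro continuous_on_add continuous_on_const continuous_on_diff r(3)
        bounded_bilinear.continuous_on[OF bounded_bilinear_blinfun_compose]
        bounded_linear.continuous_on[OF bounded_linear_cdotL])
  \<comment> \<open>Sherman-Morrison formula: \<open>\<Psi>' 0\<close> is the identity plus the
    rank-one map \<open>v \<mapsto> axis n (cdot s v)\<close>, and
    \<open>1 + s $ n = p 0 $ n\<close> is nonzero.\<close>
  define s where "s = p 0 - axis n 1"
  define c where "c = - 1 / p 0 $ n"
  define invf where "invf = id_blinfun + (axisL o\<^sub>L cdotL (c *s s))"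
  have inv: "invf o\<^sub>L \<Psi>' 0 = id_blinfun"
  proof (rule blinfun_eqI)
    fix v
    have sn: "p 0 $ n = 1 + s $ n" by (simp add: s_def)
    then have "1 + s $ n \<noteq> 0" using pn by simp
    then have "cdot s v + c * (cdot s v + s $ n * cdot s v) = 0"
      unfolding c_def sn by (simp add: divide_simps) (simp add: algebra_simps)
    then show "blinfun_apply (invf o\<^sub>L \<Psi>' 0) v = blinfun_apply id_blinfun v"
      by (simp add: invf_def \<Psi>'_def axisL blinfun.bilinear_simps cdot_smult_left s_def[symmetric]
          bounded_bilinear.add_right[OF bounded_bilinear_cdot] vec_eq_iff axis_component algebra_simps)
  qed
  obtain U' V g g' where U': "open U'" "U' \<subseteq> polydisc r" "0 \<in> U'" and V: "open V" "\<Psi> 0 \<in> V"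
    and hom: "homeomorphism U' V \<Psi> g"
    and g': "\<And>y. y \<in> V \<Longrightarrow> (g has_derivative g' y) (at y)"
      "\<And>y. y \<in> V \<Longrightarrow> g' y = inv (blinfun_apply (\<Psi>' (g y)))"
      "\<And>y. y \<in> V \<Longrightarrow> bij (blinfun_apply (\<Psi>' (g y)))"
    by (rule inverse_function_theorem[OF open_polydisc der cont 0 inv]) (assumption | blast)+
  have \<Psi>0: "\<Psi> 0 = 0" using D(2) by (simp add: \<Psi>_def)
  have g: "g y \<in> polydisc r" "\<Psi> (g y) = y" if "y \<in> V" for y
    using hom U' that by (auto simp: homeomorphism_def)
  have g0: "g 0 = 0" using hom U'(3) \<Psi>0 by (metis homeomorphism_def)
  \<comment> \<open>Implicit differentiation: \<open>w = g' y v\<close> satisfies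
    \<open>w $ j = v $ j\<close> for \<open>j \<noteq> n\<close> and
    \<open>cdot (p (g y)) w = v $ n\<close>. Solving for \<open>w $ n\<close> gives this
    vector.\<close>
  define q where "q y = (1 / p (g y) $ n) *s vupd (- p (g y)) n 1" for y
  have pgn: "p (g y) $ n \<noteq> 0" if "y \<in> V" for y
  proof
    assume *: "p (g y) $ n = 0"
    then have "blinfun_apply (\<Psi>' (g y)) (axis n 1) = blinfun_apply (\<Psi>' (g y)) 0"
      by (simp add: \<Psi>'_apply vec_eq_iff vupd_nth axis_component)
    then have "axis n (1::complex) = 0"
      using g'(3)[OF that] by (meson bij_is_inj injD)
    then show False by (simp add: axis_eq_0_iff)
  qed
  have grad: "has_cgrad (\<lambda>y. g y $ n) (q y) y" if "y \<in> V" for y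
  proof -
    have "((\<lambda>y. g y $ n) has_derivative (\<lambda>v. g' y v $ n)) (at y)"
      by (rule bounded_linear.has_derivative[OF bounded_linear_vec_nth g'(1)[OF that]])
    moreover have "(\<lambda>v. g' y v $ n) = cdot (q y)"
    proof
      fix v
      define w where "w = g' y v"
      have "blinfun_apply (\<Psi>' (g y)) w = v"
        using g'(2,3)[OF that] by (simp add: w_def bij_is_surj surj_f_inv_f)
      then have *: "(if j = n then cdot (p (g y)) w else w $ j) = v $ j" for j
        by (simp add: \<Psi>'_apply vec_eq_iff vupd_nth)
      have w: "w $ j = v $ j" if "j \<noteq> n" for j using *[of j] that by simp
      have wn: "cdot (p (g y)) w = v $ n" using *[of n] by simp
      have "cdot (p (g y)) w = p (g y) $ n * w $ n + (\<Sum>j\<in>UNIV-{n}. p (g y) $ j * v $ j)"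
        unfolding cdot_def by (subst sum.remove[of _ n]) (auto simp: w)
      moreover have "cdot (q y) v = 1 / p (g y) $ n * (v $ n - (\<Sum>j\<in>UNIV-{n}. p (g y) $ j * v $ j))"
        unfolding q_def cdot_smult_left
        by (subst cdot_def, subst sum.remove[of _ n]) (auto simp: sum_negf)
      ultimately show "g' y v $ n = cdot (q y) v"
        using pgn[OF that] wn by (simp add: w_def[symmetric] field_simps)
    qed
    ultimately show ?thesis by (simp add: has_cgrad_def)
  qed
  have contq: "isCont q y" if "y \<in> V" for y
  proof -
    have "isCont g y" using has_derivative_continuous[OF g'(1)[OF that]] .
    moreover have "isCont p (g y)"
      using r(3) g(1)[OF that] open_polydisc continuous_on_eq_continuous_at by blast
    ultimately have pg: "isCont (\<lambda>y. p (g y)) y" by (rule isCont_o2)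
    have "isCont (\<lambda>y. q y $ i) y" for i
      using pgn[OF that] unfolding q_def
      by (cases "i = n") (auto intro!: continuous_intros isCont_vec_nth pg)
    then show ?thesis by (rule isCont_vecI)
  qed
  have evV: "\<forall>\<^sub>0 y. y \<in> V"
    using V \<Psi>0 eventually_nhds by auto
  have "holo (\<lambda>y. g y $ n)"
    unfolding holo_def by (rule exI[of _ q]) (use evV in eventually_elim, auto intro: grad contq)
  then have "holo (\<lambda>x. g (vupd x n 0) $ n)"
    by (rule holo_compose) (auto intro: holomap_vupd)
  moreover have "\<forall>\<^sub>0 x. vupd x n 0 \<in> V"
    by (rule eventually_compose[OF holomap_isCont[OF holomap_vupd[OF holo_const]] vupd_0_0 evV])
  then have "\<forall>\<^sub>0 x. D (vupd x n (g (vupd x n 0) $ n)) = 0"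
  proof eventually_elim
    case (elim x)
    have "vupd (g (vupd x n 0)) n (D (g (vupd x n 0))) = vupd x n 0"
      using g(2)[OF elim] by (simp add: \<Psi>_def)
    then have *: "(if j = n then D (g (vupd x n 0)) else g (vupd x n 0) $ j) = (if j = n then 0 else x $ j)" for j
      by (simp add: vec_eq_iff vupd_nth)
    then have "vupd x n (g (vupd x n 0) $ n) = g (vupd x n 0)"
      unfolding vec_eq_iff vupd_nth using * by metis
    then show ?case using *[of n] by simp
  qed
  ultimately show ?thesis
    by (intro exI[of _ "\<lambda>x. g (vupd x n 0) $ n"]) (auto simp: g0)
qed

section \<open>Local modifications of the coordinates\<close>

definition proj :: "'n set \<Rightarrow> complex^'n \<Rightarrow> complex^'n" where
  "proj S x = (\<chi> i. if i \<in> S then x $ i else 0)"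

lemma proj_nth: "proj S x $ i = (if i \<in> S then x $ i else 0)"
  by (simp add: proj_def)

lemma proj_0 [simp]: "proj S 0 = 0"
  and proj_UNIV [simp]: "proj UNIV x = x"
  and proj_empty [simp]: "proj {} x = 0"
  and proj_proj [simp]: "proj S (proj T x) = proj (S \<inter> T) x"
  by (simp_all add: vec_eq_iff proj_nth)

lemma holomap_proj: "holomap (proj S)"
  unfolding holomap_def
proof
  fix i show "holo (\<lambda>x. proj S x $ i)"
    by (cases "i \<in> S") (simp_all add: proj_nth)
qed

lemma isCont_proj: "isCont (proj S) 0"
  by (rule holomap_isCont[OF holomap_proj])

text \<open>The induction on the number of variables runs inside the fixed type
  \<open>complex^'n\<close>: having fewer variables means depending on a smaller set of
  coordinates.\<close>

definition dep :: "'n set \<Rightarrow> (complex^'n \<Rightarrow> 'a) \<Rightarrow> bool" where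
  "dep S f \<longleftrightarrow> (\<forall>x. f (proj S x) = f x)"

lemma depD: "dep S f \<Longrightarrow> f (proj S x) = f x"
  by (simp add: dep_def)

lemma dep_cong: "dep S f \<Longrightarrow> (\<And>i. i \<in> S \<Longrightarrow> x $ i = y $ i) \<Longrightarrow> f x = f y"
proof -
  assume "dep S f" "\<And>i. i \<in> S \<Longrightarrow> x $ i = y $ i"
  then have "proj S x = proj S y" by (simp add: vec_eq_iff proj_nth)
  with \<open>dep S f\<close> show ?thesis by (metis depD)
qed

lemma depI: "(\<And>x y. (\<And>i. i \<in> S \<Longrightarrow> x $ i = y $ i) \<Longrightarrow> f x = f y) \<Longrightarrow> dep S f"
  unfolding dep_def by (rule allI, drule meta_spec, drule meta_spec, erule meta_mp) (simp add: proj_nth)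

lemma dep_UNIV [simp]: "dep UNIV f"
  by (simp add: dep_def)

lemma dep_mono: "dep S f \<Longrightarrow> S \<subseteq> T \<Longrightarrow> dep T f"
  by (rule depI, erule dep_cong) blast

lemma dep_proj: "dep S (\<lambda>x. f (proj S x))"
  by (simp add: dep_def)

lemma dep_const: "dep S (\<lambda>x. c)"
  by (simp add: dep_def)

lemma dep_add: "dep S f \<Longrightarrow> dep S g \<Longrightarrow> dep S (\<lambda>x. f x + g x)"
  and dep_diff: "dep S f \<Longrightarrow> dep S g \<Longrightarrow> dep S (\<lambda>x. f x - g x)"
  and dep_mult: "dep S f \<Longrightarrow> dep S g \<Longrightarrow> dep S (\<lambda>x. f x * g x)"
  and dep_power: "dep S f \<Longrightarrow> dep S (\<lambda>x. f x ^ k)"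
  by (simp_all add: dep_def)

lemma dep_sum: "(\<And>i. i \<in> A \<Longrightarrow> dep S (f i)) \<Longrightarrow> dep S (\<lambda>x. \<Sum>i\<in>A. f i x)"
  and dep_prod: "(\<And>i. i \<in> A \<Longrightarrow> dep S (g i)) \<Longrightarrow> dep S (\<lambda>x. \<Prod>i\<in>A. g i x)"
  by (simp_all add: dep_def)

lemma dep_nth: "i \<in> S \<Longrightarrow> dep S (\<lambda>x. x $ i)"
  by (simp add: dep_def proj_nth)

lemmas dep_intros = dep_add dep_diff dep_mult dep_power dep_sum dep_prod dep_nth dep_const

lemma dep_vupd: "dep S f \<Longrightarrow> n \<notin> S \<Longrightarrow> f (vupd x n c) = f x"
  by (erule dep_cong) (auto simp: vupd_nth)

text \<open>Maps that change the coordinates in \<open>S\<close> only, and independently of the other coordinates. Families of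
  such maps are used as charts around \<open>0\<close>, so all of them fix \<open>0\<close>.\<close>

definition adm :: "'n set \<Rightarrow> (complex^'n \<Rightarrow> complex^'n) \<Rightarrow> bool" where
  "adm S \<phi> \<longleftrightarrow> holomap \<phi> \<and> \<phi> 0 = 0 \<and> (\<forall>i\<in>S. dep S (\<lambda>x. \<phi> x $ i)) \<and> (\<forall>i. i \<notin> S \<longrightarrow> (\<forall>x. \<phi> x $ i = x $ i))"

lemma admD: "adm S \<phi> \<Longrightarrow> holomap \<phi>" "adm S \<phi> \<Longrightarrow> \<phi> 0 = 0"
  "adm S \<phi> \<Longrightarrow> i \<notin> S \<Longrightarrow> \<phi> x $ i = x $ i"
  by (auto simp: adm_def)

lemma adm_holo: "adm S \<phi> \<Longrightarrow> holo f \<Longrightarrow> holo (\<lambda>x. f (\<phi> x))"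
  by (auto intro: holo_compose admD)

lemma adm_eventually: "adm S \<phi> \<Longrightarrow> \<forall>\<^sub>0 x. P x \<Longrightarrow> \<forall>\<^sub>0 x. P (\<phi> x)"
  by (rule eventually_compose) (auto intro: holomap_isCont admD)

lemma adm_dep:
  fixes \<phi> :: "complex^'n \<Rightarrow> complex^'n"
  shows "adm S \<phi> \<Longrightarrow> dep T f \<Longrightarrow> S \<subseteq> T \<Longrightarrow> dep T (\<lambda>x. f (\<phi> x))"
proof (rule depI)
  fix x y :: "complex^'n" assume *: "adm S \<phi>" "dep T f" "S \<subseteq> T" "\<And>i. i \<in> T \<Longrightarrow> x $ i = y $ i"
  show "f (\<phi> x) = f (\<phi> y)"
  proof (rule dep_cong[OF *(2)])
    fix i assume "i \<in> T"
    show "\<phi> x $ i = \<phi> y $ i"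
    proof (cases "i \<in> S")
      case True
      then have "dep S (\<lambda>x. \<phi> x $ i)" using *(1) by (simp add: adm_def)
      then show ?thesis by (rule dep_cong) (use * in blast)
    next
      case False
      then show ?thesis using *(4)[OF \<open>i \<in> T\<close>] admD(3)[OF *(1)] by simp
    qed
  qed
qed

lemma adm_mono:
  assumes "adm S \<phi>" "S \<subseteq> T"
  shows "adm T \<phi>"
  unfolding adm_def
proof (intro conjI ballI allI impI)
  show "dep T (\<lambda>x. \<phi> x $ i)" if "i \<in> T" for i
    using adm_dep[OF assms(1) dep_nth[OF that] assms(2)] .
  show "\<phi> x $ i = x $ i" if "i \<notin> T" for i x
    using admD(3)[OF assms(1), of i] that assms(2) by blast
qed (use admD[OF assms(1)] in auto)

lemma adm_id: "adm S (\<lambda>x. x)"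
  by (simp add: adm_def dep_nth holomap_def)

lemma adm_compose:
  assumes "adm S \<phi>" "adm S \<psi>"
  shows "adm S (\<lambda>x. \<phi> (\<psi> x))"
  unfolding adm_def
proof (intro conjI ballI allI impI)
  show "holomap (\<lambda>x. \<phi> (\<psi> x))"
    by (rule holomap_compose) (use assms admD in auto)
  show "\<phi> (\<psi> 0) = 0" using admD(2) assms by metis
  show "dep S (\<lambda>x. \<phi> (\<psi> x) $ i)" if "i \<in> S" for i
    using adm_dep[OF assms(2), of S "\<lambda>x. \<phi> x $ i"] assms(1) that by (simp add: adm_def)
  show "\<phi> (\<psi> x) $ i = x $ i" if "i \<notin> S" for i x
    using admD(3)[OF assms(1) that] admD(3)[OF assms(2) that] by simp
qed

text \<open>However small the charts of the family \<open>\<Phi>\<close> are taken, finitely many of them suffice.\<close>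

definition cover :: "(complex^'n \<Rightarrow> complex^'n) set \<Rightarrow> bool" where
  "cover \<Phi> \<longleftrightarrow> (\<forall>N. (\<forall>\<phi>\<in>\<Phi>. \<forall>\<^sub>0 y. y \<in> N \<phi>) \<longrightarrow>
     (\<exists>\<Phi>'\<subseteq>\<Phi>. finite \<Phi>' \<and> (\<forall>\<^sub>0 x. \<exists>\<phi>\<in>\<Phi>'. \<exists>y\<in>N \<phi>. \<phi> y = x)))"

lemma coverD:
  assumes "cover \<Phi>" "\<And>\<phi>. \<phi> \<in> \<Phi> \<Longrightarrow> \<forall>\<^sub>0 y. y \<in> N \<phi>"
  shows "\<exists>\<Phi>'\<subseteq>\<Phi>. finite \<Phi>' \<and> (\<forall>\<^sub>0 x. \<exists>\<phi>\<in>\<Phi>'. \<exists>y\<in>N \<phi>. \<phi> y = x)"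
  using assms(1)[unfolded cover_def, THEN spec[of _ N], THEN mp] assms(2) by simp

text \<open>The inner covers are used first: what finitely many shrunken charts
  \<open>\<gamma>\<close> reach, the set \<open>W\<close>, is a neighbourhood of 0, and it is then
  imposed on \<open>\<phi>\<close> as the shrinking in the outer cover.\<close>

lemma cover_bind:
  fixes \<Phi> :: "(complex^'n \<Rightarrow> complex^'n) set"
  assumes "cover \<Phi>" "\<And>\<phi>. \<phi> \<in> \<Phi> \<Longrightarrow> cover (\<Gamma> \<phi>)"
  shows "cover (\<Union>\<phi>\<in>\<Phi>. (\<lambda>\<gamma> x. \<phi> (\<gamma> x)) ` \<Gamma> \<phi>)"
  unfolding cover_def
proof (intro allI impI)
  fix N :: "(complex^'n \<Rightarrow> complex^'n) \<Rightarrow> (complex^'n) set"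
  assume N: "\<forall>\<phi>\<in>(\<Union>\<phi>\<in>\<Phi>. (\<lambda>\<gamma> x. \<phi> (\<gamma> x)) ` \<Gamma> \<phi>). \<forall>\<^sub>0 y. y \<in> N \<phi>"
  define W where "W \<phi> G = {x. \<exists>\<gamma>\<in>G. \<exists>y\<in>N (\<lambda>x. \<phi> (\<gamma> x)). \<gamma> y = x}"
    for \<phi> :: "complex^'n \<Rightarrow> complex^'n" and G
  have "\<exists>G\<subseteq>\<Gamma> \<phi>. finite G \<and> (\<forall>\<^sub>0 x. x \<in> W \<phi> G)" if "\<phi> \<in> \<Phi>" for \<phi>
  proof -
    have "\<forall>\<^sub>0 y. y \<in> N (\<lambda>x. \<phi> (\<gamma> x))" if "\<gamma> \<in> \<Gamma> \<phi>" for \<gamma>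
      by (rule N[rule_format]) (use that \<open>\<phi> \<in> \<Phi>\<close> in blast)
    from coverD[OF assms(2)[OF \<open>\<phi> \<in> \<Phi>\<close>], of "\<lambda>\<gamma>. N (\<lambda>x. \<phi> (\<gamma> x))", OF this]
    show ?thesis unfolding W_def mem_Collect_eq .
  qed
  then obtain G where G: "\<And>\<phi>. \<phi> \<in> \<Phi> \<Longrightarrow> G \<phi> \<subseteq> \<Gamma> \<phi> \<and> finite (G \<phi>) \<and> (\<forall>\<^sub>0 x. x \<in> W \<phi> (G \<phi>))"
    by metis
  obtain \<Phi>' where \<Phi>': "\<Phi>' \<subseteq> \<Phi>" "finite \<Phi>'" "\<forall>\<^sub>0 x. \<exists>\<phi>\<in>\<Phi>'. \<exists>y\<in>W \<phi> (G \<phi>). \<phi> y = x"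
    using coverD[OF assms(1), of "\<lambda>\<phi>. W \<phi> (G \<phi>)"] G by blast
  show "\<exists>\<Phi>'\<subseteq>\<Union>\<phi>\<in>\<Phi>. (\<lambda>\<gamma> x. \<phi> (\<gamma> x)) ` \<Gamma> \<phi>. finite \<Phi>' \<and> (\<forall>\<^sub>0 x. \<exists>\<phi>\<in>\<Phi>'. \<exists>y\<in>N \<phi>. \<phi> y = x)"
  proof (intro exI[of _ "\<Union>\<phi>\<in>\<Phi>'. (\<lambda>\<gamma> x. \<phi> (\<gamma> x)) ` G \<phi>"] conjI)
    show "(\<Union>\<phi>\<in>\<Phi>'. (\<lambda>\<gamma> x. \<phi> (\<gamma> x)) ` G \<phi>) \<subseteq> (\<Union>\<phi>\<in>\<Phi>. (\<lambda>\<gamma> x. \<phi> (\<gamma> x)) ` \<Gamma> \<phi>)"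
      using G \<Phi>'(1) by (intro UN_mono image_mono) auto
    show "finite (\<Union>\<phi>\<in>\<Phi>'. (\<lambda>\<gamma> x. \<phi> (\<gamma> x)) ` G \<phi>)"
      using G \<Phi>'(1,2) by (intro finite_UN_I finite_imageI) auto
    show "\<forall>\<^sub>0 x. \<exists>\<phi>\<in>\<Union>\<phi>\<in>\<Phi>'. (\<lambda>\<gamma> x. \<phi> (\<gamma> x)) ` G \<phi>. \<exists>y\<in>N \<phi>. \<phi> y = x"
      using \<Phi>'(3)
    proof eventually_elim
      case (elim x)
      then obtain \<phi> y \<gamma> z where *: "\<phi> \<in> \<Phi>'" "\<gamma> \<in> G \<phi>" "z \<in> N (\<lambda>x. \<phi> (\<gamma> x))" "\<phi> (\<gamma> z) = x"
        unfolding W_def by blast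
      show ?case
      proof (intro bexI[of _ "\<lambda>x. \<phi> (\<gamma> x)"] bexI[of _ z])
        show "(\<lambda>x. \<phi> (\<gamma> x)) \<in> (\<Union>\<phi>\<in>\<Phi>'. (\<lambda>\<gamma> x. \<phi> (\<gamma> x)) ` G \<phi>)"
          by (rule UN_I[OF *(1)], rule imageI[OF *(2)])
      qed (use * in auto)
    qed
  qed
qed

text \<open>A quantifier ``locally, after a modification of the coordinates in \<open>S\<close>''; \<open>loc_bind\<close> below allows
  to chain modifications.\<close>

definition loc :: "'n set \<Rightarrow> ((complex^'n \<Rightarrow> complex^'n) \<Rightarrow> bool) \<Rightarrow> bool" where
  "loc S Q \<longleftrightarrow> (\<exists>\<Phi>. (\<forall>\<phi>\<in>\<Phi>. adm S \<phi> \<and> Q \<phi>) \<and> cover \<Phi>)"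

lemma loc_bind:
  assumes "loc S Q" "\<And>\<phi>. adm S \<phi> \<Longrightarrow> Q \<phi> \<Longrightarrow> loc S (\<lambda>\<psi>. Q' (\<lambda>x. \<phi> (\<psi> x)))"
  shows "loc S Q'"
proof -
  obtain \<Phi> where \<Phi>: "\<And>\<phi>. \<phi> \<in> \<Phi> \<Longrightarrow> adm S \<phi> \<and> Q \<phi>" "cover \<Phi>"
    using assms(1) unfolding loc_def by blast
  have "\<forall>\<phi>\<in>\<Phi>. \<exists>\<Gamma>. (\<forall>\<psi>\<in>\<Gamma>. adm S \<psi> \<and> Q' (\<lambda>x. \<phi> (\<psi> x))) \<and> cover \<Gamma>"
    using assms(2) \<Phi>(1) unfolding loc_def by blast
  then obtain \<Gamma> where \<Gamma>: "\<And>\<phi> \<psi>. \<phi> \<in> \<Phi> \<Longrightarrow> \<psi> \<in> \<Gamma> \<phi> \<Longrightarrow> adm S \<psi> \<and> Q' (\<lambda>x. \<phi> (\<psi> x))"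
    "\<And>\<phi>. \<phi> \<in> \<Phi> \<Longrightarrow> cover (\<Gamma> \<phi>)"
    by metis
  have "cover (\<Union>\<phi>\<in>\<Phi>. (\<lambda>\<gamma> x. \<phi> (\<gamma> x)) ` \<Gamma> \<phi>)"
    by (rule cover_bind[OF \<Phi>(2) \<Gamma>(2)])
  moreover have "adm S \<phi> \<and> Q' \<phi>" if "\<phi> \<in> (\<Union>\<phi>\<in>\<Phi>. (\<lambda>\<gamma> x. \<phi> (\<gamma> x)) ` \<Gamma> \<phi>)" for \<phi>
  proof -
    obtain \<psi> \<gamma> where *: "\<psi> \<in> \<Phi>" "\<gamma> \<in> \<Gamma> \<psi>" "\<phi> = (\<lambda>x. \<psi> (\<gamma> x))"
      using \<open>\<phi> \<in> _\<close> by (elim UN_E imageE) blast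
    show ?thesis
      using adm_compose[of S \<psi> \<gamma>] \<Gamma>(1)[OF *(1,2)] \<Phi>(1)[OF *(1)] unfolding *(3) by blast
  qed
  ultimately show ?thesis unfolding loc_def by blast
qed

lemma loc_mono: "loc S Q \<Longrightarrow> S \<subseteq> T \<Longrightarrow> (\<And>\<phi>. adm S \<phi> \<Longrightarrow> Q \<phi> \<Longrightarrow> Q' \<phi>) \<Longrightarrow> loc T Q'"
  unfolding loc_def using adm_mono by (elim exE) (rename_tac \<Phi>, rule_tac x=\<Phi> in exI, blast)

text \<open>A single chart covers as soon as it has a local right inverse continuous at 0. That
  inverse need not be holomorphic, which admits branches of roots.\<close>

lemma loc_single:
  fixes \<phi> :: "complex^'n \<Rightarrow> complex^'n"
  assumes "adm S \<phi>" "Q \<phi>" "isCont \<theta> 0" "\<theta> 0 = 0" "\<forall>\<^sub>0 x. \<phi> (\<theta> x) = x"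
  shows "loc S Q"
  unfolding loc_def cover_def
proof (intro exI[of _ "{\<phi>}"] conjI allI impI exI[of _ "{\<phi>}"])
  fix N :: "(complex^'n \<Rightarrow> complex^'n) \<Rightarrow> (complex^'n) set"
  assume N: "\<forall>\<phi>\<in>{\<phi>}. \<forall>\<^sub>0 y. y \<in> N \<phi>"
  have "\<forall>\<^sub>0 x. \<theta> x \<in> N \<phi>"
    by (rule eventually_compose[OF assms(3,4)]) (use N in auto)
  with assms(5) show "\<forall>\<^sub>0 x. \<exists>\<phi>\<in>{\<phi>}. \<exists>y\<in>N \<phi>. \<phi> y = x"
    by eventually_elim auto
qed (use assms in auto)

lemma loc_return: "Q (\<lambda>x. x) \<Longrightarrow> loc S Q"
  by (rule loc_single[OF adm_id, of _ "\<lambda>x. x"]) auto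

lemma loc_adm:
  assumes "loc S (\<lambda>\<psi>. Q (\<lambda>x. \<phi> (\<psi> x)))" "adm S \<phi>" "isCont \<theta> 0" "\<theta> 0 = 0" "\<forall>\<^sub>0 x. \<phi> (\<theta> x) = x"
  shows "loc S Q"
  by (rule loc_bind[of S "\<lambda>\<psi>. \<psi> = \<phi>"]) (use assms loc_single[OF assms(2) _ assms(3-5)] in auto)

lemma adm_vupd:
  assumes "holo f" "f 0 = 0" "dep S f" "n \<in> S"
  shows "adm S (\<lambda>x. vupd x n (f x))"
  using assms holomap_vupd unfolding adm_def
  by (auto simp: vupd_nth dep_def proj_nth)

text \<open>The charts of the blow-up are indexed by the points \<open>\<mu>\<close> of the exceptional line and the
  point at infinity; finitely many suffice since this projective line is compact.\<close>

lemma loc_blowup: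
  assumes jn: "j \<in> S" "n \<in> S" "j \<noteq> n"
    and 1: "\<And>\<mu>. loc S (\<lambda>\<psi>. Q (\<lambda>x. vupd (\<psi> x) n (\<psi> x $ j * (\<psi> x $ n + \<mu>))))"
    and 2: "loc S (\<lambda>\<psi>. Q (\<lambda>x. vupd (\<psi> x) j (\<psi> x $ j * \<psi> x $ n)))"
  shows "loc S Q"
proof -
  define c1 where "c1 = (\<lambda>\<mu> (x::complex^'a). vupd x n (x $ j * (x $ n + \<mu>)))"
  define c2 where "c2 = (\<lambda>x::complex^'a. vupd x j (x $ j * x $ n))"
  let ?\<Phi> = "insert c2 (range c1)"
  have a1: "adm S (c1 \<mu>)" for \<mu>
    unfolding c1_def
    by (intro adm_vupd holo_mult holo_add holo_nth holo_const dep_intros) (use jn in simp_all)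
  have a2: "adm S c2"
    unfolding c2_def
    by (intro adm_vupd holo_mult holo_nth dep_intros) (use jn in simp_all)
  have "cover ?\<Phi>" unfolding cover_def
  proof (intro allI impI)
    fix N :: "(complex^'a \<Rightarrow> complex^'a) \<Rightarrow> (complex^'a) set"
    assume N: "\<forall>\<phi>\<in>?\<Phi>. \<forall>\<^sub>0 y. y \<in> N \<phi>"
    then have "\<forall>\<mu>. \<exists>r>0. \<forall>y\<in>polydisc r. y \<in> N (c1 \<mu>)"
      by (simp add: eventually_nhds_0_polydisc)
    then obtain r where r: "\<And>\<mu>. r \<mu> > 0" "\<And>\<mu> y. y \<in> polydisc (r \<mu>) \<Longrightarrow> y \<in> N (c1 \<mu>)" by metis
    obtain s where s: "s > 0" "\<And>y. y \<in> polydisc s \<Longrightarrow> y \<in> N c2"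
      using N by (auto simp: eventually_nhds_0_polydisc)
    \<comment> \<open>The chart at infinity reaches the points with
      \<open>norm (x $ j) < s * norm (x $ n)\<close>; the slopes \<open>x $ n / x $ j\<close> left
      over lie in this disc.\<close>
    have "compact (cball (0::complex) (1 / s))" by simp
    moreover have "cball 0 (1 / s) \<subseteq> (\<Union>\<mu>\<in>cball 0 (1/s). ball \<mu> (r \<mu>))"
      using r(1) by force
    ultimately obtain C where C: "C \<subseteq> cball 0 (1 / s)" "finite C" "cball 0 (1 / s) \<subseteq> (\<Union>\<mu>\<in>C. ball \<mu> (r \<mu>))"
      by (elim compactE_image[where f = "\<lambda>\<mu>. ball \<mu> (r \<mu>)"]) auto
    define \<epsilon> where "\<epsilon> = Min (insert s (r ` C))"
    have \<epsilon>: "\<epsilon> > 0" "\<epsilon> \<le> s" "\<And>\<mu>. \<mu> \<in> C \<Longrightarrow> \<epsilon> \<le> r \<mu>"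
      using C(2) r(1) s(1) by (auto simp: \<epsilon>_def)
    show "\<exists>\<Phi>'\<subseteq>?\<Phi>. finite \<Phi>' \<and> (\<forall>\<^sub>0 x. \<exists>\<phi>\<in>\<Phi>'. \<exists>y\<in>N \<phi>. \<phi> y = x)"
    proof (intro exI[of _ "insert c2 (c1 ` C)"] conjI)
      show "\<forall>\<^sub>0 x. \<exists>\<phi>\<in>insert c2 (c1 ` C). \<exists>y\<in>N \<phi>. \<phi> y = x"
        unfolding eventually_nhds_0_polydisc
      proof (intro exI[of _ \<epsilon>] conjI \<epsilon>(1) ballI)
        fix x :: "complex^'a" assume x: "x \<in> polydisc \<epsilon>"
        have xi: "norm (x $ i) < \<epsilon>" for i using x by (simp add: mem_polydisc)
        show "\<exists>\<phi>\<in>insert c2 (c1 ` C). \<exists>y\<in>N \<phi>. \<phi> y = x"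
        proof (cases "norm (x $ j) < s * norm (x $ n)")
          case True
          then have xn: "x $ n \<noteq> 0" by auto
          define y where "y = vupd x j (x $ j / x $ n)"
          have "norm (x $ j / x $ n) < s"
            using True xn by (simp add: norm_divide divide_simps)
          then have "y \<in> polydisc s"
            using xi \<epsilon>(2) by (auto simp: y_def mem_polydisc vupd_nth intro: less_le_trans)
          moreover have "c2 y = x"
            using jn xn by (simp add: c2_def y_def)
          ultimately show ?thesis using s(2) by blast
        next
          case False
          \<comment> \<open>Here \<open>x $ j = 0\<close> forces \<open>x $ n = 0\<close>, so that
            the default \<open>0 / 0 = 0\<close> is a correct slope as well.\<close>
          define \<nu> where "\<nu> = x $ n / x $ j"
          have \<nu>: "x $ j * \<nu> = x $ n"
            using False s(1) by (cases "x $ j = 0") (auto simp: \<nu>_def mult_le_0_iff not_less)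
          have "norm \<nu> \<le> 1 / s"
            using False s(1) by (simp add: \<nu>_def norm_divide divide_simps mult.commute not_less)
          then obtain \<mu> where \<mu>: "\<mu> \<in> C" "dist \<mu> \<nu> < r \<mu>"
            using C(3) by (auto simp: subset_iff)
          define y where "y = vupd x n (\<nu> - \<mu>)"
          have "y \<in> polydisc (r \<mu>)"
            using xi \<epsilon>(3)[OF \<mu>(1)] \<mu>(2)
            by (auto simp: y_def mem_polydisc vupd_nth dist_norm norm_minus_commute intro: less_le_trans)
          moreover have "c1 \<mu> y = x"
            using jn \<nu> by (simp add: c1_def y_def)
          ultimately show ?thesis using r(2) \<mu>(1) by blast
        qed
      qed
    qed (use C(2) in auto)
  qed
  then have "loc S (\<lambda>\<phi>. \<phi> \<in> ?\<Phi>)"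
    using a1 a2 unfolding loc_def by (intro exI[of _ ?\<Phi>]) auto
  then show ?thesis
    by (rule loc_bind) (use 1 2 in \<open>auto simp: c1_def c2_def\<close>)
qed

section \<open>Normal crossings\<close>

definition xpow :: "('n \<Rightarrow> nat) \<Rightarrow> complex^'n \<Rightarrow> complex" where
  "xpow a x = (\<Prod>i\<in>UNIV. x $ i ^ a i)"

lemma xpow_0 [simp]: "xpow (\<lambda>_. 0) x = 1"
  by (simp add: xpow_def)

lemma xpow_add: "xpow (\<lambda>i. a i + b i) x = xpow a x * xpow b x"
  by (simp add: xpow_def power_add prod.distrib)

lemma xpow_mult: "xpow (\<lambda>i. k * a i) x = xpow a x ^ k"
  by (simp add: xpow_def power_mult mult.commute[of k] prod_power_distrib)

lemma xpow_single: "xpow (\<lambda>i. if i = n then k else 0) = (\<lambda>x. x $ n ^ k)"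
  by (simp add: fun_eq_iff xpow_def if_distrib[of "\<lambda>k. _ ^ k"] cong: if_cong)

lemma xpow_remove: "xpow a x = x $ i ^ a i * (\<Prod>j\<in>UNIV - {i}. x $ j ^ a j)"
  unfolding xpow_def by (rule prod.remove) auto

lemma holo_xpow: "holo (xpow a)"
  unfolding xpow_def[abs_def] by (intro holo_prod holo_power holo_nth)

lemma xpow_eq_0_iff: "xpow a x = 0 \<longleftrightarrow> (\<exists>i. a i > 0 \<and> x $ i = 0)"
  by (auto simp: xpow_def)

lemma xpow_dep: "(\<And>i. i \<notin> S \<Longrightarrow> a i = 0) \<Longrightarrow> dep S (xpow a)"
proof (rule depI)
  fix x y :: "complex^'a" assume *: "\<And>i. i \<notin> S \<Longrightarrow> a i = 0" "\<And>i. i \<in> S \<Longrightarrow> x $ i = y $ i"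
  have "x $ i ^ a i = y $ i ^ a i" for i
    using * by (cases "i \<in> S") auto
  then show "xpow a x = xpow a y" by (simp add: xpow_def)
qed

lemma xpow_at_0: "xpow a 0 = (if \<forall>i. a i = 0 then 1 else 0)"
proof (cases "\<forall>i. a i = 0")
  case True
  then have "a = (\<lambda>_. 0)" by auto
  then show ?thesis by simp
next
  case False
  then have "xpow a 0 = 0" by (auto simp: xpow_eq_0_iff)
  with False show ?thesis by simp
qed

text \<open>At a point with entries 0 on \<open>Z\<close> and \<open>\<epsilon>\<close> elsewhere, a
  monomial vanishes exactly if one of its variables lies in \<open>Z\<close>. One
  \<open>\<epsilon>\<close> for all \<open>Z\<close> lets exponents be read off from local
  identities.\<close>

lemma eventually_test_point:
  assumes "\<forall>\<^sub>F x in nhds (0::complex^'n). P x"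
  shows "\<exists>\<epsilon>\<noteq>0. \<forall>Z. P (\<chi> i. if i \<in> Z then 0 else \<epsilon>)"
proof -
  obtain r where r: "r > 0" "\<And>x. x \<in> polydisc r \<Longrightarrow> P x"
    using assms unfolding eventually_nhds_0_polydisc by blast
  have "(\<chi> i. if i \<in> Z then 0 else of_real (r / 2)) \<in> polydisc r" for Z
    using r(1) by (simp add: mem_polydisc)
  then show ?thesis using r
    by (intro exI[of _ "complex_of_real (r / 2)"]) auto
qed

lemma xpow_not_eventually_0: "\<not> (\<forall>\<^sub>0 x. xpow a x = 0)"
proof
  assume "\<forall>\<^sub>0 x. xpow a x = 0"
  from eventually_test_point[OF this] obtain \<epsilon> where \<epsilon>: "\<epsilon> \<noteq> 0"
    "xpow a (\<chi> i. if i \<in> {} then 0 else \<epsilon>) = 0" by blast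
  then show False by (simp add: xpow_eq_0_iff)
qed

lemma nth_not_eventually_0: "\<not> (\<forall>\<^sub>0 x. x $ i = (0::complex))"
  using xpow_not_eventually_0[of "\<lambda>j. if j = i then 1 else 0"] by (simp add: xpow_single)

lemma holo_cancel:
  assumes "holo f" "holo g" "holo h" "\<not> (\<forall>\<^sub>0 x. f x = 0)"
    "\<forall>\<^sub>0 x. f x * g x = f x * h x"
  shows "\<forall>\<^sub>0 x. g x = h x"
proof -
  have "\<forall>\<^sub>0 x. f x * (g x - h x) = 0"
    using assms(5) by eventually_elim (simp add: algebra_simps)
  from holo_zero_divisor[OF assms(1) holo_diff[OF assms(2,3)] this] assms(4)
  have "\<forall>\<^sub>0 x. g x - h x = 0" by blast
  then show ?thesis by eventually_elim simp
qed

text \<open>Normal crossings: a monomial times a unit.\<close>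

definition nc :: "(complex^'n \<Rightarrow> complex) \<Rightarrow> bool" where
  "nc f \<longleftrightarrow> (\<exists>a u. holo u \<and> u 0 \<noteq> 0 \<and> (\<forall>\<^sub>0 x. f x = xpow a x * u x))"

lemma ncI: "holo u \<Longrightarrow> u 0 \<noteq> 0 \<Longrightarrow> \<forall>\<^sub>0 x. f x = xpow a x * u x \<Longrightarrow> nc f"
  unfolding nc_def by blast

lemma nc_unit: "holo u \<Longrightarrow> u 0 \<noteq> 0 \<Longrightarrow> nc u"
  by (rule ncI[of u _ "\<lambda>_. 0"]) simp_all

lemma nc_cong:
  assumes "nc f" and ev: "\<forall>\<^sub>0 x. f x = g x"
  shows "nc g"
proof -
  obtain a u where u: "holo u" "u 0 \<noteq> 0" "\<forall>\<^sub>0 x. f x = xpow a x * u x"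
    using assms(1) unfolding nc_def by blast
  from u(3) ev have "\<forall>\<^sub>0 x. g x = xpow a x * u x"
    by eventually_elim simp
  with u(1,2) show ?thesis by (rule ncI)
qed

lemma nc_mult: assumes "nc f" "nc g" shows "nc (\<lambda>x. f x * g x)"
proof -
  obtain a u b v where *: "holo u" "u 0 \<noteq> 0" "\<forall>\<^sub>0 x. f x = xpow a x * u x"
    "holo v" "v 0 \<noteq> 0" "\<forall>\<^sub>0 x. g x = xpow b x * v x"
    using assms unfolding nc_def by blast
  show ?thesis
  proof (rule ncI)
    show "holo (\<lambda>x. u x * v x)" by (intro holo_mult *)
    show "\<forall>\<^sub>0 x. f x * g x = xpow (\<lambda>i. a i + b i) x * (u x * v x)"
      using *(3,6) by eventually_elim (simp add: xpow_add mult_ac)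
  qed (use * in simp)
qed

lemma nc_xpow: "nc (xpow a)"
  by (rule ncI[of "\<lambda>_. 1" _ a]) simp_all

lemma nc_nth: "nc (\<lambda>x. x $ i)"
  using nc_xpow[of "\<lambda>j. if j = i then 1 else 0"] by (simp add: xpow_single)

lemma nc_power: "nc f \<Longrightarrow> nc (\<lambda>x. f x ^ k)"
  by (induction k) (simp_all add: nc_unit nc_mult)

lemma nc_not_eventually_0: "nc f \<Longrightarrow> \<not> (\<forall>\<^sub>0 x. f x = 0)"
proof
  assume "nc f" "\<forall>\<^sub>0 x. f x = 0"
  then obtain a u where u: "holo u" "u 0 \<noteq> 0" "\<forall>\<^sub>0 x. f x = xpow a x * u x"
    unfolding nc_def by blast
  have "\<forall>\<^sub>0 x. xpow a x = 0"
    using u(3) \<open>\<forall>\<^sub>0 x. f x = 0\<close> holo_eventually_nonzero[OF u(1,2)]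
    by eventually_elim auto
  then show False using xpow_not_eventually_0 by blast
qed

text \<open>Setting the coordinates outside \<open>S\<close> to 0 does not change \<open>f\<close>.
  If the monomial contained one of them, \<open>f\<close> would vanish identically; the unit is
  replaced by its restriction.\<close>

lemma nc_dep:
  assumes "nc f" "dep S f"
  shows "\<exists>a u. (\<forall>i. i \<notin> S \<longrightarrow> a i = 0) \<and> dep S u \<and> holo u \<and> u 0 \<noteq> 0 \<and>
    (\<forall>\<^sub>0 x. f x = xpow a x * u x)"
proof -
  obtain a u where u: "holo u" "u 0 \<noteq> 0" "\<forall>\<^sub>0 x. f x = xpow a x * u x"
    using assms(1) unfolding nc_def by blast
  have ev: "\<forall>\<^sub>0 x. f x = xpow a (proj S x) * u (proj S x)"
    using eventually_compose[OF isCont_proj proj_0 u(3), of S] by (simp add: depD[OF assms(2)])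
  have a: "a i = 0" if "i \<notin> S" for i
  proof (rule ccontr)
    assume "a i \<noteq> 0"
    then have "xpow a (proj S x) = 0" for x using that by (auto simp: xpow_eq_0_iff proj_nth)
    with ev have "\<forall>\<^sub>0 x. f x = 0" by simp
    then show False using nc_not_eventually_0[OF assms(1)] by blast
  qed
  have "dep S (xpow a)" using a by (rule xpow_dep)
  with ev have "\<forall>\<^sub>0 x. f x = xpow a x * u (proj S x)" by (simp add: depD)
  moreover have "holo (\<lambda>x. u (proj S x))" by (rule holo_compose[OF u(1) holomap_proj proj_0])
  ultimately show ?thesis using a u(2)
    by (intro exI[of _ a] exI[of _ "\<lambda>x. u (proj S x)"] conjI dep_proj) auto
qed

lemma holo_divide_coord:
  assumes "holo f" "\<forall>\<^sub>0 x. f (vupd x i 0) = 0"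
  shows "\<exists>g. holo g \<and> (\<forall>\<^sub>0 x. f x = x $ i * g x)"
proof -
  obtain g where "holo g" "\<forall>\<^sub>0 x. f x = f (vupd x i 0) + x $ i * g x"
    using holo_expand[OF assms(1)] by blast
  from this(2) assms(2) have "\<forall>\<^sub>0 x. f x = x $ i * g x" by eventually_elim simp
  with \<open>holo g\<close> show ?thesis by blast
qed

text \<open>Induction on the degree of the monomial in place of unique factorisation: if
  \<open>x $ i\<close> occurs in it, the product vanishes on \<open>x $ i = 0\<close>, hence so does
  one factor, which is then divisible by \<open>x $ i\<close>. Thus resolving one product resolves
  all its factors simultaneously.\<close>

lemma nc_factors:
  assumes "holo f" "holo g" "nc (\<lambda>x. f x * g x)"
  shows "nc f \<and> nc g"
proof -
  obtain a u where u: "holo u" "u 0 \<noteq> 0" "\<forall>\<^sub>0 x. f x * g x = xpow a x * u x"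
    using assms(3) unfolding nc_def by blast
  show ?thesis using assms(1,2) u(3)
  proof (induction "\<Sum>i\<in>UNIV. a i" arbitrary: a f g)
    case 0
    then have "a = (\<lambda>_. 0)" by auto
    with eventually_nhds_x_imp_x[OF 0(4)] u(2) have "f 0 \<noteq> 0" "g 0 \<noteq> 0" by auto
    with 0 show ?case by (simp add: nc_unit)
  next
    case (Suc k)
    then obtain i where i: "a i > 0" by (metis gr0I sum.neutral zero_less_Suc less_irrefl)
    define b where "b = a(i := a i - 1)"
    have ab: "xpow a x = x $ i * xpow b x" for x
      using i by (simp add: xpow_remove[of _ x i] b_def power_eq_if)
    have "(\<Sum>i\<in>UNIV. a i) = Suc (\<Sum>i\<in>UNIV. b i)"
      using i by (simp add: sum.remove[of UNIV i] b_def)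
    with Suc(2) have k: "k = (\<Sum>i\<in>UNIV. b i)" by simp
    have step: "nc f' \<and> nc g'" if fg: "holo f'" "holo g'" "\<forall>\<^sub>0 x. f' x * g' x = xpow a x * u x"
      and 0: "\<forall>\<^sub>0 x. f' (vupd x i 0) = 0" for f' g'
    proof -
      obtain f1 where f1: "holo f1" "\<forall>\<^sub>0 x. f' x = x $ i * f1 x"
        using holo_divide_coord[OF fg(1) 0] by blast
      have "\<forall>\<^sub>0 x. x $ i * (f1 x * g' x) = x $ i * (xpow b x * u x)"
        using fg(3) f1(2) by eventually_elim (simp add: ab mult.assoc)
      from holo_cancel[OF holo_nth holo_mult[OF f1(1) fg(2)] holo_mult[OF holo_xpow u(1)] nth_not_eventually_0 this]
      have "nc f1 \<and> nc g'" by (rule Suc(1)[OF k f1(1) fg(2)])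
      moreover have "nc f'" if "nc f1"
        using nc_cong[OF nc_mult[OF nc_nth that]] f1(2) by (simp add: eq_commute)
      ultimately show ?thesis by blast
    qed
    have hv: "holomap (\<lambda>x::complex^'a. vupd x i 0)" by (rule holomap_vupd) (rule holo_const)
    have "\<forall>\<^sub>0 x. f (vupd x i 0) * g (vupd x i 0) = 0"
      using eventually_compose[OF holomap_isCont[OF hv] vupd_0_0 Suc(5)]
      by (simp add: ab)
    then have "(\<forall>\<^sub>0 x. f (vupd x i 0) = 0) \<or> (\<forall>\<^sub>0 x. g (vupd x i 0) = 0)"
      by (rule holo_zero_divisor[OF holo_compose[OF Suc(3) hv vupd_0_0] holo_compose[OF Suc(4) hv vupd_0_0]])
    then show ?case
      using step[OF Suc(3-5)] step[OF Suc(4,3)] Suc(5) by (auto simp: mult.commute)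
  qed
qed

lemma nc_prod_factor:
  assumes "finite A" "\<And>i. i \<in> A \<Longrightarrow> holo (f i)" "nc (\<lambda>x. \<Prod>i\<in>A. f i x)" "i \<in> A"
  shows "nc (f i)"
proof -
  have "nc (\<lambda>x. f i x * (\<Prod>i\<in>A - {i}. f i x))"
    using assms(3) by (simp add: prod.remove[OF assms(1,4)])
  moreover have "holo (\<lambda>x. \<Prod>i\<in>A - {i}. f i x)"
    by (rule holo_prod) (use assms(2) in blast)
  ultimately show ?thesis using nc_factors[of "f i" "\<lambda>x. \<Prod>i\<in>A - {i}. f i x"] assms(2,4)
    by blast
qed

text \<open>If neither exponent dominates, dividing \<open>f - g\<close> by the common monomial leaves a non-unit that vanishes
  on no coordinate hyperplane.\<close>

lemma nc_exponents_comparable: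
  assumes f: "holo u" "u 0 \<noteq> 0" "\<forall>\<^sub>0 x. f x = xpow a x * u x"
    and g: "holo v" "v 0 \<noteq> 0" "\<forall>\<^sub>0 x. g x = xpow b x * v x"
    and fg: "(\<forall>\<^sub>0 x. f x = g x) \<or> nc (\<lambda>x. f x - g x)"
  shows "(\<forall>i. a i \<le> b i) \<or> (\<forall>i. b i \<le> a i)"
proof (rule ccontr)
  assume "\<not> ?thesis"
  then obtain j k where jk: "a j < b j" "b k < a k" by (auto simp: not_le)
  define d where "d i = min (a i) (b i)" for i
  define a' where "a' i = a i - d i" for i
  define b' where "b' i = b i - d i" for i
  have disj: "a' i = 0 \<or> b' i = 0" for i by (auto simp: a'_def b'_def d_def)
  have jk': "a' j = 0" "b' j > 0" "a' k > 0" "b' k = 0"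
    using jk by (simp_all add: a'_def b'_def d_def)
  have "xpow a x = xpow d x * xpow a' x" "xpow b x = xpow d x * xpow b' x" for x
    unfolding xpow_add[symmetric] by (simp_all add: a'_def b'_def d_def)
  note split = this
  define h where "h x = xpow a' x * u x - xpow b' x * v x" for x
  have h: "holo h" unfolding h_def[abs_def] by (intro holo_diff holo_mult holo_xpow f g)
  have ev: "\<forall>\<^sub>0 x. f x - g x = xpow d x * h x"
    using f(3) g(3) by eventually_elim (simp add: split h_def algebra_simps)
  have ev_nz: "\<forall>\<^sub>0 x. u x \<noteq> 0 \<and> v x \<noteq> 0"
    using holo_eventually_nonzero[OF f(1,2)] holo_eventually_nonzero[OF g(1,2)] by eventually_elim simp
  have *: False if ev0: "\<forall>\<^sub>0 x. x $ i = 0 \<longrightarrow> h x = 0" for i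
  proof -
    obtain \<epsilon> where \<epsilon>: "\<epsilon> \<noteq> 0" "\<And>Z. let x = (\<chi> i. if i \<in> Z then 0 else \<epsilon>) in u x \<noteq> 0 \<and> v x \<noteq> 0 \<and> (x $ i = 0 \<longrightarrow> h x = 0)"
      using eventually_test_point[OF eventually_conj[OF ev_nz ev0]] by (auto simp: Let_def)
    \<comment> \<open>A point with \<open>x $ i = 0\<close> at which exactly one of the two
      monomials vanishes. If \<open>x $ i\<close> occurs in one of them, it is absent from the
      other; if it occurs in neither, setting \<open>x $ j = 0\<close> as well kills only
      \<open>xpow b'\<close>.\<close>
    define Z where "Z = (if a' i > 0 \<or> b' i > 0 then {i} else {i, j})"
    define x :: "complex^'a" where "x = (\<chi> i. if i \<in> Z then 0 else \<epsilon>)"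
    have "u x \<noteq> 0" "v x \<noteq> 0" "h x = 0"
      using \<epsilon>(2)[of Z] by (auto simp: Let_def x_def[symmetric]) (auto simp: x_def Z_def)
    then have "xpow a' x = 0 \<longleftrightarrow> xpow b' x = 0" by (auto simp: h_def)
    moreover have "xpow c x = 0 \<longleftrightarrow> (\<exists>i\<in>Z. c i > 0)" for c
      using \<epsilon>(1) by (auto simp: xpow_eq_0_iff x_def)
    ultimately show False using disj[of i] jk' by (auto simp: Z_def split: if_splits)
  qed
  from fg show False
  proof
    assume "\<forall>\<^sub>0 x. f x = g x"
    with ev have "\<forall>\<^sub>0 x. xpow d x * h x = 0" by eventually_elim simp
    from holo_zero_divisor[OF holo_xpow h this] xpow_not_eventually_0
    have "\<forall>\<^sub>0 x. h x = 0" by blast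
    then have "\<forall>\<^sub>0 x. x $ j = 0 \<longrightarrow> h x = 0" by eventually_elim simp
    then show False by (rule *)
  next
    assume "nc (\<lambda>x. f x - g x)"
    from nc_cong[OF this ev] have "nc h" using nc_factors[OF holo_xpow h] by blast
    then obtain c w where w: "holo w" "w 0 \<noteq> 0" "\<forall>\<^sub>0 x. h x = xpow c x * w x"
      unfolding nc_def by blast
    have "h 0 = 0" using jk' by (auto simp: h_def xpow_at_0)
    with eventually_nhds_x_imp_x[OF w(3)] w(2) have "xpow c 0 = 0" by simp
    then obtain i where i: "c i > 0" by (auto simp: xpow_eq_0_iff)
    have "\<forall>\<^sub>0 x. x $ i = 0 \<longrightarrow> h x = 0"
      using w(3) by eventually_elim (use i in \<open>auto simp: xpow_eq_0_iff\<close>)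
    then show False by (rule *)
  qed
qed

section \<open>Expansion in one coordinate and blowing up\<close>

lemma higher_deriv_taylor_coeffs:
  fixes f w :: "complex \<Rightarrow> complex"
  assumes w: "w analytic_on {0}"
    and f: "\<forall>\<^sub>0 t. f t = (\<Sum>i<d. c i * t ^ i) + t ^ d * w t"
  shows "k < d \<Longrightarrow> (deriv ^^ k) f 0 = fact k * c k" "(deriv ^^ d) f 0 = fact d * w 0"
proof -
  obtain W where W: "w has_fps_expansion W"
    using analytic_at_imp_has_fps_expansion_0[OF w] by blast
  define F where "F = (\<Sum>i<d. fps_const (c i) * fps_X ^ i) + fps_X ^ d * W"
  have "(\<lambda>t. (\<Sum>i<d. c i * t ^ i) + t ^ d * w t) has_fps_expansion F"
    unfolding F_def
    by (intro has_fps_expansion_add has_fps_expansion_sum has_fps_expansion_mult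
        has_fps_expansion_const has_fps_expansion_fps_X_power W)
  then have "f has_fps_expansion F"
    using has_fps_expansion_cong[OF f refl] by blast
  note nth = fps_nth_fps_expansion[OF this]
  have F: "fps_nth F k = (\<Sum>i<d. if i = k then c i else 0) + (if k < d then 0 else fps_nth W (k - d))" for k
    unfolding F_def fps_add_nth fps_sum_nth
    by (rule arg_cong2[where f = "(+)"], rule sum.cong)
       (auto simp: fps_X_power_nth fps_X_power_mult_nth)
  show "(deriv ^^ k) f 0 = fact k * c k" if "k < d"
    using nth[of k] that by (simp add: F field_simps)
  have "fps_nth W 0 = w 0" using fps_nth_fps_expansion[OF W, of 0] by simp
  then show "(deriv ^^ d) f 0 = fact d * w 0"
    using nth[of d] by (simp add: F field_simps)
qed

lemma higher_deriv_shift: "(deriv ^^ k) (\<lambda>t. f (t + c)) z = (deriv ^^ k) f (z + c)"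
proof (induction k arbitrary: z)
  case (Suc k)
  have "(deriv ^^ k) (\<lambda>t. f (t + c)) = (\<lambda>z. (deriv ^^ k) f (z + c))"
    using Suc by (simp add: fun_eq_iff)
  moreover have "deriv (\<lambda>z. F (z + c)) z = deriv F (z + c)" for F
    by (simp add: deriv_def DERIV_shift)
  ultimately show ?case by simp
qed simp

lemma higher_deriv_sum:
  assumes "\<And>i. i \<in> A \<Longrightarrow> f i analytic_on {z}"
  shows "(deriv ^^ k) (\<lambda>w. \<Sum>i\<in>A. f i w) z = (\<Sum>i\<in>A. (deriv ^^ k) (f i) z)"
  using assms
proof (induction A rule: infinite_finite_induct)
  case (insert i A)
  then show ?case
    using higher_deriv_add_at[of "f i" z "\<lambda>w. \<Sum>i\<in>A. f i w" k] analytic_on_sum[of A f "{z}"] by simp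
qed simp_all

text \<open>Since there is no term \<open>(t + \<mu>) ^ e\<close>, only the last summand contributes. This is the reason why
  the order drops away from the centre of a blow-up chart.\<close>

lemma higher_deriv_gap_nonzero:
  fixes \<mu> K :: complex
  assumes "\<mu> \<noteq> 0" "K \<noteq> 0"
  shows "(deriv ^^ e) (\<lambda>t. (\<Sum>i<e. C i * (t + \<mu>) ^ i) + (t + \<mu>) ^ Suc e * K) 0 \<noteq> 0"
proof -
  have p: "(deriv ^^ e) (\<lambda>w. c * w ^ i) \<mu> = c * (pochhammer (of_nat (Suc i - e)) e * \<mu> ^ (i - e))" for c i
    using higher_deriv_power[of e 0 i \<mu>] by (subst higher_deriv_cmult[of _ UNIV]) (auto intro: holomorphic_intros)
  have an: "(\<lambda>w. c * w ^ i) analytic_on {\<mu>}" for c i by (intro analytic_intros)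
  have "(deriv ^^ e) (\<lambda>t. (\<Sum>i<e. C i * (t + \<mu>) ^ i) + (t + \<mu>) ^ Suc e * K) 0
      = (deriv ^^ e) (\<lambda>t. (\<Sum>i<e. C i * t ^ i) + K * t ^ Suc e) \<mu>"
    using higher_deriv_shift[of e "\<lambda>t. (\<Sum>i<e. C i * t ^ i) + K * t ^ Suc e" \<mu> 0] by (simp add: mult.commute)
  also have "\<dots> = (\<Sum>i<e. (deriv ^^ e) (\<lambda>t. C i * t ^ i) \<mu>) + (deriv ^^ e) (\<lambda>t. K * t ^ Suc e) \<mu>"
    by (subst higher_deriv_add_at) (auto intro!: analytic_intros simp: higher_deriv_sum[OF an])
  \<comment> \<open>For \<open>i < e\<close> the truncated \<open>Suc i - e\<close> is 0, and
    \<open>pochhammer 0 e = 0\<close> since \<open>e > 0\<close>. The term of degree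
    \<open>Suc e\<close> keeps one factor \<open>\<mu>\<close>, hence the hypothesis
    \<open>\<mu> \<noteq> 0\<close>.\<close>
  also have "(\<Sum>i<e. (deriv ^^ e) (\<lambda>t. C i * t ^ i) \<mu>) = 0"
    unfolding p by (intro sum.neutral) (auto simp: pochhammer_0_left)
  also have "0 + (deriv ^^ e) (\<lambda>t. K * t ^ Suc e) \<mu> = K * (pochhammer 2 e * \<mu>)"
    unfolding p by simp
  also have "\<dots> \<noteq> 0"
  proof -
    have "pochhammer (2::complex) e \<noteq> 0"
      by (metis of_nat_numeral pochhammer_of_nat of_nat_eq_0_iff pochhammer_pos zero_less_numeral less_numeral_extra(3))
    with assms show ?thesis by simp
  qed
  finally show ?thesis .
qed

lemma holo_slice_analytic:
  assumes "holo f"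
  shows "\<forall>\<^sub>0 x. (\<lambda>t. f (vupd x n t)) analytic_on {0}"
proof -
  obtain r p where r: "r > 0" "\<And>x. x \<in> polydisc r \<Longrightarrow> has_cgrad f (p x) x" "continuous_on (polydisc r) p"
    using holo_polydisc[OF assms] by blast
  have "(\<lambda>t. f (vupd x n t)) analytic_on {0}" if "x \<in> polydisc r" for x
    using holomorphic_on_slice[OF r(2) that] r(1)
    by (intro analytic_at[THEN iffD2] exI[of _ "ball 0 r"]) auto
  then show ?thesis using r(1) by (auto simp: eventually_nhds_0_polydisc)
qed

lemma eventually_slice:
  assumes "\<forall>\<^sub>F x in nhds (0::complex^'n). P x"
  shows "\<forall>\<^sub>0 x. \<forall>\<^sub>0 t. P (vupd x n t)"
proof -
  obtain r where r: "r > 0" "\<And>x. x \<in> polydisc r \<Longrightarrow> P x"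
    using assms unfolding eventually_nhds_0_polydisc by blast
  have "\<forall>\<^sub>0 t. P (vupd x n t)" if "x \<in> polydisc r" for x
    unfolding eventually_nhds_metric
    using r vupd_polydisc[OF that] by (intro exI[of _ r]) auto
  then show ?thesis using r(1) by (auto simp: eventually_nhds_0_polydisc)
qed

lemma taylor_coeffs:
  assumes "n \<notin> S" "\<And>i. i < d \<Longrightarrow> dep S (a i)" "holo U"
    and g: "\<forall>\<^sub>0 x. g x = (\<Sum>i<d. a i x * x $ n ^ i) + x $ n ^ d * U x"
  shows "\<forall>\<^sub>0 x. (\<forall>k<d. (deriv ^^ k) (\<lambda>t. g (vupd x n t)) 0 = fact k * a k x) \<and>
    (deriv ^^ d) (\<lambda>t. g (vupd x n t)) 0 = fact d * U (vupd x n 0)"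
  using eventually_slice[OF g, of n] holo_slice_analytic[OF assms(3), of n]
proof eventually_elim
  case (elim x)
  have "\<forall>\<^sub>0 t. g (vupd x n t) = (\<Sum>i<d. a i x * t ^ i) + t ^ d * U (vupd x n t)"
    using elim(1) by eventually_elim (simp add: dep_vupd[OF assms(2,1)])
  from higher_deriv_taylor_coeffs[OF elim(2) this] show ?case by blast
qed

text \<open>Repeated division by \<open>x $ n\<close>. Each quotient is composed with
  \<open>proj\<close>, because \<open>holo_expand\<close> does not tell on which coordinates its
  quotient depends.\<close>

lemma holo_taylor:
  assumes g: "holo g" "dep (insert n S) g" and n: "n \<notin> S"
  shows "\<exists>a U. (\<forall>i. holo (a i) \<and> dep S (a i)) \<and> holo U \<and> dep (insert n S) U \<and>
    (\<forall>\<^sub>0 x. g x = (\<Sum>i<d. a i x * x $ n ^ i) + x $ n ^ d * U x)"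
proof (induction d)
  case 0
  show ?case using g by (intro exI[of _ "\<lambda>_ _. 0"] exI[of _ g]) (simp add: dep_const)
next
  case (Suc d)
  then obtain a U where a: "\<And>i. holo (a i)" "\<And>i. dep S (a i)" and U: "holo U" "dep (insert n S) U"
    and ev: "\<forall>\<^sub>0 x. g x = (\<Sum>i<d. a i x * x $ n ^ i) + x $ n ^ d * U x" by blast
  obtain V where V: "holo V" "\<forall>\<^sub>0 x. U x = U (vupd x n 0) + x $ n * V x"
    using holo_expand[OF U(1)] by blast
  define c where "c x = U (vupd x n 0)" for x
  define V' where "V' x = V (proj (insert n S) x)" for x
  have c: "holo c" "dep S c"
  proof -
    show "holo c" unfolding c_def[abs_def]
      by (rule holo_compose[OF U(1) holomap_vupd[OF holo_const] vupd_0_0])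
    show "dep S c"
      by (rule depI, unfold c_def, rule dep_cong[OF U(2)]) (auto simp: vupd_nth)
  qed
  have V': "holo V'" "dep (insert n S) V'"
    unfolding V'_def[abs_def] by (rule holo_compose[OF V(1) holomap_proj proj_0], rule dep_proj)
  have "\<forall>\<^sub>0 x. U x = c x + x $ n * V' x"
    using eventually_compose[OF isCont_proj proj_0 V(2), of "insert n S"]
  proof eventually_elim
    case (elim x)
    have "U (vupd (proj (insert n S) x) n 0) = U (vupd x n 0)"
      by (rule dep_cong[OF U(2)]) (auto simp: vupd_nth proj_nth)
    with elim show ?case by (simp add: c_def V'_def depD[OF U(2)] proj_nth)
  qed
  with ev have "\<forall>\<^sub>0 x. g x = (\<Sum>i<Suc d. (a(d := c)) i x * x $ n ^ i) + x $ n ^ Suc d * V' x"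
    by eventually_elim (simp add: algebra_simps)
  with a c V' show ?case
    by (intro exI[of _ "a(d := c)"] exI[of _ V']) auto
qed

text \<open>The order in \<open>x $ n\<close> is at most \<open>d\<close>: the coefficients \<open>a i\<close> may be nonzero at \<open>0\<close>.\<close>

definition regular :: "'n set \<Rightarrow> 'n \<Rightarrow> nat \<Rightarrow> (complex^'n \<Rightarrow> complex) \<Rightarrow> bool" where
  "regular S n d g \<longleftrightarrow> (\<exists>a U. (\<forall>i<d. holo (a i) \<and> dep S (a i)) \<and> holo U \<and> dep (insert n S) U \<and> U 0 \<noteq> 0 \<and>
    (\<forall>\<^sub>0 x. g x = (\<Sum>i<d. a i x * x $ n ^ i) + x $ n ^ d * U x))"

lemma regular_of_deriv_nonzero:
  assumes "holo g" "dep (insert n S) g" "n \<notin> S" "(deriv ^^ d) (\<lambda>t. g (vupd 0 n t)) 0 \<noteq> 0"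
  shows "regular S n d g"
proof -
  obtain a U where a: "\<And>i. holo (a i)" "\<And>i. dep S (a i)" and U: "holo U" "dep (insert n S) U"
    and ev: "\<forall>\<^sub>0 x. g x = (\<Sum>i<d. a i x * x $ n ^ i) + x $ n ^ d * U x"
    using holo_taylor[OF assms(1-3)] by blast
  have "U 0 \<noteq> 0"
    using eventually_nhds_x_imp_x[OF taylor_coeffs[OF assms(3) a(2) U(1) ev]] assms(4) by auto
  with a U ev show ?thesis unfolding regular_def by blast
qed

text \<open>From degree \<open>k\<close> on all terms share the factor \<open>x $ n ^ k\<close>;
  what remains of them takes the value \<open>a k 0\<close> at the origin and so is a unit.\<close>

lemma regular_lower:
  assumes a: "\<And>i. i < d \<Longrightarrow> holo (a i)" "\<And>i. i < d \<Longrightarrow> dep S (a i)" and U: "holo U" "dep (insert n S) U"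
    and k: "k < d" "a k 0 \<noteq> 0"
    and ev: "\<forall>\<^sub>0 x. g x = (\<Sum>i<d. a i x * x $ n ^ i) + x $ n ^ d * U x"
  shows "regular S n k g"
proof -
  define W where "W x = (\<Sum>i\<in>{k..<d}. a i x * x $ n ^ (i - k)) + x $ n ^ (d - k) * U x" for x
  have "holo W" unfolding W_def[abs_def]
    by (intro holo_add holo_sum holo_mult holo_power holo_nth U a) simp
  moreover have "dep (insert n S) W" unfolding W_def[abs_def]
    by (intro dep_intros U dep_mono[OF a(2)]) auto
  moreover have "W 0 \<noteq> 0"
  proof -
    have "(\<Sum>i\<in>{k..<d}. a i 0 * 0 ^ (i - k)) = (\<Sum>i\<in>{k..<d}. if i = k then a k 0 else 0)"
      by (rule sum.cong) auto
    then show ?thesis using k by (simp add: W_def power_0_left)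
  qed
  moreover have "\<forall>\<^sub>0 x. g x = (\<Sum>i<k. a i x * x $ n ^ i) + x $ n ^ k * W x"
    using ev
  proof eventually_elim
    case (elim x)
    have "(\<Sum>i<d. a i x * x $ n ^ i) = (\<Sum>i<k. a i x * x $ n ^ i) + (\<Sum>i\<in>{k..<d}. a i x * x $ n ^ i)"
      using k(1) by (simp add: lessThan_atLeast0 sum.atLeastLessThan_concat)
    also have "(\<Sum>i\<in>{k..<d}. a i x * x $ n ^ i) = x $ n ^ k * (\<Sum>i\<in>{k..<d}. a i x * x $ n ^ (i - k))"
      unfolding sum_distrib_left
      by (rule sum.cong) (simp_all add: mult.left_commute flip: power_add)
    moreover have "x $ n ^ d = x $ n ^ k * x $ n ^ (d - k)"
      using k(1) by (simp flip: power_add)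
    ultimately show ?case using elim by (simp add: W_def algebra_simps)
  qed
  ultimately show ?thesis
    using a k(1) unfolding regular_def by (intro exI[of _ a] exI[of _ W]) auto
qed

section \<open>Germs that acquire normal crossings after modifications\<close>

definition resolvable :: "'n set \<Rightarrow> (complex^'n \<Rightarrow> complex) \<Rightarrow> bool" where
  "resolvable S f \<longleftrightarrow> loc S (\<lambda>\<phi>. nc (\<lambda>x. f (\<phi> x)))"

lemma resolvable_nc: "nc f \<Longrightarrow> resolvable S f"
  unfolding resolvable_def by (rule loc_return)

lemma resolvable_cong:
  assumes "resolvable S f" "\<forall>\<^sub>0 x. f x = g x"
  shows "resolvable S g"
  using assms(1) unfolding resolvable_def
  by (rule loc_mono[OF _ subset_refl]) (erule nc_cong, erule adm_eventually[OF _ assms(2)])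

lemma resolvable_adm:
  assumes "resolvable S (\<lambda>x. f (\<phi> x))" "adm S \<phi>" "isCont \<theta> 0" "\<theta> 0 = 0" "\<forall>\<^sub>0 x. \<phi> (\<theta> x) = x"
  shows "resolvable S f"
  using assms(1) unfolding resolvable_def
  by (rule loc_adm[of S "\<lambda>\<phi>. nc (\<lambda>x. f (\<phi> x))" \<phi>, OF _ assms(2-5)])

lemma resolvable_mult:
  assumes "resolvable S E" "S \<subseteq> T" "\<And>\<phi>. adm S \<phi> \<Longrightarrow> nc (\<lambda>x. g (\<phi> x))"
  shows "resolvable T (\<lambda>x. E x * g x)"
  using assms(1) unfolding resolvable_def
  by (rule loc_mono[OF _ assms(2)]) (intro nc_mult assms(3))

lemma resolvable_mult_unit:
  assumes "resolvable S E" "S \<subseteq> T" "holo U" "U 0 \<noteq> 0"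
  shows "resolvable T (\<lambda>x. E x * U x)"
  by (rule resolvable_mult[OF assms(1,2)], rule nc_unit)
     (use assms(3,4) adm_holo in \<open>auto simp: admD(2)\<close>)

text \<open>Induction on the degree of the monomial \<open>\<gamma>\<close>: blowing up \<open>(x\<^sub>j, x\<^sub>n)\<close> with \<open>\<gamma> j > 0\<close> lowers \<open>\<gamma> j\<close> at the origin of the
  chart \<open>x\<^sub>n = x\<^sub>j (y + \<mu>)\<close>, lowers the order at its points \<open>\<mu> \<noteq> 0\<close>, and gives normal crossings in the other
  chart. Once \<open>\<gamma> = 0\<close>, the order is smaller because of \<open>b k 0 \<noteq> 0\<close>.\<close>

lemma blowup_step:
  fixes E :: "complex^'n \<Rightarrow> complex"
  assumes n: "n \<notin> S"
    and IH: "\<And>E g k. k \<le> e \<Longrightarrow> holo E \<Longrightarrow> dep S E \<Longrightarrow> nc E \<Longrightarrow> regular S n k g \<Longrightarrow>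
      resolvable (insert n S) (\<lambda>x. E x * g x)"
    and E: "holo E" "dep S E" "nc E"
    and b: "\<And>i. i < e \<Longrightarrow> holo (b i)" "\<And>i. i < e \<Longrightarrow> dep S (b i)" "k < e" "b k 0 \<noteq> 0"
    and U: "holo U" "dep (insert n S) U" "U 0 \<noteq> 0"
    and \<gamma>: "\<And>i. i \<notin> S \<Longrightarrow> \<gamma> i = 0"
  shows "resolvable (insert n S)
    (\<lambda>x. E x * ((\<Sum>i<e. xpow \<gamma> x ^ (Suc e - i) * b i x * x $ n ^ i) + x $ n ^ Suc e * U x))"
  using E U \<gamma>
proof (induction "\<Sum>i\<in>UNIV. \<gamma> i" arbitrary: \<gamma> E U)
  case 0
  then have \<gamma>: "\<gamma> = (\<lambda>_. 0)" by auto
  \<comment> \<open>Padding with 0 at index \<open>e\<close>, where the expression of order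
    \<open>Suc e\<close> has its gap.\<close>
  define a where "a i = (if i < e then b i else (\<lambda>_. 0))" for i
  have reg: "regular S n k (\<lambda>x. (\<Sum>i<e. xpow \<gamma> x ^ (Suc e - i) * b i x * x $ n ^ i) + x $ n ^ Suc e * U x)"
    by (rule regular_lower[of "Suc e" a, OF _ _ 0(5,6)])
       (use b in \<open>auto simp: a_def \<gamma> dep_const intro!: always_eventually sum.cong\<close>)
  show ?case by (rule IH[OF less_imp_le[OF b(3)] 0(2-4) reg])
next
  case (Suc m)
  then obtain j where j: "\<gamma> j > 0" by (metis gr0I sum.neutral zero_less_Suc less_irrefl)
  then have jS: "j \<in> S" using Suc.prems(7) by force
  have jn: "j \<noteq> n" using jS n by blast
  define \<gamma>' where "\<gamma>' = \<gamma>(j := \<gamma> j - 1)"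
  have \<gamma>\<gamma>': "xpow \<gamma> x = x $ j * xpow \<gamma>' x" for x :: "complex^'n"
    using j by (simp add: xpow_remove[of _ x j] \<gamma>'_def power_eq_if)
  have "(\<Sum>i\<in>UNIV. \<gamma> i) = Suc (\<Sum>i\<in>UNIV. \<gamma>' i)"
    using j by (simp add: sum.remove[of UNIV j] \<gamma>'_def)
  with Suc(2) have m: "m = (\<Sum>i\<in>UNIV. \<gamma>' i)" by simp
  have \<gamma>'S: "\<And>i. i \<notin> S \<Longrightarrow> \<gamma>' i = 0" using Suc.prems(7) jS by (auto simp: \<gamma>'_def)
  let ?f = "\<lambda>x. E x * ((\<Sum>i<e. xpow \<gamma> x ^ (Suc e - i) * b i x * x $ n ^ i) + x $ n ^ Suc e * U x)"
  show ?case unfolding resolvable_def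
  proof (rule loc_blowup[where j = j and n = n])
    show "j \<in> insert n S" "n \<in> insert n S" "j \<noteq> n" using jS jn by auto
    fix \<mu> :: complex
    define c where "c x = vupd x n (x $ j * (x $ n + \<mu>))" for x :: "complex^'n"
    have hc: "holomap c" unfolding c_def[abs_def]
      by (intro holomap_vupd holo_mult holo_add holo_nth holo_const)
    have c0: "c 0 = 0" by (simp add: c_def)
    have cS: "f (c x) = f x" if "dep S f" for f :: "complex^'n \<Rightarrow> complex" and x
      unfolding c_def by (rule dep_vupd[OF that n])
    define E' where "E' x = E x * x $ j ^ Suc e" for x
    define U' where "U' x = U (c x)" for x
    \<comment> \<open>The strict transform: \<open>x $ j ^ Suc e\<close> has moved into
      \<open>E'\<close>, with \<open>Suc e - i\<close> factors coming from the monomial and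
      \<open>i\<close> from the power of \<open>x $ n\<close>.\<close>
    define G where "G x = (\<Sum>i<e. xpow \<gamma>' x ^ (Suc e - i) * b i x * (x $ n + \<mu>) ^ i) + (x $ n + \<mu>) ^ Suc e * U' x" for x
    have E': "holo E'" "dep S E'" "nc E'"
    proof -
      show "holo E'" unfolding E'_def[abs_def] by (intro holo_mult holo_power holo_nth Suc.prems)
      show "dep S E'" unfolding E'_def[abs_def] by (intro dep_intros Suc.prems jS)
      show "nc E'" unfolding E'_def[abs_def] by (intro nc_mult nc_power nc_nth Suc.prems)
    qed
    have U': "holo U'" "dep (insert n S) U'" "U' 0 \<noteq> 0"
    proof -
      show "holo U'" unfolding U'_def[abs_def] by (rule holo_compose[OF Suc.prems(4) hc c0])
      show "dep (insert n S) U'" unfolding U'_def[abs_def]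
        by (rule depI, rule dep_cong[OF Suc.prems(5)]) (use jS in \<open>auto simp: c_def vupd_nth\<close>)
      show "U' 0 \<noteq> 0" using Suc.prems(6) by (simp add: U'_def c0)
    qed
    have fc: "?f (c x) = E' x * G x" for x
    proof -
      have "xpow \<gamma> (c x) ^ (Suc e - i) * b i (c x) * c x $ n ^ i =
          x $ j ^ Suc e * (xpow \<gamma>' x ^ (Suc e - i) * b i x * (x $ n + \<mu>) ^ i)" if "i < e" for i
      proof -
        have "x $ j ^ Suc e = x $ j ^ (Suc e - i) * x $ j ^ i"
          using that by (simp flip: power_add)
        moreover have "c x $ n = x $ j * (x $ n + \<mu>)" by (simp add: c_def)
        moreover have "xpow \<gamma> (c x) = x $ j * xpow \<gamma>' x"
          using cS[OF xpow_dep[of S \<gamma>]] Suc.prems(7) by (simp add: \<gamma>\<gamma>')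
        ultimately show ?thesis using cS[OF b(2)[OF that]] by (simp only: power_mult_distrib mult_ac)
      qed
      then have "(\<Sum>i<e. xpow \<gamma> (c x) ^ (Suc e - i) * b i (c x) * c x $ n ^ i) =
          x $ j ^ Suc e * (\<Sum>i<e. xpow \<gamma>' x ^ (Suc e - i) * b i x * (x $ n + \<mu>) ^ i)"
        unfolding sum_distrib_left by (intro sum.cong) auto
      moreover have "c x $ n ^ Suc e = x $ j ^ Suc e * (x $ n + \<mu>) ^ Suc e"
        by (simp add: c_def power_mult_distrib)
      ultimately show ?thesis
        unfolding E'_def G_def U'_def cS[OF Suc.prems(2)] by (simp only: distrib_left mult_ac)
    qed
    have "resolvable (insert n S) (\<lambda>x. E' x * G x)"
    proof (cases "\<mu> = 0")
      case True
      show ?thesis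
        unfolding G_def True add_0_right by (rule Suc.hyps(1)[OF m E' U' \<gamma>'S])
    next
      case False
      have "holo G" unfolding G_def[abs_def]
        by (intro holo_add holo_sum holo_mult holo_power holo_nth holo_const holo_xpow U' b) simp
      moreover have "dep (insert n S) G" unfolding G_def[abs_def]
        by (intro dep_intros U' dep_mono[OF b(2)] dep_mono[OF xpow_dep[of S \<gamma>']]) (auto simp: \<gamma>'S)
      \<comment> \<open>On this slice \<open>U'\<close> is constant, since the chart multiplies the
        last coordinate by \<open>x $ j = 0\<close>. So \<open>G\<close> is a polynomial in
        \<open>t + \<mu>\<close> with a gap at exponent \<open>e\<close>.\<close>
      moreover have "(deriv ^^ e) (\<lambda>t. G (vupd 0 n t)) 0 \<noteq> 0"
      proof -
        have "G (vupd 0 n t) = (\<Sum>i<e. (xpow \<gamma>' 0 ^ (Suc e - i) * b i 0) * (t + \<mu>) ^ i) + (t + \<mu>) ^ Suc e * U 0" for t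
        proof -
          have "b i (vupd 0 n t) = b i 0" if "i < e" for i using dep_vupd[OF b(2)[OF that] n] .
          moreover have "xpow \<gamma>' (vupd 0 n t) = xpow \<gamma>' 0"
            by (rule dep_vupd[OF xpow_dep[of S] n]) (rule \<gamma>'S)
          moreover have "U' (vupd 0 n t) = U 0" using jn by (simp add: U'_def c_def)
          ultimately show ?thesis by (simp add: G_def cong: sum.cong_simp)
        qed
        then show ?thesis using higher_deriv_gap_nonzero[OF False Suc.prems(6)] by presburger
      qed
      ultimately have "regular S n e G" by (rule regular_of_deriv_nonzero[OF _ _ n])
      with E' show ?thesis by (intro IH) auto
    qed
    then show "loc (insert n S) (\<lambda>\<psi>. nc (\<lambda>x. ?f (vupd (\<psi> x) n (\<psi> x $ j * (\<psi> x $ n + \<mu>)))))"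
      unfolding resolvable_def fc[symmetric] unfolding c_def .
  next
    define c where "c x = vupd x j (x $ j * x $ n)" for x :: "complex^'n"
    have hc: "holomap c" unfolding c_def[abs_def]
      by (intro holomap_vupd holo_mult holo_nth)
    have c0: "c 0 = 0" by (simp add: c_def)
    have cn: "c x $ n = x $ n" for x using jn by (simp add: c_def)
    \<comment> \<open>After splitting off \<open>x $ n ^ Suc e\<close>, every term of the sum keeps
      a factor \<open>x $ j\<close>; therefore \<open>W 0 = U 0\<close> and \<open>W\<close> is a
      unit.\<close>
    define W where "W x = (\<Sum>i<e. (x $ j * xpow \<gamma>' (c x)) ^ (Suc e - i) * b i (c x)) + U (c x)" for x
    have "holo W" unfolding W_def[abs_def]
      by (intro holo_add holo_sum holo_mult holo_power holo_nth holo_compose[OF _ hc c0] holo_xpow Suc.prems b) simp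
    moreover have "W 0 \<noteq> 0"
    proof -
      have "(\<Sum>i<e. (0 * xpow \<gamma>' (c 0)) ^ (Suc e - i) * b i (c 0)) = 0"
        by (intro sum.neutral) (auto simp: power_0_left)
      then show ?thesis using Suc.prems(6) by (simp add: W_def c0)
    qed
    ultimately have "nc W" by (rule nc_unit)
    have "nc (\<lambda>x. E (c x))"
    proof -
      obtain \<alpha> u where u: "holo u" "u 0 \<noteq> 0" "\<forall>\<^sub>0 x. E x = xpow \<alpha> x * u x"
        using Suc.prems(3) unfolding nc_def by blast
      have xc: "xpow \<alpha> (c x) = xpow \<alpha> x * x $ n ^ \<alpha> j" for x
      proof -
        have "(\<Prod>i\<in>UNIV - {j}. c x $ i ^ \<alpha> i) = (\<Prod>i\<in>UNIV - {j}. x $ i ^ \<alpha> i)"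
          by (rule prod.cong) (auto simp: c_def)
        then show ?thesis
          by (simp add: xpow_remove[of \<alpha> _ j]) (simp add: c_def power_mult_distrib mult_ac)
      qed
      have "nc (\<lambda>x. xpow \<alpha> x * x $ n ^ \<alpha> j * u (c x))"
        by (intro nc_mult nc_xpow nc_power nc_nth nc_unit holo_compose[OF u(1) hc c0]) (simp add: c0 u)
      moreover have "\<forall>\<^sub>0 x. xpow \<alpha> x * x $ n ^ \<alpha> j * u (c x) = E (c x)"
        using eventually_compose[OF holomap_isCont[OF hc] c0 u(3)] by eventually_elim (simp add: xc)
      ultimately show ?thesis by (rule nc_cong)
    qed
    moreover have fc: "?f (c x) = E (c x) * (x $ n ^ Suc e * W x)" for x
    proof -
      have "xpow \<gamma> (c x) ^ (Suc e - i) * b i (c x) * c x $ n ^ i =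
          x $ n ^ Suc e * ((x $ j * xpow \<gamma>' (c x)) ^ (Suc e - i) * b i (c x))" if "i < e" for i
      proof -
        have "x $ n ^ Suc e = x $ n ^ (Suc e - i) * x $ n ^ i"
          using that by (simp flip: power_add)
        moreover have "xpow \<gamma> (c x) = x $ j * x $ n * xpow \<gamma>' (c x)"
          by (simp add: \<gamma>\<gamma>') (simp add: c_def)
        ultimately show ?thesis by (simp only: cn power_mult_distrib mult_ac)
      qed
      then have "(\<Sum>i<e. xpow \<gamma> (c x) ^ (Suc e - i) * b i (c x) * c x $ n ^ i) =
          x $ n ^ Suc e * (\<Sum>i<e. (x $ j * xpow \<gamma>' (c x)) ^ (Suc e - i) * b i (c x))"
        unfolding sum_distrib_left by (intro sum.cong) auto
      then show ?thesis unfolding W_def cn by (simp only: distrib_left mult_ac)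
    qed
    ultimately have "nc (\<lambda>x. ?f (c x))"
      unfolding fc by (intro nc_mult nc_power nc_nth \<open>nc W\<close>)
    then show "loc (insert n S) (\<lambda>\<psi>. nc (\<lambda>x. ?f (vupd (\<psi> x) j (\<psi> x $ j * \<psi> x $ n))))"
      by (intro loc_return) (simp only: c_def)
  qed
qed

section \<open>Resolution of holomorphic germs\<close>

lemma eventually_0_mult_iff:
  assumes "holo f" "holo g"
  shows "(\<forall>\<^sub>0 x. f x * g x = 0) \<longleftrightarrow> (\<forall>\<^sub>0 x. f x = 0) \<or> (\<forall>\<^sub>0 x. g x = 0)"
  using holo_zero_divisor[OF assms] by (auto elim: eventually_mono)

lemma prod_not_eventually_0:
  assumes "finite A" "\<And>i. i \<in> A \<Longrightarrow> holo (f i)" "\<And>i. i \<in> A \<Longrightarrow> \<not> (\<forall>\<^sub>0 x. f i x = 0)"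
  shows "\<not> (\<forall>\<^sub>0 x. (\<Prod>i\<in>A. f i x) = 0)"
  using assms
proof (induction A rule: finite_induct)
  case (insert i A)
  have "holo (\<lambda>x. \<Prod>i\<in>A. f i x)" by (rule holo_prod) (use insert in blast)
  then have "(\<forall>\<^sub>0 x. f i x * (\<Prod>i\<in>A. f i x) = 0) \<longleftrightarrow>
      (\<forall>\<^sub>0 x. f i x = 0) \<or> (\<forall>\<^sub>0 x. (\<Prod>i\<in>A. f i x) = 0)"
    by (intro eventually_0_mult_iff insert) simp
  with insert show ?case by (simp only: prod.insert[OF insert.hyps]) blast
qed simp

text \<open>An arbitrary choice suffices: \<open>norm (rootmap N z) = root N (norm z)\<close> makes
  it continuous at 0 whatever roots are chosen, as \<open>loc_single\<close> requires.\<close>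

definition rootmap :: "nat \<Rightarrow> complex \<Rightarrow> complex" where
  "rootmap N z = (SOME w. w ^ N = z)"

lemma rootmap: "N > 0 \<Longrightarrow> rootmap N z ^ N = z"
  unfolding rootmap_def by (rule someI_ex) (metis exists_complex_root less_irrefl)

lemma isCont_rootmap: assumes "N > 0" shows "rootmap N 0 = 0" "isCont (rootmap N) 0"
proof -
  show 0: "rootmap N 0 = 0" using rootmap[OF assms, of 0] assms by simp
  have "norm (rootmap N z) = root N (norm z)" for z
    using assms by (metis norm_ge_zero norm_power real_root_power_cancel rootmap)
  moreover have "((\<lambda>z::complex. root N (norm z)) \<longlongrightarrow> root N (norm (0::complex))) (at 0)"
    by (intro tendsto_intros)
  ultimately have "((\<lambda>z. norm (rootmap N z)) \<longlongrightarrow> 0) (at 0)" by simp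
  then show "isCont (rootmap N) 0"
    by (simp add: isCont_def 0 tendsto_norm_zero_iff)
qed

definition powmap :: "'n set \<Rightarrow> nat \<Rightarrow> complex^'n \<Rightarrow> complex^'n" where
  "powmap S N x = (\<chi> k. if k \<in> S then x $ k ^ N else x $ k)"

lemma powmap_nth: "powmap S N x $ k = (if k \<in> S then x $ k ^ N else x $ k)"
  by (simp add: powmap_def)

lemma adm_powmap: assumes "N > 0" shows "adm S (powmap S N)"
  unfolding adm_def
proof (intro conjI ballI allI impI)
  show "holomap (powmap S N)" unfolding holomap_def
  proof
    fix i show "holo (\<lambda>x. powmap S N x $ i)"
      by (cases "i \<in> S") (simp_all add: powmap_nth holo_power)
  qed
qed (use assms in \<open>auto simp: vec_eq_iff dep_def proj_nth powmap_nth\<close>)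

lemma resolvable_powmap:
  assumes N: "N > 0" and f: "resolvable T (\<lambda>x. f (powmap S N x))" and T: "S \<subseteq> T"
  shows "resolvable T f"
proof (rule resolvable_adm[where \<phi> = "powmap S N", OF f adm_mono[OF adm_powmap[OF N] T],
      where \<theta> = "\<lambda>x. \<chi> k. if k \<in> S then rootmap N (x $ k) else x $ k"])
  show "isCont (\<lambda>x. \<chi> k. if k \<in> S then rootmap N (x $ k) else x $ k) 0"
  proof (rule isCont_vecI)
    fix i
    have "isCont (\<lambda>x::complex^'a. x $ i) 0" by (intro isCont_vec_nth) simp
    then have "isCont (\<lambda>x::complex^'a. rootmap N (x $ i)) 0"
      by (rule isCont_o2) (simp add: isCont_rootmap[OF N])
    then show "isCont (\<lambda>x. (\<chi> k. if k \<in> S then rootmap N (x $ k) else x $ k) $ i) 0"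
      by (cases "i \<in> S") (simp_all add: isCont_vec_nth)
  qed
qed (use N in \<open>auto simp: vec_eq_iff isCont_rootmap rootmap powmap_nth\<close>)

lemma ex_pointwise_least:
  fixes \<delta> :: "'i \<Rightarrow> 'k \<Rightarrow> nat"
  assumes "finite I" "I \<noteq> {}" "\<And>i j. i \<in> I \<Longrightarrow> j \<in> I \<Longrightarrow> (\<forall>k. \<delta> i k \<le> \<delta> j k) \<or> (\<forall>k. \<delta> j k \<le> \<delta> i k)"
  shows "\<exists>i\<in>I. \<forall>j\<in>I. \<forall>k. \<delta> i k \<le> \<delta> j k"
  using assms
proof (induction rule: finite_ne_induct)
  case (insert i I)
  then obtain j where j: "j \<in> I" "\<forall>i\<in>I. \<forall>k. \<delta> j k \<le> \<delta> i k" by (metis insertI2)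
  show ?case
  proof (cases "\<forall>k. \<delta> i k \<le> \<delta> j k")
    case True
    with j show ?thesis by (metis insert_iff le_refl le_trans)
  next
    case False
    with insert.prems[of i j] j show ?thesis by (metis insert_iff)
  qed
qed auto

text \<open>Comparable exponents of the \<open>b i ^ (N div (Suc e - i))\<close> are obtained by giving normal
  crossings to their differences as well. After the substitution \<open>x\<^sub>j \<mapsto> x\<^sub>j ^ N\<close> the least of them becomes the
  monomial of \<open>blowup_step\<close>.\<close>

lemma resolvable_centered:
  fixes E :: "complex^'n \<Rightarrow> complex"
  assumes n: "n \<notin> S"
    and M: "\<And>h. holo h \<Longrightarrow> dep S h \<Longrightarrow> \<not> (\<forall>\<^sub>0 x. h x = 0) \<Longrightarrow> resolvable S h"
    and IH: "\<And>E g k. k \<le> e \<Longrightarrow> holo E \<Longrightarrow> dep S E \<Longrightarrow> nc E \<Longrightarrow> regular S n k g \<Longrightarrow>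
      resolvable (insert n S) (\<lambda>x. E x * g x)"
    and E: "holo E" "dep S E" "\<not> (\<forall>\<^sub>0 x. E x = 0)"
    and b: "\<And>i. i < e \<Longrightarrow> holo (b i)" "\<And>i. i < e \<Longrightarrow> dep S (b i)"
    and W: "holo W" "dep (insert n S) W" "W 0 \<noteq> 0"
  shows "resolvable (insert n S) (\<lambda>x. E x * ((\<Sum>i<e. b i x * x $ n ^ i) + x $ n ^ Suc e * W x))"
    (is "resolvable _ ?f")
proof -
  define I where "I = {i. i < e \<and> \<not> (\<forall>\<^sub>0 x. b i x = 0)}"
  \<comment> \<open>A common multiple of the weights \<open>Suc e - i\<close>; the powers
    \<open>A i\<close> bring the coefficients to the same weight.\<close>
  define N :: nat where "N = fact (Suc e)"
  define A where "A i x = b i x ^ (N div (Suc e - i))" for i x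
  \<comment> \<open>Zero germs cannot be resolved, so pairs with equal powers are left out; they
    fall under the other alternative in \<open>nc_exponents_comparable\<close>.\<close>
  define J where "J = {(i, j) \<in> I \<times> I. \<not> (\<forall>\<^sub>0 x. A i x = A j x)}"
  have N: "N > 0" by (simp add: N_def)
  have Nd: "(Suc e - i) * (N div (Suc e - i)) = N" if "i < e" for i
  proof -
    have "(Suc e - i) dvd fact (Suc e)" by (rule dvd_fact) (use that in auto)
    then show ?thesis by (simp only: N_def dvd_mult_div_cancel)
  qed
  have "I \<subseteq> {..<e}" by (auto simp: I_def)
  then have fin: "finite I" by (rule finite_subset) simp
  have "J \<subseteq> I \<times> I" by (auto simp: J_def)
  then have finJ: "finite J" by (rule finite_subset) (simp add: fin)
  have Ie: "i < e" if "i \<in> I" for i using that by (simp add: I_def)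
  have hA: "holo (A i)" "dep S (A i)" if "i \<in> I" for i
  proof -
    show "holo (A i)" unfolding A_def[abs_def] by (intro holo_power b Ie that)
    show "dep S (A i)" unfolding A_def[abs_def] by (intro dep_intros b Ie that)
  qed
  define P1 where "P1 x = (\<Prod>i\<in>I. b i x)" for x
  define P2 where "P2 x = (\<Prod>p\<in>J. A (fst p) x - A (snd p) x)" for x
  have P1: "holo P1" "dep S P1" "\<not> (\<forall>\<^sub>0 x. P1 x = 0)"
  proof -
    show "holo P1" unfolding P1_def[abs_def] by (intro holo_prod b Ie)
    show "dep S P1" unfolding P1_def[abs_def] by (intro dep_intros b Ie)
    show "\<not> (\<forall>\<^sub>0 x. P1 x = 0)" unfolding P1_def
      by (rule prod_not_eventually_0[OF fin]) (use b(1)[OF Ie] in \<open>auto simp: I_def\<close>)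
  qed
  have P2: "holo P2" "dep S P2" "\<not> (\<forall>\<^sub>0 x. P2 x = 0)"
  proof -
    show "holo P2" unfolding P2_def[abs_def]
      by (intro holo_prod holo_diff hA) (auto simp: J_def)
    show "dep S P2" unfolding P2_def[abs_def] by (intro dep_intros hA) (auto simp: J_def)
    show "\<not> (\<forall>\<^sub>0 x. P2 x = 0)" unfolding P2_def
    proof (rule prod_not_eventually_0[OF finJ])
      show "holo (\<lambda>x. A (fst p) x - A (snd p) x)" if "p \<in> J" for p
        by (intro holo_diff hA) (use that in \<open>auto simp: J_def\<close>)
    qed (auto simp: J_def)
  qed
  have hP: "holo (\<lambda>x. P1 x * P2 x)" by (intro holo_mult P1 P2)
  \<comment> \<open>One resolution in fewer variables of the product of everything involved;
    \<open>nc_factors\<close> distributes the normal crossings afterwards.\<close>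
  have "resolvable S (\<lambda>x. E x * (P1 x * P2 x))"
  proof (rule M)
    show "holo (\<lambda>x. E x * (P1 x * P2 x))" by (intro holo_mult E P1 P2)
    show "dep S (\<lambda>x. E x * (P1 x * P2 x))" by (intro dep_intros E P1 P2)
    show "\<not> (\<forall>\<^sub>0 x. E x * (P1 x * P2 x) = 0)"
      unfolding eventually_0_mult_iff[OF E(1) hP] eventually_0_mult_iff[OF P1(1) P2(1)]
      using E(3) P1(3) P2(3) by (simp only: simp_thms)
  qed
  then have "loc (insert n S) (\<lambda>\<phi>. adm S \<phi> \<and> nc (\<lambda>x. E (\<phi> x) * (P1 (\<phi> x) * P2 (\<phi> x))))"
    unfolding resolvable_def by (rule loc_mono) auto
  then have "loc (insert n S) (\<lambda>\<phi>. nc (\<lambda>x. ?f (\<phi> x)))"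
  proof (rule loc_bind)
    fix \<phi> :: "complex^'n \<Rightarrow> complex^'n"
    assume "adm S \<phi> \<and> nc (\<lambda>x. E (\<phi> x) * (P1 (\<phi> x) * P2 (\<phi> x)))"
    then have \<phi>: "adm S \<phi>" and ncP: "nc (\<lambda>x. E (\<phi> x) * (P1 (\<phi> x) * P2 (\<phi> x)))" by auto
    note h\<phi> = adm_holo[OF \<phi>]
    have ncE: "nc (\<lambda>x. E (\<phi> x))" and ncP1: "nc (\<lambda>x. P1 (\<phi> x))" and ncP2: "nc (\<lambda>x. P2 (\<phi> x))"
    proof -
      have *: "nc (\<lambda>x. E (\<phi> x)) \<and> nc (\<lambda>x. P1 (\<phi> x) * P2 (\<phi> x))"
        by (rule nc_factors[OF h\<phi>[OF E(1)] h\<phi>[OF hP] ncP])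
      then have "nc (\<lambda>x. P1 (\<phi> x)) \<and> nc (\<lambda>x. P2 (\<phi> x))"
        by (intro nc_factors h\<phi> P1 P2) simp
      with * show "nc (\<lambda>x. E (\<phi> x))" "nc (\<lambda>x. P1 (\<phi> x))" "nc (\<lambda>x. P2 (\<phi> x))" by auto
    qed
    have ncb: "nc (\<lambda>x. b i (\<phi> x))" if "i \<in> I" for i
      by (rule nc_prod_factor[OF fin _ ncP1[unfolded P1_def] that]) (intro h\<phi> b Ie)
    have ncA: "nc (\<lambda>x. A i (\<phi> x) - A j (\<phi> x))" if "(i, j) \<in> J" for i j
    proof -
      have "holo (\<lambda>x. A (fst p) (\<phi> x) - A (snd p) (\<phi> x))" if "p \<in> J" for p
        by (intro holo_diff h\<phi> hA) (use that in \<open>auto simp: J_def\<close>)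
      from nc_prod_factor[OF finJ this ncP2[unfolded P2_def] that] show ?thesis by simp
    qed
    have b0: "\<forall>\<^sub>0 x. b i (\<phi> x) = 0" if "i < e" "i \<notin> I" for i
      using that by (intro adm_eventually[OF \<phi>]) (auto simp: I_def)
    have \<phi>n: "\<phi> x $ n = x $ n" for x using admD(3)[OF \<phi> n] .
    have W\<phi>: "holo (\<lambda>x. W (\<phi> x))" "dep (insert n S) (\<lambda>x. W (\<phi> x))" "W (\<phi> 0) \<noteq> 0"
      using h\<phi>[OF W(1)] adm_dep[OF \<phi> W(2)] W(3) by (auto simp: admD(2)[OF \<phi>])
    have "resolvable (insert n S) (\<lambda>x. ?f (\<phi> x))"
    proof (cases "I = {}")
      case True
      have "\<forall>\<^sub>0 x. \<forall>i\<in>{..<e}. b i (\<phi> x) = 0"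
        using b0 True by (intro eventually_ball_finite) auto
      then have "\<forall>\<^sub>0 x. E (\<phi> x) * (x $ n ^ Suc e * W (\<phi> x)) = ?f (\<phi> x)"
        by eventually_elim (simp add: \<phi>n)
      moreover have "nc (\<lambda>x. E (\<phi> x) * (x $ n ^ Suc e * W (\<phi> x)))"
        by (intro nc_mult ncE nc_power nc_nth nc_unit W\<phi>)
      ultimately show ?thesis by (intro resolvable_nc) (rule nc_cong)
    next
      case False
      let ?P = "\<lambda>i \<alpha> v. (\<forall>k. k \<notin> S \<longrightarrow> \<alpha> k = 0) \<and> dep S v \<and> holo v \<and> v 0 \<noteq> 0 \<and>
          (\<forall>\<^sub>0 x. b i (\<phi> x) = xpow \<alpha> x * v x)"
      have "\<forall>i\<in>I. \<exists>\<alpha> v. ?P i \<alpha> v"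
        using nc_dep[OF ncb adm_dep[OF \<phi> b(2)[OF Ie] subset_refl]] by (intro ballI)
      then obtain \<alpha> where "\<forall>i\<in>I. \<exists>v. ?P i (\<alpha> i) v" by (rule bchoice[THEN exE])
      then obtain v where "\<forall>i\<in>I. ?P i (\<alpha> i) (v i)" by (rule bchoice[THEN exE])
      then have \<alpha>: "\<And>i k. i \<in> I \<Longrightarrow> k \<notin> S \<Longrightarrow> \<alpha> i k = 0"
        and v: "\<And>i. i \<in> I \<Longrightarrow> dep S (v i)" "\<And>i. i \<in> I \<Longrightarrow> holo (v i)" "\<And>i. i \<in> I \<Longrightarrow> v i 0 \<noteq> 0"
        and bv: "\<And>i. i \<in> I \<Longrightarrow> \<forall>\<^sub>0 x. b i (\<phi> x) = xpow (\<alpha> i) x * v i x"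
        by blast+
      define \<delta> where "\<delta> i k = N div (Suc e - i) * \<alpha> i k" for i k
      have "(\<forall>k. \<delta> i k \<le> \<delta> j k) \<or> (\<forall>k. \<delta> j k \<le> \<delta> i k)" if ij: "i \<in> I" "j \<in> I" for i j
      proof (rule nc_exponents_comparable)
        show "holo (\<lambda>x. v i x ^ (N div (Suc e - i)))" "holo (\<lambda>x. v j x ^ (N div (Suc e - j)))"
          by (intro holo_power v ij)+
        show "v i 0 ^ (N div (Suc e - i)) \<noteq> 0" "v j 0 ^ (N div (Suc e - j)) \<noteq> 0"
          using v(3) ij by auto
        show "\<forall>\<^sub>0 x. A i (\<phi> x) = xpow (\<delta> i) x * v i x ^ (N div (Suc e - i))"
          using bv[OF ij(1)] by eventually_elim (simp add: A_def \<delta>_def[abs_def] xpow_mult power_mult_distrib)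
        show "\<forall>\<^sub>0 x. A j (\<phi> x) = xpow (\<delta> j) x * v j x ^ (N div (Suc e - j))"
          using bv[OF ij(2)] by eventually_elim (simp add: A_def \<delta>_def[abs_def] xpow_mult power_mult_distrib)
        show "(\<forall>\<^sub>0 x. A i (\<phi> x) = A j (\<phi> x)) \<or> nc (\<lambda>x. A i (\<phi> x) - A j (\<phi> x))"
        proof (cases "(i, j) \<in> J")
          case False
          then have "\<forall>\<^sub>0 x. A i x = A j x" using ij by (simp add: J_def)
          then show ?thesis by (intro disjI1 adm_eventually[OF \<phi>])
        qed (simp add: ncA)
      qed
      then obtain k where k: "k \<in> I" "\<And>i l. i \<in> I \<Longrightarrow> \<delta> k l \<le> \<delta> i l"
        using ex_pointwise_least[OF fin False, of \<delta>] by blast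
      define \<pi> where "\<pi> = powmap S N"
      have \<pi>: "adm S \<pi>" unfolding \<pi>_def by (rule adm_powmap[OF N])
      note h\<pi> = adm_holo[OF \<pi>] and ev\<pi> = adm_eventually[OF \<pi>]
      have \<pi>n: "\<pi> x $ n = x $ n" for x by (rule admD(3)[OF \<pi> n])
      have xpow\<pi>: "xpow \<beta> (\<pi> x) = xpow (\<lambda>k. if k \<in> S then N * \<beta> k else \<beta> k) x" for \<beta> x
        unfolding xpow_def by (rule prod.cong) (auto simp: \<pi>_def powmap_nth power_mult)
      define E' where "E' x = E (\<phi> (\<pi> x))" for x
      define W' where "W' x = W (\<phi> (\<pi> x))" for x
      \<comment> \<open>What remains of \<open>b i\<close> once the weighted power of the least
        monomial is split off. For \<open>i = k\<close> the exponent is 0, so \<open>b' k\<close> is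
        the coefficient with nonzero value at 0 that \<open>blowup_step\<close> demands.\<close>
      define b' where "b' i = (if i \<in> I then (\<lambda>x. xpow (\<lambda>l. (Suc e - i) * (\<delta> i l - \<delta> k l)) x * v i (\<pi> x)) else (\<lambda>_. 0))" for i
      have "resolvable (insert n S) (\<lambda>x. E' x * ((\<Sum>i<e. xpow (\<delta> k) x ^ (Suc e - i) * b' i x * x $ n ^ i) + x $ n ^ Suc e * W' x))"
      proof (rule blowup_step[OF n IH, where k = k])
        show "holo E'" unfolding E'_def[abs_def] by (intro h\<pi> h\<phi> E)
        show "dep S E'" unfolding E'_def[abs_def] by (intro adm_dep[OF \<pi>] adm_dep[OF \<phi>] E subset_refl)
        show "nc E'"
        proof -
          obtain \<beta> u where u: "holo u" "u 0 \<noteq> 0" "\<forall>\<^sub>0 x. E (\<phi> x) = xpow \<beta> x * u x"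
            using ncE unfolding nc_def by blast
          show ?thesis
          proof (rule ncI)
            show "holo (\<lambda>x. u (\<pi> x))" by (rule h\<pi>[OF u(1)])
            show "\<forall>\<^sub>0 x. E' x = xpow (\<lambda>k. if k \<in> S then N * \<beta> k else \<beta> k) x * u (\<pi> x)"
              using ev\<pi>[OF u(3)] by eventually_elim (simp add: E'_def xpow\<pi>)
          qed (simp add: admD(2)[OF \<pi>] u)
        qed
        show "holo W'" unfolding W'_def[abs_def] by (rule h\<pi>[OF W\<phi>(1)])
        show "dep (insert n S) W'" unfolding W'_def[abs_def] by (rule adm_dep[OF \<pi> W\<phi>(2)]) auto
        show "W' 0 \<noteq> 0" using W\<phi>(3) by (simp add: W'_def admD(2)[OF \<pi>])
        show "k < e" using k(1) Ie by blast
        show "b' k 0 \<noteq> 0" using k(1) v(3) by (simp add: b'_def admD(2)[OF \<pi>])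
        show "holo (b' i)" for i
        proof (cases "i \<in> I")
          case True
          have "holo (\<lambda>x. xpow (\<lambda>l. (Suc e - i) * (\<delta> i l - \<delta> k l)) x * v i (\<pi> x))"
            by (intro holo_mult holo_xpow h\<pi> v True)
          with True show ?thesis by (simp add: b'_def)
        qed (simp add: b'_def)
        show "dep S (b' i)" for i
        proof (cases "i \<in> I")
          case True
          have "dep S (\<lambda>x. xpow (\<lambda>l. (Suc e - i) * (\<delta> i l - \<delta> k l)) x * v i (\<pi> x))"
            by (intro dep_mult xpow_dep adm_dep[OF \<pi>] v True) (simp_all add: \<delta>_def \<alpha>[OF True])
          with True show ?thesis by (simp add: b'_def)
        qed (simp add: b'_def dep_const)
        show "\<delta> k i = 0" if "i \<notin> S" for i using \<alpha>[OF k(1) that] by (simp add: \<delta>_def)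
      qed auto
      moreover have "\<forall>\<^sub>0 x. E' x * ((\<Sum>i<e. xpow (\<delta> k) x ^ (Suc e - i) * b' i x * x $ n ^ i) + x $ n ^ Suc e * W' x)
          = ?f (\<phi> (\<pi> x))"
      proof -
        have "\<forall>\<^sub>0 x. xpow (\<delta> k) x ^ (Suc e - i) * b' i x = b i (\<phi> (\<pi> x))" if i: "i \<in> {..<e}" for i
        proof (cases "i \<in> I")
          case True
          have *: "xpow (\<alpha> i) (\<pi> x) = xpow (\<delta> k) x ^ (Suc e - i) * xpow (\<lambda>l. (Suc e - i) * (\<delta> i l - \<delta> k l)) x" for x
          proof -
            \<comment> \<open>The power substitution makes the exponents divisible by the weights:
              \<open>N * \<alpha> i l = (Suc e - i) * \<delta> i l\<close>.\<close>
            have "(if l \<in> S then N * \<alpha> i l else \<alpha> i l) = (Suc e - i) * \<delta> k l + (Suc e - i) * (\<delta> i l - \<delta> k l)" for l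
            proof -
              have "(Suc e - i) * \<delta> k l + (Suc e - i) * (\<delta> i l - \<delta> k l) = (Suc e - i) * \<delta> i l"
                using k(2)[OF True] by (simp flip: distrib_left)
              also have "\<dots> = N * \<alpha> i l"
                unfolding \<delta>_def mult.assoc[symmetric] using Nd[of i] i by simp
              finally show ?thesis using \<alpha>[OF True, of l] by auto
            qed
            then show ?thesis unfolding xpow\<pi> xpow_mult[symmetric] xpow_add[symmetric] by (simp only:)
          qed
          from ev\<pi>[OF bv[OF True]] show ?thesis
            by eventually_elim (simp add: b'_def True * mult.assoc)
        next
          case False
          from ev\<pi>[OF b0[OF _ False]] i have "\<forall>\<^sub>0 x. b i (\<phi> (\<pi> x)) = 0" by simp
          then show ?thesis by eventually_elim (simp add: b'_def False)
        qed
        then have "\<forall>\<^sub>0 x. \<forall>i\<in>{..<e}. xpow (\<delta> k) x ^ (Suc e - i) * b' i x = b i (\<phi> (\<pi> x))"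
          by (intro eventually_ball_finite) auto
        then show ?thesis
          by eventually_elim (simp add: E'_def W'_def \<phi>n \<pi>n cong: sum.cong_simp)
      qed
      ultimately have "resolvable (insert n S) (\<lambda>x. ?f (\<phi> (\<pi> x)))" by (rule resolvable_cong)
      then show ?thesis
        unfolding \<pi>_def by (rule resolvable_powmap[OF N, of "insert n S" "\<lambda>x. ?f (\<phi> x)" S]) auto
    qed
    then show "loc (insert n S) (\<lambda>\<psi>. nc (\<lambda>x. ?f (\<phi> (\<psi> x))))"
      unfolding resolvable_def .
  qed
  then show ?thesis unfolding resolvable_def .
qed

text \<open>The translation \<open>\<sigma>\<close> of \<open>x $ n\<close> solves \<open>\<partial>\<^sub>n ^ (d - 1) g = 0\<close>, which kills the coefficient of
  \<open>x $ n ^ (d - 1)\<close>.\<close>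

lemma resolvable_regular:
  fixes E :: "complex^'n \<Rightarrow> complex"
  assumes n: "n \<notin> S"
    and M: "\<And>h. holo h \<Longrightarrow> dep S h \<Longrightarrow> \<not> (\<forall>\<^sub>0 x. h x = 0) \<Longrightarrow> resolvable S h"
    and E: "holo E" "dep S E" "\<not> (\<forall>\<^sub>0 x. E x = 0)"
    and g: "regular S n d g"
  shows "resolvable (insert n S) (\<lambda>x. E x * g x)"
  using E g
proof (induction d arbitrary: E g rule: less_induct)
  case (less d)
  obtain a U where a: "\<And>i. i < d \<Longrightarrow> holo (a i)" "\<And>i. i < d \<Longrightarrow> dep S (a i)"
    and U: "holo U" "dep (insert n S) U" "U 0 \<noteq> 0"
    and ev: "\<forall>\<^sub>0 x. g x = (\<Sum>i<d. a i x * x $ n ^ i) + x $ n ^ d * U x"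
    using less.prems(4) unfolding regular_def by blast
  show ?case
  proof (cases d)
    case 0
    have "resolvable (insert n S) (\<lambda>x. E x * U x)"
      by (rule resolvable_mult_unit[OF M[OF less.prems(1-3)] _ U(1,3)]) auto
    moreover have "\<forall>\<^sub>0 x. E x * U x = E x * g x"
      using ev by eventually_elim (simp add: 0)
    ultimately show ?thesis by (rule resolvable_cong)
  next
    case (Suc e)
    define g0 where "g0 x = (\<Sum>i<d. a i x * x $ n ^ i) + x $ n ^ d * U x" for x
    have g0: "holo g0" "dep (insert n S) g0"
    proof -
      show "holo g0" unfolding g0_def[abs_def]
        by (intro holo_add holo_sum holo_mult holo_power holo_nth U a) simp
      show "dep (insert n S) g0" unfolding g0_def[abs_def]
        by (intro dep_intros U dep_mono[OF a(2)]) auto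
    qed
    have ev0: "\<forall>\<^sub>0 x. g0 x = (\<Sum>i<d. a i x * x $ n ^ i) + x $ n ^ d * U x"
      by (simp add: g0_def)
    have "resolvable (insert n S) (\<lambda>x. E x * g0 x)"
    proof (cases "\<exists>k<d. a k 0 \<noteq> 0")
      case True
      then obtain k where k: "k < d" "a k 0 \<noteq> 0" by blast
      show ?thesis
        by (rule less.IH[OF k(1) less.prems(1-3) regular_lower[OF a U(1,2) k ev0]])
    next
      case False
      \<comment> \<open>The partial derivative of order \<open>d - 1\<close>: it vanishes at 0, and
        its derivative in direction \<open>n\<close> there is \<open>fact d * U 0\<close>, so it can
        be solved for \<open>x $ n\<close>.\<close>
      define D where "D x = (deriv ^^ e) (\<lambda>t. g0 (vupd x n t)) (x $ n)" for x
      have coeffs0: "(deriv ^^ k) (\<lambda>t. g0 (vupd 0 n t)) 0 = 0" if "k < d" for k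
        using eventually_nhds_x_imp_x[OF taylor_coeffs[OF n a(2) U(1) ev0]] that False by auto
      have coeffd: "(deriv ^^ d) (\<lambda>t. g0 (vupd 0 n t)) 0 \<noteq> 0"
        using eventually_nhds_x_imp_x[OF taylor_coeffs[OF n a(2) U(1) ev0]] U(3) by auto
      have D: "holo D" unfolding D_def[abs_def] by (rule holo_higher_deriv[OF g0(1)])
      moreover have "D 0 = 0" using coeffs0[of e] by (simp add: D_def Suc)
      moreover have "deriv (\<lambda>t. D (vupd 0 n t)) 0 \<noteq> 0"
        using coeffd by (simp add: D_def Suc)
      ultimately obtain \<tau> where \<tau>: "holo \<tau>" "\<tau> 0 = 0" "\<forall>\<^sub>0 x. D (vupd x n (\<tau> x)) = 0"
        using holo_implicit by blast
      \<comment> \<open>Restricting \<open>\<tau>\<close> to the coordinates in \<open>S\<close>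
        lets the translation \<open>T\<close> be undone by subtracting
        \<open>\<sigma>\<close>.\<close>
      define \<sigma> where "\<sigma> x = \<tau> (proj S x)" for x
      have \<sigma>: "holo \<sigma>" "\<sigma> 0 = 0" "dep S \<sigma>"
        unfolding \<sigma>_def[abs_def] using \<tau>(2) by (auto intro: holo_compose[OF \<tau>(1) holomap_proj] dep_proj)
      have D\<sigma>: "\<forall>\<^sub>0 x. D (vupd x n (\<sigma> x)) = 0"
        using eventually_compose[OF isCont_proj proj_0 \<tau>(3), of S]
      proof eventually_elim
        case (elim x)
        have "g0 (vupd (proj S x) n t) = g0 (vupd x n t)" for t
          by (rule dep_cong[OF g0(2)]) (auto simp: vupd_nth proj_nth)
        with elim show ?case by (simp add: D_def \<sigma>_def)
      qed
      define T where "T x = vupd x n (x $ n + \<sigma> x)" for x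
      define T' where "T' x = vupd x n (x $ n - \<sigma> x)" for x
      have T: "adm (insert n S) T" unfolding T_def[abs_def]
      proof (rule adm_vupd)
        show "holo (\<lambda>x. x $ n + \<sigma> x)" by (intro holo_add holo_nth \<sigma>)
        show "dep (insert n S) (\<lambda>x. x $ n + \<sigma> x)"
          by (intro dep_intros dep_mono[OF \<sigma>(3)]) auto
      qed (simp_all add: \<sigma>)
      have T': "isCont T' 0" "T' 0 = 0" "\<And>x. T (T' x) = x"
      proof -
        show "isCont T' 0" unfolding T'_def[abs_def]
          by (intro holomap_isCont holomap_vupd holo_diff holo_nth \<sigma>)
        show "T' 0 = 0" by (simp add: T'_def \<sigma>)
        show "T (T' x) = x" for x
          using dep_vupd[OF \<sigma>(3) n, of x] by (simp add: T_def T'_def)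
      qed
      define g1 where "g1 x = g0 (T x)" for x
      have g1: "holo g1" "dep (insert n S) g1"
        unfolding g1_def[abs_def] by (rule adm_holo[OF T g0(1)], rule adm_dep[OF T g0(2) subset_refl])
      obtain b W where b: "\<And>i. holo (b i)" "\<And>i. dep S (b i)" and W: "holo W" "dep (insert n S) W"
        and ev1: "\<forall>\<^sub>0 x. g1 x = (\<Sum>i<d. b i x * x $ n ^ i) + x $ n ^ d * W x"
        using holo_taylor[OF g1 n] by blast
      have shift: "(deriv ^^ k) (\<lambda>t. g1 (vupd x n t)) 0 = (deriv ^^ k) (\<lambda>t. g0 (vupd x n t)) (\<sigma> x)" for k x
        using higher_deriv_shift[of k "\<lambda>t. g0 (vupd x n t)" "\<sigma> x" 0]
        by (simp add: g1_def T_def dep_vupd[OF \<sigma>(3) n])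
      note tc = taylor_coeffs[OF n b(2) W(1) ev1]
      have W0: "W 0 \<noteq> 0"
        using eventually_nhds_x_imp_x[OF tc] coeffd by (auto simp: shift \<sigma>)
      \<comment> \<open>\<open>fact e * b e x\<close> is the \<open>e\<close>-th derivative of the
        translated slice at 0, that is, \<open>D\<close> at height
        \<open>\<sigma> x\<close>.\<close>
      have "\<forall>\<^sub>0 x. b e x = 0"
        using tc D\<sigma> by eventually_elim (auto simp: shift D_def Suc)
      with ev1 have "\<forall>\<^sub>0 x. E x * ((\<Sum>i<e. b i x * x $ n ^ i) + x $ n ^ Suc e * W x) = E (T x) * g0 (T x)"
        by eventually_elim (simp add: Suc g1_def[symmetric], simp add: T_def dep_vupd[OF less.prems(2) n])
      moreover have "resolvable (insert n S) (\<lambda>x. E x * ((\<Sum>i<e. b i x * x $ n ^ i) + x $ n ^ Suc e * W x))"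
      proof (rule resolvable_centered[OF n M _ less.prems(1-3)])
        show "resolvable (insert n S) (\<lambda>x. E x * g x)"
          if "k \<le> e" "holo E" "dep S E" "nc E" "regular S n k g" for E g k
          using less.IH[of k E g] that nc_not_eventually_0 by (auto simp: Suc)
      qed (use b W W0 in auto)
      ultimately have "resolvable (insert n S) (\<lambda>x. E (T x) * g0 (T x))"
        by (rule resolvable_cong[rotated])
      then show ?thesis
        by (rule resolvable_adm[of "insert n S" "\<lambda>x. E x * g0 x" T, OF _ T T'(1,2)]) (simp add: T'(3))
    qed
    moreover have "\<forall>\<^sub>0 x. E x * g0 x = E x * g x"
      using ev by eventually_elim (simp add: g0_def)
    ultimately show ?thesis by (rule resolvable_cong)
  qed
qed

text \<open>After a generic linear change of coordinates the germ is regular in \<open>x $ n\<close>.\<close>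

theorem holo_resolvable:
  fixes f :: "complex^'n \<Rightarrow> complex"
  assumes "holo f" "dep S f" "\<not> (\<forall>\<^sub>0 x. f x = 0)"
  shows "resolvable S f"
  using finite[of S] assms
proof (induction S arbitrary: f rule: finite_induct)
  case empty
  have "f 0 \<noteq> 0"
  proof
    assume "f 0 = 0"
    then have "f x = 0" for x using depD[OF empty(2), of x] by simp
    with empty(3) show False by simp
  qed
  with empty(1) show ?case by (intro resolvable_nc nc_unit)
next
  case (insert n S)
  obtain r p where r: "r > 0" "\<And>x. x \<in> polydisc r \<Longrightarrow> has_cgrad f (p x) x"
    using holo_polydisc[OF insert.prems(1)] by blast
  obtain v where v: "v \<in> polydisc r" "f v \<noteq> 0" "v $ n \<noteq> 0" "proj (insert n S) v = v"
  proof -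
    obtain w where w: "w \<in> polydisc r" "f w \<noteq> 0"
      using insert.prems(3) r(1) unfolding eventually_nhds_0_polydisc by blast
    \<comment> \<open>A point where the product is nonzero gives \<open>f v \<noteq> 0\<close> and
      \<open>v $ n \<noteq> 0\<close> together; the latter makes \<open>A\<close>
      invertible.\<close>
    have "\<not> (\<forall>\<^sub>0 x. f x * x $ n = 0)"
      using holo_zero_divisor[OF insert.prems(1) holo_nth] insert.prems(3) nth_not_eventually_0 by blast
    then obtain u where u: "u \<in> polydisc r" "f u * u $ n \<noteq> 0"
      using r(1) unfolding eventually_nhds_0_polydisc by blast
    show thesis
    proof (rule that)
      show "proj (insert n S) u \<in> polydisc r" using u(1) r(1) by (auto simp: mem_polydisc proj_nth)
    qed (use u(2) depD[OF insert.prems(2)] in \<open>auto simp: proj_nth\<close>)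
  qed
  \<comment> \<open>\<open>A\<close> maps the \<open>n\<close>-th axis onto the complex line through
    \<open>v\<close>, where \<open>f\<close> does not vanish identically; hence the order in
    \<open>x $ n\<close> becomes finite.\<close>
  define A where "A x = vupd x n 0 + x $ n *s v" for x
  define A' where "A' x = vupd (x - (x $ n / v $ n) *s v) n (x $ n / v $ n)" for x
  have A: "adm (insert n S) A" unfolding adm_def
  proof (intro conjI ballI allI impI)
    show "holomap A" unfolding holomap_def
    proof
      fix i show "holo (\<lambda>x. A x $ i)"
        by (cases "i = n") (auto simp: A_def intro!: holo_add holo_mult holo_nth holo_const)
    qed
    show "A 0 = 0" by (simp add: A_def)
    show "dep (insert n S) (\<lambda>x. A x $ i)" if "i \<in> insert n S" for i
      by (rule depI) (use that in \<open>auto simp: A_def vupd_nth\<close>)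
    show "A x $ i = x $ i" if "i \<notin> insert n S" for x i
    proof -
      have "v $ i = 0" using that arg_cong[OF v(4), of "\<lambda>v. v $ i"] by (simp add: proj_nth)
      then show ?thesis using that by (simp add: A_def vupd_nth)
    qed
  qed
  have A': "isCont A' 0" "A' 0 = 0" "\<And>x. A (A' x) = x"
  proof -
    have "holomap A'" unfolding holomap_def
    proof
      fix i
      have "holo (\<lambda>x. x $ n * inverse (v $ n))" "holo (\<lambda>x. x $ i - x $ n * inverse (v $ n) * v $ i)"
        by (intro holo_diff holo_mult holo_nth holo_const)+
      then show "holo (\<lambda>x. A' x $ i)"
        by (cases "i = n") (simp_all add: A'_def divide_inverse)
    qed
    then show "isCont A' 0" by (rule holomap_isCont)
    show "A' 0 = 0" by (simp add: A'_def)
    show "A (A' x) = x" for x using v(3) by (auto simp: A_def A'_def vec_eq_iff vupd_nth)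
  qed
  define f1 where "f1 x = f (A x)" for x
  have f1: "holo f1" "dep (insert n S) f1"
    unfolding f1_def[abs_def]
    by (rule adm_holo[OF A insert.prems(1)], rule adm_dep[OF A insert.prems(2) subset_refl])
  have slice: "f1 (vupd 0 n t) = f (0 + t *s v)" for t
    by (simp add: f1_def A_def)
  have "\<exists>d. (deriv ^^ d) (\<lambda>t. f1 (vupd 0 n t)) 0 \<noteq> 0"
  proof (rule ccontr)
    assume "\<not> ?thesis"
    then have z: "(deriv ^^ d) (\<lambda>t. f (0 + t *s v)) 0 = 0" for d by (simp add: slice)
    define Z where "Z = {t. 0 + t *s v \<in> polydisc r}"
    have Z: "open Z" "connected Z" unfolding Z_def
      by (intro open_convex_line_polydisc convex_connected)+
    have "f (0 + 1 *s v) = 0"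
    proof (rule holomorphic_fun_eq_0_on_connected[where f = "\<lambda>t. f (0 + t *s v)" and S = Z and z = 0 and w = 1])
      show "(\<lambda>t. f (0 + t *s v)) holomorphic_on Z" unfolding Z_def
        by (rule holomorphic_on_line[OF r(2)])
    qed (use Z z v(1) r(1) in \<open>auto simp: Z_def mem_polydisc\<close>)
    then show False using v(2) by simp
  qed
  then obtain d where "(deriv ^^ d) (\<lambda>t. f1 (vupd 0 n t)) 0 \<noteq> 0" by blast
  then have "regular S n d f1" by (rule regular_of_deriv_nonzero[OF f1 insert.hyps(2)])
  from resolvable_regular[OF insert.hyps(2) insert.IH holo_const dep_const _ this, of 1]
  have "resolvable (insert n S) (\<lambda>x. f (A x))" by (simp add: f1_def)
  then show ?case
    by (rule resolvable_adm[of "insert n S" f A, OF _ A A'(1,2)]) (simp add: A'(3))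
qed

section \<open>The Lojasiewicz inequality for holomorphic germs\<close>

lemma isCont_eventually_less:
  fixes f g :: "complex^'n \<Rightarrow> real"
  assumes "isCont f 0" "isCont g 0" "f 0 < g 0"
  shows "\<forall>\<^sub>0 x. f x < g x"
proof -
  have "isCont (\<lambda>x. g x - f x) 0" by (intro isCont_diff assms)
  then have "((\<lambda>x. g x - f x) \<longlongrightarrow> g 0 - f 0) (nhds 0)"
    using tendsto_at_iff_tendsto_nhds[of "\<lambda>x. g x - f x" 0] by (simp add: isCont_def)
  from order_tendstoD(1)[OF this, of 0] assms(3) show ?thesis by simp
qed

lemma norm_smult: "norm (c *s (v :: complex^'n)) = norm c * norm v"
  by (simp add: norm_vec_def norm_mult L2_set_right_distrib)

text \<open>Quantifying over all \<open>p\<close> spares a gradient operator and lets the chain rule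
  act on a given \<open>p\<close>.\<close>

definition loj :: "(complex^'n \<Rightarrow> complex) \<Rightarrow> real \<Rightarrow> real \<Rightarrow> complex^'n \<Rightarrow> bool" where
  "loj F \<theta> C x \<longleftrightarrow> (\<forall>p. has_cgrad F p x \<longrightarrow> norm (F x) powr \<theta> \<le> C * norm p)"

text \<open>For a monomial times a unit, \<open>x\<^sub>i \<partial>F/\<partial>x\<^sub>i\<close> is comparable to \<open>F\<close> whenever \<open>x\<^sub>i\<close> occurs in the
  monomial; the smallest such \<open>\<bar>x\<^sub>i\<bar>\<close> is bounded by \<open>\<bar>F\<bar> powr (1 / degree)\<close> up to a constant.\<close>

lemma nc_lojasiewicz:
  fixes F :: "complex^'n \<Rightarrow> complex"
  assumes "nc F" "F 0 = 0"
  shows "\<exists>\<theta> C. 0 < \<theta> \<and> \<theta> < 1 \<and> C > 0 \<and> (\<forall>\<^sub>0 x. loj F \<theta> C x)"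
proof -
  obtain a u where u: "holo u" "u 0 \<noteq> 0" and F: "\<forall>\<^sub>0 x. F x = xpow a x * u x"
    using assms(1) unfolding nc_def by blast
  obtain q where q: "\<forall>\<^sub>0 x. has_cgrad u (q x) x \<and> isCont q x"
    using u(1) unfolding holo_def by blast
  have "xpow a 0 = 0" using eventually_nhds_x_imp_x[OF F] assms(2) u(2) by simp
  then obtain i0 where i0: "a i0 > 0" by (auto simp: xpow_eq_0_iff)
  define I where "I = {i. a i > 0}"
  define N where "N = (\<Sum>i\<in>UNIV. a i)"
  have N: "N > 0" unfolding N_def using i0 by (meson finite sum_pos2 UNIV_I zero_le)
  define K where "K = norm (u 0) + 1"
  define c where "c = norm (u 0) / 2"
  \<comment> \<open>With \<open>m\<close> the modulus of the monomial, the \<open>i\<close>-th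
    partial derivative is at least \<open>c * m / norm (x $ i)\<close>, and
    \<open>norm (x $ i) \<le> m powr (1 / N)\<close> turns this into
    \<open>c * m powr \<theta>0\<close>.\<close>
  define \<theta>0 where "\<theta>0 = 1 - 1 / real N"
  \<comment> \<open>For \<open>N = 1\<close> the exponent \<open>\<theta>0\<close> is 0; the maximum
    keeps it positive.\<close>
  define \<theta> where "\<theta> = max (1/2) \<theta>0"
  define C where "C = K powr \<theta>0 / c"
  have "K > 0" unfolding K_def by (intro add_nonneg_pos) auto
  moreover have "c > 0" using u(2) by (simp add: c_def)
  moreover have "\<theta>0 \<ge> 0" "\<theta>0 < 1" using N by (auto simp: \<theta>0_def)
  ultimately have pos: "K > 0" "c > 0" "C > 0" "\<theta>0 \<ge> 0" "0 < \<theta>" "\<theta> < 1" "\<theta>0 \<le> \<theta>"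
    by (auto simp: C_def \<theta>_def)
  have contq: "isCont q 0" using eventually_nhds_x_imp_x[OF q] by blast
  have ev_unit: "\<forall>\<^sub>0 x. i \<in> I \<longrightarrow> c < norm (of_nat (a i) * u x + x $ i * q x $ i)" for i
  proof (cases "i \<in> I")
    case True
    have "isCont (\<lambda>x. norm (of_nat (a i) * u x + x $ i * q x $ i)) 0"
      by (intro isCont_norm isCont_add isCont_mult isCont_vec_nth holo_isCont[OF u(1)] contq) simp_all
    moreover have "c < norm (of_nat (a i) * u 0 + 0 $ i * q 0 $ i)"
    proof -
      have "norm (u 0) \<le> real (a i) * norm (u 0)" using True by (auto simp: I_def mult_le_cancel_right1)
      then show ?thesis using u(2) by (simp add: c_def norm_mult)
    qed
    ultimately have "\<forall>\<^sub>0 x. c < norm (of_nat (a i) * u x + x $ i * q x $ i)"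
      by (intro isCont_eventually_less) simp_all
    then show ?thesis by eventually_elim simp
  qed simp
  then have ev_unit: "\<forall>\<^sub>0 x. \<forall>i. i \<in> I \<longrightarrow> c < norm (of_nat (a i) * u x + x $ i * q x $ i)"
    by (rule eventually_all_finite)
  have ev_K: "\<forall>\<^sub>0 x. norm (u x) < K"
  proof -
    have "isCont (\<lambda>x. norm (u x)) 0" by (intro isCont_norm holo_isCont[OF u(1)])
    then show ?thesis by (rule isCont_eventually_less) (simp_all add: K_def)
  qed
  have ev_1: "\<forall>\<^sub>0 x. norm (F x) < 1"
  proof -
    have "isCont (\<lambda>x. norm (xpow a x * u x)) 0"
      by (intro isCont_norm isCont_mult holo_isCont holo_xpow u)
    then have "\<forall>\<^sub>0 x. norm (xpow a x * u x) < 1"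
      by (rule isCont_eventually_less) (simp_all add: \<open>xpow a 0 = 0\<close>)
    with F show ?thesis by eventually_elim simp
  qed
  have F': "\<forall>\<^sub>0 x. \<forall>\<^sub>F y in nhds x. F y = xpow a y * u y"
    using F by (simp add: eventually_eventually)
  have "\<forall>\<^sub>0 x. loj F \<theta> C x"
    using F' q ev_unit ev_K ev_1
  proof eventually_elim
    case (elim x)
    have Fx: "F x = xpow a x * u x" using eventually_nhds_x_imp_x[OF elim(1)] .
    show ?case unfolding loj_def
    proof (intro allI impI)
      fix p assume "has_cgrad F p x"
      then have p: "has_cgrad (\<lambda>y. xpow a y * u y) p x" by (rule has_cgrad_cong[OF _ elim(1)])
      show "norm (F x) powr \<theta> \<le> C * norm p"
      proof (cases "xpow a x = 0")
        case True
        then show ?thesis using pos by (simp add: Fx)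
      next
        case False
        \<comment> \<open>The smallest variable of the monomial: replacing all the others by it can
          only decrease the modulus.\<close>
        obtain i where i: "i \<in> I" "\<And>j. j \<in> I \<Longrightarrow> norm (x $ i) \<le> norm (x $ j)"
        proof -
          have "finite I" "I \<noteq> {}" using i0 by (auto simp: I_def)
          then show thesis
            using that[OF arg_min_if_finite(1)] arg_min_least[of I _ "\<lambda>i. norm (x $ i)"] by blast
        qed
        have xi: "x $ i \<noteq> 0" using False i(1) unfolding xpow_eq_0_iff I_def by blast
        define m where "m = norm (xpow a x)"
        have m: "m > 0" using False by (simp add: m_def)
        have "norm (x $ i) ^ N = (\<Prod>j\<in>UNIV. norm (x $ i) ^ a j)"
          by (simp add: N_def power_sum)
        also have "\<dots> \<le> (\<Prod>j\<in>UNIV. norm (x $ j) ^ a j)"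
        proof (rule prod_mono, intro conjI)
          fix j show "norm (x $ i) ^ a j \<le> norm (x $ j) ^ a j"
            by (cases "j \<in> I") (auto intro: power_mono i(2), simp add: I_def)
        qed simp
        also have "\<dots> = m" by (simp add: m_def xpow_def norm_power prod_norm[symmetric])
        finally have xiN: "norm (x $ i) powr real N \<le> m" using xi by (simp add: powr_realpow)
        then have "(norm (x $ i) powr real N) powr (1 / real N) \<le> m powr (1 / real N)"
          by (rule powr_mono2[rotated 2]) auto
        then have xi_le: "norm (x $ i) \<le> m powr (1 / real N)"
          using N xi by (simp add: powr_powr)
        have pi: "x $ i * p $ i = xpow a x * (of_nat (a i) * u x + x $ i * q x $ i)"
        proof -
          define M where "M = (\<Prod>j\<in>UNIV - {i}. x $ j ^ a j)"
          have "(\<lambda>t. xpow a (vupd x i t) * u (vupd x i t)) = (\<lambda>t. t ^ a i * M * u (vupd x i t))"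
            by (simp add: fun_eq_iff xpow_remove[of _ _ i] M_def cong: prod.cong_simp)
          moreover have "((\<lambda>t. xpow a (vupd x i t) * u (vupd x i t)) has_field_derivative p $ i) (at (x $ i))"
            using has_field_derivative_slice[of "\<lambda>y. xpow a y * u y" p x i "x $ i"] p by simp
          ultimately have 1: "((\<lambda>t. t ^ a i * M * u (vupd x i t)) has_field_derivative p $ i) (at (x $ i))" by simp
          have 2: "((\<lambda>t. u (vupd x i t)) has_field_derivative q x $ i) (at (x $ i))"
            using has_field_derivative_slice[of u "q x" x i "x $ i"] elim(2) by simp
          have "((\<lambda>t. t ^ a i * M * u (vupd x i t)) has_field_derivative
              (of_nat (a i) * (x $ i) ^ (a i - 1) * M * u x + (x $ i) ^ a i * M * q x $ i)) (at (x $ i))"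
            by (rule derivative_eq_intros 2 refl)+ (simp add: algebra_simps)
          from DERIV_unique[OF 1 this]
          have "x $ i * p $ i = of_nat (a i) * (x $ i * (x $ i) ^ (a i - 1)) * M * u x + x $ i * (x $ i) ^ a i * M * q x $ i"
            by (simp add: algebra_simps)
          also have "x $ i * (x $ i) ^ (a i - 1) = (x $ i) ^ a i"
            using i(1) by (simp add: I_def power_eq_if)
          finally show ?thesis
            by (simp add: xpow_remove[of _ x i] M_def algebra_simps)
        qed
        have "norm (x $ i) * norm (p $ i) = m * norm (of_nat (a i) * u x + x $ i * q x $ i)"
          using arg_cong[OF pi, of norm] by (simp add: norm_mult m_def)
        also have "\<dots> \<ge> m * c" using elim(3) i(1) m by (intro mult_left_mono) (auto intro: less_imp_le)
        finally have "m * c \<le> norm (x $ i) * norm (p $ i)" .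
        also have "\<dots> \<le> m powr (1 / real N) * norm p"
          by (intro mult_mono xi_le Finite_Cartesian_Product.norm_nth_le) auto
        finally have mc: "m * c \<le> m powr (1 / real N) * norm p" .
        have "m powr \<theta>0 * m powr (1 / real N) = m"
          using m by (simp add: \<theta>0_def powr_add[symmetric])
        with mc have "m powr (1 / real N) * (m powr \<theta>0 * c) \<le> m powr (1 / real N) * norm p"
          by (metis mult.assoc mult.commute)
        then have mp: "m powr \<theta>0 * c \<le> norm p" using m by simp
        have "norm (F x) powr \<theta> \<le> norm (F x) powr \<theta>0"
          using pos elim(5) by (intro powr_mono') auto
        also have "\<dots> \<le> (m * K) powr \<theta>0"
          using elim(4) m pos by (intro powr_mono2) (auto simp: Fx norm_mult m_def intro!: mult_left_mono)
        also have "\<dots> = C * (m powr \<theta>0 * c)" using m pos by (simp add: powr_mult C_def)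
        also have "\<dots> \<le> C * norm p" using mp pos by (intro mult_left_mono) auto
        finally show ?thesis .
      qed
    qed
  qed
  with pos show ?thesis by blast
qed

text \<open>The gradient of \<open>F \<circ> \<phi>\<close> at \<open>y\<close> is at most a
  Jacobian bound \<open>M\<close> times that of \<open>F\<close> at \<open>\<phi> y\<close>, so the
  exponent survives and only the constant changes.\<close>

lemma loj_compose:
  fixes F :: "complex^'n \<Rightarrow> complex"
  assumes \<phi>: "holomap \<phi>" "\<phi> 0 = 0" and C: "C > 0" "\<forall>\<^sub>0 y. loj (\<lambda>y. F (\<phi> y)) \<theta> C y"
  shows "\<exists>D>0. \<forall>\<^sub>0 y. loj F \<theta> D (\<phi> y)"
proof -
  have "\<exists>q. \<forall>i. \<forall>\<^sub>0 x. has_cgrad (\<lambda>x. \<phi> x $ i) (q i x) x \<and> isCont (q i) x"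
    using \<phi>(1) unfolding holomap_def holo_def by (intro choice allI) blast
  then obtain q where q1: "\<And>i. \<forall>\<^sub>0 x. has_cgrad (\<lambda>x. \<phi> x $ i) (q i x) x \<and> isCont (q i) x"
    by blast
  then have q: "\<forall>\<^sub>0 x. \<forall>i. has_cgrad (\<lambda>x. \<phi> x $ i) (q i x) x \<and> isCont (q i) x"
    by (rule eventually_all_finite)
  define M where "M = (\<Sum>i\<in>UNIV. norm (q i 0)) + 1"
  have M: "M > 0" unfolding M_def by (intro add_nonneg_pos sum_nonneg) auto
  have "isCont (\<lambda>x. \<Sum>i\<in>UNIV. norm (q i x)) 0"
    using eventually_nhds_x_imp_x[OF q] by (intro isCont_sum ballI isCont_norm) auto
  then have "\<forall>\<^sub>0 x. (\<Sum>i\<in>UNIV. norm (q i x)) < M"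
    by (rule isCont_eventually_less) (simp_all add: M_def)
  with q C(2) have "\<forall>\<^sub>0 y. loj F \<theta> (C * M) (\<phi> y)"
  proof eventually_elim
    case (elim y)
    show ?case unfolding loj_def
    proof (intro allI impI)
      fix p assume p: "has_cgrad F p (\<phi> y)"
      have "has_cgrad (\<lambda>x. F (\<phi> x)) (\<Sum>i\<in>UNIV. p $ i *s q i y) y"
        by (rule has_cgrad_compose[of F p \<phi> y, OF p]) (use elim(1) in blast)
      with elim(2) have "norm (F (\<phi> y)) powr \<theta> \<le> C * norm (\<Sum>i\<in>UNIV. p $ i *s q i y)"
        unfolding loj_def by blast
      also have "norm (\<Sum>i\<in>UNIV. p $ i *s q i y) \<le> (\<Sum>i\<in>UNIV. norm p * norm (q i y))"
        by (rule order_trans[OF norm_sum], rule sum_mono)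
           (simp add: norm_smult mult_right_mono Finite_Cartesian_Product.norm_nth_le)
      also have "\<dots> \<le> norm p * M"
        unfolding sum_distrib_left[symmetric] using elim(3) by (intro mult_left_mono) auto
      finally show "norm (F (\<phi> y)) powr \<theta> \<le> C * M * norm p"
        using C(1) by (simp add: mult_ac)
    qed
  qed
  then show ?thesis using C(1) M by (intro exI[of _ "C * M"]) auto
qed

theorem holo_lojasiewicz:
  fixes F :: "complex^'n \<Rightarrow> complex"
  assumes F: "holo F" "F 0 = 0"
  shows "\<exists>\<theta> C. 0 < \<theta> \<and> \<theta> < 1 \<and> C > 0 \<and> (\<forall>\<^sub>0 x. loj F \<theta> C x)"
proof (cases "\<forall>\<^sub>0 x. F x = 0")
  case True
  then have "\<forall>\<^sub>0 x. loj F (1/2) 1 x"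
    by eventually_elim (simp add: loj_def)
  then show ?thesis by (intro exI[of _ "1/2"] exI[of _ 1]) simp
next
  case False
  have "resolvable UNIV F" using F(1) False by (intro holo_resolvable) auto
  then obtain \<Phi> where \<Phi>: "\<And>\<phi>. \<phi> \<in> \<Phi> \<Longrightarrow> adm UNIV \<phi>" "\<And>\<phi>. \<phi> \<in> \<Phi> \<Longrightarrow> nc (\<lambda>x. F (\<phi> x))" "cover \<Phi>"
    unfolding resolvable_def loc_def by blast
  let ?P = "\<lambda>\<phi> \<theta> D. 0 < \<theta> \<and> \<theta> < 1 \<and> D > 0 \<and> (\<forall>\<^sub>0 y. loj F \<theta> D (\<phi> y))"
  have "\<forall>\<phi>\<in>\<Phi>. \<exists>\<theta> D. ?P \<phi> \<theta> D"
  proof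
    fix \<phi> assume \<phi>: "\<phi> \<in> \<Phi>"
    have "F (\<phi> 0) = 0" using admD(2)[OF \<Phi>(1)[OF \<phi>]] F(2) by simp
    from nc_lojasiewicz[OF \<Phi>(2)[OF \<phi>] this]
    obtain \<theta> C where *: "0 < \<theta>" "\<theta> < 1" "C > 0" "\<forall>\<^sub>0 y. loj (\<lambda>y. F (\<phi> y)) \<theta> C y"
      by blast
    from loj_compose[OF admD(1,2)[OF \<Phi>(1)[OF \<phi>]] *(3,4)] *(1,2)
    show "\<exists>\<theta> D. ?P \<phi> \<theta> D" by blast
  qed
  then obtain \<theta> where "\<forall>\<phi>\<in>\<Phi>. \<exists>D. ?P \<phi> (\<theta> \<phi>) D" by (rule bchoice[THEN exE])
  then obtain D where \<theta>D: "\<forall>\<phi>\<in>\<Phi>. ?P \<phi> (\<theta> \<phi>) (D \<phi>)" by (rule bchoice[THEN exE])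
  obtain \<Phi>' where \<Phi>': "\<Phi>' \<subseteq> \<Phi>" "finite \<Phi>'"
    "\<forall>\<^sub>0 x. \<exists>\<phi>\<in>\<Phi>'. \<exists>y\<in>{y. loj F (\<theta> \<phi>) (D \<phi>) (\<phi> y)}. \<phi> y = x"
    using coverD[OF \<Phi>(3), of "\<lambda>\<phi>. {y. loj F (\<theta> \<phi>) (D \<phi>) (\<phi> y)}"] \<theta>D by auto
  \<comment> \<open>Where \<open>norm (F x) < 1\<close>, a larger exponent gives a smaller power, so
    the maximum serves all charts. The entry \<open>1/2\<close> and the \<open>+ 1\<close> in
    \<open>E\<close> also cover an empty family.\<close>
  define \<Theta> where "\<Theta> = Max (insert (1/2) (\<theta> ` \<Phi>'))"
  define E where "E = (\<Sum>\<phi>\<in>\<Phi>'. D \<phi>) + 1"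
  have Dpos: "D \<phi> > 0" if "\<phi> \<in> \<Phi>'" for \<phi> using \<theta>D \<Phi>'(1) that by blast
  have DE: "D \<phi> \<le> E" if "\<phi> \<in> \<Phi>'" for \<phi>
    using member_le_sum[OF that, of D] \<Phi>'(2) Dpos by (force simp: E_def less_imp_le)
  have \<theta>\<Theta>: "\<theta> \<phi> \<le> \<Theta>" "0 < \<theta> \<phi>" if "\<phi> \<in> \<Phi>'" for \<phi> using \<Phi>' that \<theta>D by (auto simp: \<Theta>_def)
  have \<Theta>: "0 < \<Theta>" "\<Theta> < 1"
    unfolding \<Theta>_def using \<theta>D \<Phi>' by (auto simp: Max_gr_iff)
  have E: "E > 0" unfolding E_def using Dpos by (intro add_nonneg_pos sum_nonneg) (auto simp: less_imp_le)
  have "isCont (\<lambda>x. norm (F x)) 0" by (intro isCont_norm holo_isCont F)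
  then have "\<forall>\<^sub>0 x. norm (F x) < 1"
    by (rule isCont_eventually_less) (simp_all add: F(2))
  with \<Phi>'(3) have "\<forall>\<^sub>0 x. loj F \<Theta> E x"
  proof eventually_elim
    case (elim x)
    then obtain \<phi> where \<phi>: "\<phi> \<in> \<Phi>'" "loj F (\<theta> \<phi>) (D \<phi>) x" by blast
    show ?case unfolding loj_def
    proof (intro allI impI)
      fix p assume p: "has_cgrad F p x"
      have "norm (F x) powr \<Theta> \<le> norm (F x) powr \<theta> \<phi>"
        using \<theta>\<Theta>[OF \<phi>(1)] elim(2) by (intro powr_mono') auto
      also have "\<dots> \<le> D \<phi> * norm p" using \<phi>(2) p unfolding loj_def by blast
      also have "\<dots> \<le> E * norm p" using DE[OF \<phi>(1)] by (intro mult_right_mono) auto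
      finally show "norm (F x) powr \<Theta> \<le> E * norm p" .
    qed
  qed
  with \<Theta> E show ?thesis by blast
qed

section \<open>The Lojasiewicz inequality for real analytic functions\<close>

text \<open>For \<open>d i = 0\<close> the truncated exponent \<open>d i - 1\<close> is harmless:
  the factor \<open>of_nat (d i)\<close> is 0.\<close>

definition xgrad :: "('n \<Rightarrow> nat) \<Rightarrow> complex^'n \<Rightarrow> complex^'n" where
  "xgrad d x = (\<chi> i. of_nat (d i) * x $ i ^ (d i - 1) * (\<Prod>j\<in>UNIV - {i}. x $ j ^ d j))"

lemma has_cgrad_xpow: "has_cgrad (xpow d) (xgrad d x) x"
proof -
  have "((\<lambda>x. x $ i ^ d i) has_derivative (\<lambda>v. of_nat (d i) * (v $ i * x $ i ^ (d i - 1)))) (at x)" for i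
    by (rule has_derivative_power[THEN has_derivative_eq_rhs],
        rule bounded_linear.has_derivative[OF bounded_linear_vec_nth has_derivative_ident])
       (simp add: fun_eq_iff mult_ac)
  then have "((\<lambda>x. \<Prod>i\<in>UNIV. x $ i ^ d i) has_derivative
      (\<lambda>v. \<Sum>i\<in>UNIV. of_nat (d i) * (v $ i * x $ i ^ (d i - 1)) * (\<Prod>j\<in>UNIV - {i}. x $ j ^ d j))) (at x)"
    by (rule has_derivative_prod)
  then show ?thesis
    unfolding has_cgrad_def xpow_def[abs_def]
    by (rule has_derivative_eq_rhs) (simp add: fun_eq_iff cdot_def xgrad_def mult_ac)
qed

lemma continuous_on_xgrad: "continuous_on A (xgrad d)"
  unfolding xgrad_def[abs_def] by (intro continuous_intros)

lemma norm_xpow_le: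
  fixes x :: "complex^'n"
  assumes "x \<in> polydisc s"
  shows "norm (xpow d x) \<le> s ^ (\<Sum>i\<in>UNIV. d i)"
proof -
  have "norm (xpow d x) = (\<Prod>i\<in>UNIV. norm (x $ i) ^ d i)"
    by (simp add: xpow_def norm_power prod_norm[symmetric])
  also have "\<dots> \<le> (\<Prod>i\<in>UNIV. s ^ d i)"
    using assms by (intro prod_mono conjI power_mono) (auto simp: mem_polydisc less_imp_le)
  also have "\<dots> = s ^ (\<Sum>i\<in>UNIV. d i)" by (simp add: power_sum)
  finally show ?thesis .
qed

text \<open>Differentiation costs a factor at most the degree \<open>N\<close>; halving the radius
  gains a power of 2 that absorbs it.\<close>

lemma norm_xgrad_le:
  fixes x :: "complex^'n"
  assumes "s > 0" "x \<in> polydisc (s / 2)"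
  shows "norm (xgrad d x) \<le> real CARD('n) * (2 / s) * s ^ (\<Sum>i\<in>UNIV. d i)"
proof -
  define N where "N = (\<Sum>i\<in>UNIV. d i)"
  have "norm (xgrad d x $ i) \<le> 2 / s * s ^ N" for i
  proof (cases "d i = 0")
    case True
    then show ?thesis using assms(1) by (simp add: xgrad_def)
  next
    case False
    have N: "N = d i + (\<Sum>j\<in>UNIV - {i}. d j)" unfolding N_def by (rule sum.remove) auto
    have xj: "norm (x $ j) \<le> s / 2" for j using assms(2) by (simp add: mem_polydisc less_imp_le)
    have "norm (\<Prod>j\<in>UNIV - {i}. x $ j ^ d j) \<le> (\<Prod>j\<in>UNIV - {i}. (s / 2) ^ d j)"
      unfolding prod_norm[symmetric] using xj by (intro prod_mono conjI) (auto simp: norm_power intro: power_mono)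
    also have "\<dots> = (s / 2) ^ (N - d i)" unfolding N by (simp add: power_sum)
    finally have "norm (xgrad d x $ i) \<le> real (d i) * (s / 2) ^ (d i - 1) * (s / 2) ^ (N - d i)"
      using xj[of i] assms(1)
      by (simp add: xgrad_def norm_mult norm_power) (intro mult_mono power_mono mult_left_mono; simp)
    also have "\<dots> = real (d i) * (s / 2) ^ (N - 1)"
    proof -
      have "N - 1 = (d i - 1) + (N - d i)" using False N by simp
      then show ?thesis by (simp add: power_add)
    qed
    also have "\<dots> \<le> 2 ^ N * (s / 2) ^ (N - 1)"
    proof (rule mult_right_mono)
      have "d i \<le> N" using N by simp
      then have "real (d i) \<le> real N" by simp
      also have "\<dots> \<le> 2 ^ N" by (rule less_imp_le[OF of_nat_less_two_power])
      finally show "real (d i) \<le> 2 ^ N" .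
    qed (use assms(1) in simp)
    also have "\<dots> = 2 / s * s ^ N"
    proof -
      have "N \<noteq> 0" using False N by simp
      then obtain m where "N = Suc m" by (cases N) auto
      then show ?thesis using assms(1) by (simp add: power_divide)
    qed
    finally show ?thesis .
  qed
  then have "(\<Sum>i\<in>UNIV. norm (xgrad d x $ i)) \<le> (\<Sum>i\<in>(UNIV::'n set). 2 / s * s ^ N)"
    by (intro sum_mono)
  moreover have "norm (xgrad d x) \<le> (\<Sum>i\<in>UNIV. norm (xgrad d x $ i))"
    unfolding norm_vec_def[of "xgrad d x"] by (rule L2_set_le_sum) simp
  ultimately show ?thesis by (simp add: N_def mult.assoc)
qed

text \<open>On the polydisc of half the radius the gradients of the terms are dominated by a
  multiple of the given series, so they may be summed termwise, with a continuous limit.\<close>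

lemma holo_power_series:
  fixes c :: "nat \<Rightarrow> complex" and d :: "nat \<Rightarrow> 'n::finite \<Rightarrow> nat"
  assumes s: "s > 0" and sm: "summable (\<lambda>k. norm (c k) * s ^ (\<Sum>i\<in>UNIV. d k i))"
  shows "holo (\<lambda>z :: complex^'n. \<Sum>k. c k * xpow (d k) z)"
proof -
  define D :: "(complex^'n) set" where "D = polydisc (s / 2)"
  define M where "M k = real CARD('n) * (2 / s) * (norm (c k) * s ^ (\<Sum>i\<in>UNIV. d k i))" for k
  define P where "P k z = c k *s xgrad (d k) z" for k and z :: "complex^'n"
  define G where "G z = (\<Sum>k. P k z)" for z
  have 0: "0 \<in> D" using s by (simp add: D_def mem_polydisc)
  have oD: "open D" and cD: "convex D" unfolding D_def by (rule open_polydisc, rule convex_polydisc)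
  have Psub: "D \<subseteq> polydisc s" unfolding D_def using s by (intro polydisc_mono) simp
  have "norm (P k z) \<le> M k" if "z \<in> D" for k z
    using mult_left_mono[OF norm_xgrad_le[OF s that[unfolded D_def], of "d k"], of "norm (c k)"]
    by (simp add: P_def M_def norm_smult mult_ac)
  moreover have "summable M" unfolding M_def by (intro summable_mult sm)
  ultimately have ul: "uniform_limit D (\<lambda>n z. \<Sum>k<n. P k z) G sequentially"
    unfolding G_def by (rule Weierstrass_m_test)
  have contP: "continuous_on D (\<lambda>z. \<Sum>k<n. P k z)" for n
  proof (rule continuous_on_sum)
    fix k
    have "continuous_on D (\<lambda>z. \<chi> i. c k * xgrad (d k) z $ i)"
      by (intro continuous_intros continuous_on_xgrad)
    moreover have "P k z = (\<chi> i. c k * xgrad (d k) z $ i)" for z by (simp add: P_def vec_eq_iff)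
    ultimately show "continuous_on D (P k)" by simp
  qed
  have contG: "continuous_on D G"
    by (rule uniform_limit_theorem[OF _ ul]) (simp_all add: contP)
  have sums: "(\<lambda>k. c k * xpow (d k) z) sums (\<Sum>k. c k * xpow (d k) z)" if "z \<in> D" for z
  proof (intro summable_sums summable_comparison_test[OF _ sm] exI allI impI)
    fix k show "norm (c k * xpow (d k) z) \<le> norm (c k) * s ^ (\<Sum>i\<in>UNIV. d k i)"
      using norm_xpow_le[OF subsetD[OF Psub that], of "d k"] by (simp add: norm_mult mult_left_mono)
  qed
  obtain K where K: "K > 0" "\<And>p v :: complex^'n. norm (cdot p v) \<le> norm p * norm v * K"
    using bounded_bilinear.pos_bounded[OF bounded_bilinear_cdot] by blast
  have "\<exists>g. \<forall>z\<in>D. (\<lambda>k. c k * xpow (d k) z) sums g z \<and> (g has_derivative cdot (G z)) (at z within D)"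
  proof (rule has_derivative_series[where f = "\<lambda>k z. c k * xpow (d k) z" and f' = "\<lambda>k z. cdot (P k z)", OF cD _ _ 0 sums[OF 0]])
    fix k z assume "z \<in> D"
    have "has_cgrad (\<lambda>z. c k * xpow (d k) z) (P k z) z"
      using has_cgrad_mult[OF has_cgrad_const[of "c k"] has_cgrad_xpow[of "d k" z]] by (simp add: P_def)
    then show "((\<lambda>z. c k * xpow (d k) z) has_derivative cdot (P k z)) (at z within D)"
      unfolding has_cgrad_def by (rule has_derivative_at_withinI)
  next
    fix e :: real assume e: "e > 0"
    then have "\<forall>\<^sub>F n in sequentially. \<forall>z\<in>D. dist (\<Sum>k<n. P k z) (G z) < e / K"
      using uniform_limitD[OF ul, of "e / K"] K(1) by simp
    then show "\<forall>\<^sub>F n in sequentially. \<forall>z\<in>D. \<forall>h. norm ((\<Sum>k<n. cdot (P k z) h) - cdot (G z) h) \<le> e * norm h"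
    proof eventually_elim
      case (elim n)
      show ?case
      proof (intro ballI allI)
        fix z h assume z: "z \<in> D"
        have "norm ((\<Sum>k<n. cdot (P k z) h) - cdot (G z) h) = norm (cdot ((\<Sum>k<n. P k z) - G z) h)"
          by (simp add: cdot_diff_left bounded_bilinear.sum_left[OF bounded_bilinear_cdot])
        also have "\<dots> \<le> norm ((\<Sum>k<n. P k z) - G z) * norm h * K" by (rule K(2))
        also have "\<dots> \<le> e / K * norm h * K"
          using elim z K(1) by (intro mult_right_mono) (auto simp: dist_norm less_imp_le)
        finally show "norm ((\<Sum>k<n. cdot (P k z) h) - cdot (G z) h) \<le> e * norm h" using K(1) by simp
      qed
    qed
  qed
  then obtain g where g: "\<And>z. z \<in> D \<Longrightarrow> (\<lambda>k. c k * xpow (d k) z) sums g z"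
    "\<And>z. z \<in> D \<Longrightarrow> has_cgrad g (G z) z"
    using at_within_open[OF _ oD] unfolding has_cgrad_def by metis
  have "has_cgrad (\<lambda>z. \<Sum>k. c k * xpow (d k) z) (G z) z" if "z \<in> D" for z
  proof (rule has_cgrad_cong[OF g(2)[OF that]])
    show "\<forall>\<^sub>F y in nhds z. g y = (\<Sum>k. c k * xpow (d k) y)"
      unfolding eventually_nhds using oD that sums g(1) sums_unique2 by blast
  qed
  then show ?thesis
    using contG s unfolding D_def by (intro holoI_polydisc[of "s / 2" _ G]) auto
qed

section \<open>From real analytic functions to holomorphic germs\<close>

definition cvec :: "real^'n \<Rightarrow> complex^'n" where
  "cvec y = (\<chi> i. of_real (y $ i))"

lemma cvec_nth [simp]: "cvec y $ i = of_real (y $ i)"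
  by (simp add: cvec_def)

lemma linear_cvec: "linear cvec"
  by (rule linearI) (simp_all add: vec_eq_iff complex_eq_iff)

lemma bounded_linear_cvec: "bounded_linear cvec"
  using linear_cvec by (simp add: linear_conv_bounded_linear)

lemma cvec_0 [simp]: "cvec 0 = 0"
  by (simp add: vec_eq_iff)

text \<open>The same coefficients at complex arguments: absolute convergence at one real point with
  equal positive coordinates dominates the series on a polydisc. An enumeration \<open>h\<close> of
  the multi-indices turns the unconditional sum into an ordinary series.\<close>

lemma real_analytic_complexification:
  fixes f :: "real^'n \<Rightarrow> real"
  assumes "real_analytic f"
  shows "\<exists>F. holo F \<and> (\<forall>\<^sub>0 y. F (cvec y) = of_real (f (a + y)))"
proof -
  obtain r c where r: "r > 0"
    and hs: "\<And>x. x \<in> ball a r \<Longrightarrow> ((\<lambda>d. c d * (\<Prod>i\<in>UNIV. (x $ i - a $ i) ^ d i)) has_sum f x) (UNIV :: ('n \<Rightarrow> nat) set)"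
    using assms[unfolded real_analytic_def, THEN spec[of _ a]]
    by (elim exE conjE) (rule that, assumption, erule bspec)
  define h :: "nat \<Rightarrow> 'n \<Rightarrow> nat" where "h = from_nat_into UNIV"
  have "infinite (UNIV :: ('n \<Rightarrow> nat) set)"
  proof
    assume "finite (UNIV :: ('n \<Rightarrow> nat) set)"
    then have "finite (range (\<lambda>k (i::'n). k :: nat))" by (rule finite_subset[rotated]) simp
    moreover have "inj (\<lambda>k (i::'n). k :: nat)" by (auto simp: inj_def fun_eq_iff)
    ultimately have "finite (UNIV :: nat set)" by (rule finite_imageD)
    then show False by simp
  qed
  then have h: "bij_betw h UNIV UNIV" unfolding h_def by (intro bij_betw_from_nat_into) auto
  have sums: "(\<lambda>k. c (h k) * (\<Prod>i\<in>UNIV. y $ i ^ h k i)) sums f (a + y)" if "norm y < r" for y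
  proof -
    have "((\<lambda>d. c d * (\<Prod>i\<in>UNIV. y $ i ^ d i)) has_sum f (a + y)) UNIV"
      using hs[of "a + y"] that by (simp add: dist_norm)
    then show ?thesis
      by (intro has_sum_imp_sums
          has_sum_reindex_bij_betw[OF h, of "\<lambda>d. c d * (\<Prod>i\<in>UNIV. y $ i ^ d i)", THEN iffD2])
  qed
  \<comment> \<open>The vector with all entries \<open>s\<close> has norm at most
    \<open>r / 2\<close> and so lies in the ball of convergence.\<close>
  define s where "s = r / (2 * real CARD('n))"
  have s: "s > 0" using r by (simp add: s_def)
  have "norm ((\<chi> i. s) :: real^'n) \<le> (\<Sum>i\<in>(UNIV::'n set). norm s)"
    unfolding norm_vec_def using L2_set_le_sum[of UNIV "\<lambda>i::'n. norm s"] by simp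
  also have "\<dots> < r" using r by (simp add: s_def)
  finally have ns: "a + (\<chi> i. s) \<in> ball a r" by (simp add: dist_norm)
  have "(\<lambda>d. c d * s ^ (\<Sum>i\<in>UNIV. d i)) summable_on (UNIV :: ('n \<Rightarrow> nat) set)"
    using has_sum_imp_summable[OF hs[OF ns]] by (simp add: power_sum)
  then have "(\<lambda>d. \<bar>c d\<bar> * s ^ (\<Sum>i\<in>UNIV. d i)) summable_on (UNIV :: ('n \<Rightarrow> nat) set)"
    by (rule summable_on_iff_abs_summable_on_real[THEN iffD1, THEN summable_on_cong[THEN iffD1, rotated]])
      (use s in \<open>simp add: abs_mult\<close>)
  then have "(\<lambda>k. \<bar>c (h k)\<bar> * s ^ (\<Sum>i\<in>UNIV. h k i)) summable_on UNIV"
    by (rule summable_on_reindex_bij_betw[OF h, of "\<lambda>d. \<bar>c d\<bar> * s ^ (\<Sum>i\<in>UNIV. d i)", THEN iffD2])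
  then have "summable (\<lambda>k. norm (complex_of_real (c (h k))) * s ^ (\<Sum>i\<in>UNIV. h k i))"
    by (simp add: summable_on_imp_summable)
  from holo_power_series[OF s this]
  have "holo (\<lambda>z. \<Sum>k. of_real (c (h k)) * xpow (h k) z)" .
  moreover have "\<forall>\<^sub>0 y. (\<Sum>k. of_real (c (h k)) * xpow (h k) (cvec y)) = of_real (f (a + y))"
    unfolding eventually_nhds_metric
  proof (intro exI[of _ r] conjI r allI impI)
    fix y :: "real^'n" assume "dist y 0 < r"
    then have "(\<lambda>k. complex_of_real (c (h k) * (\<Prod>i\<in>UNIV. y $ i ^ h k i))) sums of_real (f (a + y))"
      by (intro sums_of_real sums) simp
    then show "(\<Sum>k. of_real (c (h k)) * xpow (h k) (cvec y)) = of_real (f (a + y))"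
      by (intro sums_unique[symmetric]) (simp add: xpow_def)
  qed
  ultimately show ?thesis by blast
qed

lemma gradient_eqI:
  assumes "GDERIV f x :> D"
  shows "gradient f x = D"
  unfolding gradient_def
proof (rule the_equality)
  show "GDERIV f x :> D" by (rule assms)
  fix D' assume "GDERIV f x :> D'"
  with assms have "(\<lambda>h. inner h D') = (\<lambda>h. inner h D)"
    unfolding gderiv_def by (intro has_derivative_unique)
  then have "inner (D' - D) (D' - D) = 0" by (simp add: inner_diff_right fun_eq_iff)
  then show "D' = D" by simp
qed

text \<open>\<open>F\<close> is real at real points, so its complex gradient there is real,
  coincides with the real gradient and has the same norm; the complex inequality then restricts
  directly.\<close>

theorem real_analytic_lojasiewicz:
  fixes f :: "real^'n \<Rightarrow> real"
  assumes "real_analytic f"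
  shows "\<exists>\<theta> C. 0 < \<theta> \<and> \<theta> < 1 \<and> C > 0 \<and> (\<forall>\<^sub>F x in nhds a. \<bar>f x - f a\<bar> powr \<theta> \<le> C * norm (gradient f x))"
proof -
  obtain F0 where F0: "holo F0" "\<forall>\<^sub>0 y. F0 (cvec y) = of_real (f (a + y))"
    using real_analytic_complexification[OF assms] by blast
  define F where "F z = F0 z - of_real (f a)" for z
  have F: "holo F" unfolding F_def[abs_def] by (intro holo_diff F0 holo_const)
  have Fev: "\<forall>\<^sub>0 y. F (cvec y) = of_real (f (a + y) - f a)"
    using F0(2) by eventually_elim (simp add: F_def)
  have "F 0 = 0" using eventually_nhds_x_imp_x[OF Fev] by simp
  from holo_lojasiewicz[OF F this] obtain \<theta> C
    where \<theta>C: "0 < \<theta>" "\<theta> < 1" "C > 0" and loj: "\<forall>\<^sub>0 z. loj F \<theta> C z" by blast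
  obtain p where "\<forall>\<^sub>0 z. has_cgrad F (p z) z \<and> isCont p z"
    using F unfolding holo_def by blast
  with loj have "\<forall>\<^sub>0 z. loj F \<theta> C z \<and> has_cgrad F (p z) z"
    by eventually_elim blast
  moreover have cv: "filterlim (cvec :: real^'n \<Rightarrow> complex^'n) (nhds 0) (nhds 0)"
  proof -
    have "isCont (cvec :: real^'n \<Rightarrow> complex^'n) 0"
      by (rule linear_continuous_at[OF bounded_linear_cvec])
    then show ?thesis
      using tendsto_at_iff_tendsto_nhds[of "cvec :: real^'n \<Rightarrow> complex^'n" 0] by (simp add: isCont_def)
  qed
  ultimately have ev1: "\<forall>\<^sub>0 y. loj F \<theta> C (cvec y) \<and> has_cgrad F (p (cvec y)) (cvec y)"
    by (rule eventually_compose_filterlim)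
  have "\<forall>\<^sub>0 y. \<forall>\<^sub>F z in nhds y. F (cvec z) = of_real (f (a + z) - f a)"
    using Fev by (simp add: eventually_eventually)
  with ev1 have "\<forall>\<^sub>0 y. \<bar>f (a + y) - f a\<bar> powr \<theta> \<le> C * norm (gradient f (a + y))"
  proof eventually_elim
    case (elim y)
    define q where "q = p (cvec y)"
    have "((\<lambda>z. F (cvec z)) has_derivative (\<lambda>v. cdot q (cvec v))) (at y)"
      using diff_chain_at[OF bounded_linear_imp_has_derivative[OF bounded_linear_cvec, of "at y"], of F "cdot q"]
        elim(1) by (simp add: has_cgrad_def q_def o_def)
    then have d: "((\<lambda>z. complex_of_real (f (a + z) - f a)) has_derivative (\<lambda>v. cdot q (cvec v))) (at y)"
      by (rule has_derivative_transform_eventually)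
         (use elim(2) eventually_nhds_x_imp_x[OF elim(2)] in \<open>auto simp: eventually_at_filter elim: eventually_mono\<close>)
    have Im: "Im (q $ i) = 0" for i
    proof -
      have "((\<lambda>z. 0) has_derivative (\<lambda>v. Im (cdot q (cvec v)))) (at y)"
        using bounded_linear.has_derivative[OF bounded_linear_Im d] by simp
      from has_derivative_unique[OF this has_derivative_const]
      have "Im (cdot q (cvec (axis i 1))) = 0" by (simp add: fun_eq_iff)
      moreover have "cvec (axis i 1) = axis i 1" by (simp add: vec_eq_iff axis_def)
      ultimately show ?thesis by simp
    qed
    define g where "g = (\<chi> i. Re (q $ i))"
    have qg: "q = cvec g" using Im by (simp add: vec_eq_iff g_def complex_eq_iff)
    have "((\<lambda>z. Re (complex_of_real (f (a + z) - f a))) has_derivative (\<lambda>v. Re (cdot q (cvec v)))) (at y)"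
      by (rule bounded_linear.has_derivative[OF bounded_linear_Re d])
    moreover have "Re (cdot q (cvec v)) = v \<bullet> g" for v
      by (simp add: cdot_def qg inner_vec_def mult.commute)
    ultimately have "((\<lambda>z. f (a + z) - f a) has_derivative (\<lambda>v. v \<bullet> g)) (at y)"
      by (simp del: of_real_diff)
    then have "((\<lambda>z. f (a + z) - f a + f a) has_derivative (\<lambda>v. v \<bullet> g)) (at y)"
      by (rule has_derivative_add_const)
    then have "((\<lambda>z. f (a + z)) has_derivative (\<lambda>v. v \<bullet> g)) (at y)" by simp
    moreover have "((\<lambda>x. x - a) has_derivative (\<lambda>v. v)) (at (a + y))"
      by (auto intro!: derivative_eq_intros)
    ultimately have "(f has_derivative (\<lambda>v. v \<bullet> g)) (at (a + y))"
      using diff_chain_at[of "\<lambda>x. x - a" "\<lambda>v. v" "a + y" "\<lambda>z. f (a + z)"] by (simp add: o_def)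
    then have "gradient f (a + y) = g" by (intro gradient_eqI) (simp add: gderiv_def)
    moreover have "norm q = norm g" by (simp add: qg norm_vec_def)
    moreover have "norm (F (cvec y)) powr \<theta> \<le> C * norm q"
      using elim(1) unfolding loj_def q_def by blast
    moreover have "F (cvec y) = of_real (f (a + y) - f a)" using eventually_nhds_x_imp_x[OF elim(2)] .
    ultimately show ?case by (simp del: of_real_diff)
  qed
  moreover have "nhds a = filtermap (\<lambda>x. x + a) (nhds 0)"
    using filtermap_nhds_shift[of "- a" 0] by simp
  ultimately have "\<forall>\<^sub>F x in nhds a. \<bar>f x - f a\<bar> powr \<theta> \<le> C * norm (gradient f x)"
    by (simp add: eventually_filtermap add.commute)
  with \<theta>C show ?thesis by blast
qed

section \<open>Convergence of the perturbed gradient method\<close>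

lemma differentiable_imp_GDERIV_gradient:
  fixes f :: "'a::euclidean_space \<Rightarrow> real"
  assumes "f differentiable (at x)"
  shows "GDERIV f x :> gradient f x"
proof -
  obtain f' where f': "(f has_derivative f') (at x)" using assms unfolding differentiable_def by blast
  then interpret f': bounded_linear f' by (rule has_derivative_bounded_linear)
  define D where "D = (\<Sum>b\<in>Basis. f' b *\<^sub>R b)"
  have "f' h = h \<bullet> D" for h
  proof -
    have "f' h = f' (\<Sum>b\<in>Basis. (h \<bullet> b) *\<^sub>R b)" by (simp add: euclidean_representation)
    also have "\<dots> = h \<bullet> D" by (simp add: D_def f'.sum f'.scale inner_sum_right mult.commute)
    finally show ?thesis .
  qed
  then have "f' = (\<lambda>h. h \<bullet> D)" by blast
  with f' have "GDERIV f x :> D" by (simp add: gderiv_def)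
  with gradient_eqI[OF this] show ?thesis by simp
qed

text \<open>The mean value theorem gives the constant \<open>l\<close>, where integration would give
  \<open>l / 2\<close>; the condition \<open>2 * \<eta> * l < 1\<close> on the step size fits
  \<open>l\<close>.\<close>

lemma gradient_lipschitz_descent:
  fixes f :: "'a::euclidean_space \<Rightarrow> real"
  assumes "gradient_lipschitz l f"
  shows "f y \<le> f x + (y - x) \<bullet> gradient f x + l * norm (y - x) ^ 2"
proof -
  have G: "GDERIV f z :> gradient f z" for z
    using assms by (intro differentiable_imp_GDERIV_gradient) (simp add: gradient_lipschitz_def)
  have L: "l-lipschitz_on UNIV (gradient f)" using assms by (simp add: gradient_lipschitz_def)
  have "((\<lambda>t. f (x + t *\<^sub>R (y - x))) has_real_derivative ((y - x) \<bullet> gradient f (x + t *\<^sub>R (y - x)))) (at t)" for t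
  proof -
    have "((\<lambda>t. x + t *\<^sub>R (y - x)) has_derivative (\<lambda>h. h *\<^sub>R (y - x))) (at t)"
      by (auto intro!: derivative_eq_intros)
    from diff_chain_at[OF this G[unfolded gderiv_def]] show ?thesis
      by (simp add: o_def has_field_derivative_def mult_commute_abs)
  qed
  then obtain t where t: "0 < t" "t < 1"
    "f (x + 1 *\<^sub>R (y - x)) - f (x + 0 *\<^sub>R (y - x)) = (1 - 0) * ((y - x) \<bullet> gradient f (x + t *\<^sub>R (y - x)))"
    using MVT2[of 0 1 "\<lambda>t. f (x + t *\<^sub>R (y - x))" "\<lambda>t. (y - x) \<bullet> gradient f (x + t *\<^sub>R (y - x))"] by auto
  have "(y - x) \<bullet> (gradient f (x + t *\<^sub>R (y - x)) - gradient f x)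
      \<le> norm (y - x) * norm (gradient f (x + t *\<^sub>R (y - x)) - gradient f x)"
    by (rule norm_cauchy_schwarz)
  also have "\<dots> \<le> norm (y - x) * (l * norm (t *\<^sub>R (y - x)))"
    using lipschitz_onD[OF L, of "x + t *\<^sub>R (y - x)" x] by (intro mult_left_mono) (auto simp: dist_norm)
  also have "\<dots> = t * (l * norm (y - x) ^ 2)"
    using t(1) by (simp add: power2_eq_square mult_ac)
  also have "\<dots> \<le> 1 * (l * norm (y - x) ^ 2)"
    using t(2) lipschitz_on_nonneg[OF L] by (intro mult_right_mono) auto
  finally show ?thesis using t(3) by (simp add: inner_diff_right)
qed

text \<open>On [0, 1] one has \<open>u \<le> u powr \<theta>\<close>; this is applied to the shares
  \<open>a / (a + b)\<close> and \<open>b / (a + b)\<close>.\<close>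

lemma powr_add_le:
  fixes a b \<theta> :: real
  assumes "0 \<le> a" "0 \<le> b" "0 < \<theta>" "\<theta> \<le> 1"
  shows "(a + b) powr \<theta> \<le> a powr \<theta> + b powr \<theta>"
proof (cases "a + b = 0")
  case True
  then show ?thesis using assms by simp
next
  case False
  then have s: "a + b > 0" using assms by simp
  have "u / (a + b) \<le> (u / (a + b)) powr \<theta>" if "0 \<le> u" "u \<le> a + b" for u
    using powr_mono'[of \<theta> 1 "u / (a + b)"] that s assms by simp
  from this[of a] this[of b] assms s
  have "a / (a + b) + b / (a + b) \<le> (a powr \<theta> + b powr \<theta>) / (a + b) powr \<theta>"
    by (simp add: powr_divide add_divide_distrib)
  moreover have "a / (a + b) + b / (a + b) = 1" using s by (simp flip: add_divide_distrib)
  ultimately show ?thesis using s by (simp add: field_simps)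
qed

text \<open>The graph of the concave function \<open>t powr s\<close> lies below its tangent at
  \<open>a\<close>; scaled to \<open>a = 1\<close> this is Young's inequality for
  \<open>b / a\<close> and 1.\<close>

lemma powr_diff_ge:
  fixes a b s :: real
  assumes "0 \<le> b" "b \<le> a" "0 < a" "0 < s" "s < 1"
  shows "s * a powr (s - 1) * (a - b) \<le> a powr s - b powr s"
proof -
  have "(b / a) powr s \<le> s * (b / a) + (1 - s)"
  proof (cases "b = 0")
    case False
    then show ?thesis
      using Youngs_inequality_0[of s "1 - s" "b / a" 1] assms by simp
  qed (use assms in simp)
  then have "a powr s * (b / a) powr s \<le> a powr s * (s * (b / a) + (1 - s))"
    by (rule mult_left_mono) simp
  moreover have "a powr s * (b / a) powr s = b powr s" using assms by (simp add: powr_divide)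
  moreover have "a powr s * (s * (b / a) + (1 - s)) = a powr (s - 1) * (s * b + (1 - s) * a)"
    "a powr s = a powr (s - 1) * a"
    using assms(3) by (simp_all add: powr_diff field_simps)
  ultimately show ?thesis by (simp add: algebra_simps)
qed

text \<open>The method enters through inexact gradients \<open>q k\<close> with geometrically small
  error, which separates the convergence argument from the variable \<open>h\<close>.\<close>

lemma perturbed_descent_convergent:
  fixes f :: "'a::euclidean_space \<Rightarrow> real" and x q :: "nat \<Rightarrow> 'a"
  assumes gl: "gradient_lipschitz l f"
    and sub: "\<And>t. compact {x. f x \<le> t}"
    and loj: "\<And>a. \<exists>p C. 0 < p \<and> p < 1 \<and> C > 0 \<and>
      (\<forall>\<^sub>F x in nhds a. \<bar>f x - f a\<bar> powr p \<le> C * norm (gradient f x))"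
    and \<eta>: "0 < \<eta>" "2 * \<eta> * l < 1"
    and x: "\<And>k. x (Suc k) = x k - \<eta> *\<^sub>R q k"
    and \<rho>: "0 \<le> \<rho>" "\<rho> < 1" and A: "0 \<le> A"
    and q: "\<And>k. norm (q k - gradient f (x k)) \<le> A * \<rho> ^ k"
  shows "\<exists>a. x \<longlonglongrightarrow> a \<and> gradient f a = 0"
proof -
  \<comment> \<open>The net gain \<open>\<eta> / 2 - l * \<eta>\<^sup>2\<close>: half of
    \<open>\<eta>\<close> goes into \<open>e \<bullet> q \<le> ((norm e)\<^sup>2 + (norm q)\<^sup>2)
    / 2\<close>, and \<open>l * \<eta>\<^sup>2\<close> is the quadratic term of the descent
    inequality.\<close>
  define b where "b = \<eta> / 2 * (1 - 2 * \<eta> * l)"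
  have b: "b > 0" using \<eta> by (simp add: b_def)
  \<comment> \<open>Chosen so that \<open>T k - T (Suc k)\<close> is exactly
    \<open>\<eta> / 2 * (A\<^sup>2 * (\<rho>\<^sup>2) ^ k)\<close>, the bound for the error in step
    \<open>k\<close>.\<close>
  define S where "S = \<eta> / 2 * A\<^sup>2 / (1 - \<rho>\<^sup>2)"
  define T where "T k = S * (\<rho>\<^sup>2) ^ k" for k
  have \<rho>2: "0 \<le> \<rho>\<^sup>2" "\<rho>\<^sup>2 < 1" using \<rho> by (auto simp: power_less_one_iff)
  have S: "S \<ge> 0" using \<eta> \<rho>2 by (simp add: S_def)
  have T0: "T k \<ge> 0" for k using S by (simp add: T_def)
  have T_lim: "T \<longlonglongrightarrow> 0"
    unfolding T_def using \<rho>2 by (intro tendsto_mult_right_zero LIMSEQ_power_zero) simp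
  have L: "l-lipschitz_on UNIV (gradient f)" using gl by (simp add: gradient_lipschitz_def)
  have contf: "continuous_on UNIV f"
    using gl unfolding gradient_lipschitz_def
    by (intro differentiable_imp_continuous_on) (auto simp: differentiable_on_def)
  have contg: "continuous_on UNIV (gradient f)" by (rule lipschitz_on_continuous_on[OF L])
  define V where "V k = f (x k) + T k" for k
  have step: "V (Suc k) \<le> V k - b * norm (q k) ^ 2" for k
  proof -
    define e where "e = q k - gradient f (x k)"
    have "norm e ^ 2 \<le> (A * \<rho> ^ k)\<^sup>2" using q[of k] by (intro power_mono) (auto simp: e_def)
    also have "\<dots> = A\<^sup>2 * (\<rho>\<^sup>2) ^ k" by (simp add: power_mult_distrib flip: power_mult) (simp add: mult.commute)
    finally have e: "norm e ^ 2 \<le> A\<^sup>2 * (\<rho>\<^sup>2) ^ k" .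
    have "e \<bullet> q k \<le> norm e * norm (q k)" by (rule norm_cauchy_schwarz)
    also have "\<dots> \<le> (norm e ^ 2 + norm (q k) ^ 2) / 2"
      using sum_squares_bound[of "norm e" "norm (q k)"] by simp
    finally have eq: "e \<bullet> q k \<le> (norm e ^ 2 + norm (q k) ^ 2) / 2" .
    have gq: "q k \<bullet> gradient f (x k) = norm (q k) ^ 2 - e \<bullet> q k"
      by (simp add: e_def inner_diff_left inner_diff_right power2_norm_eq_inner inner_commute)
    have d1: "f (x (Suc k)) \<le> f (x k) - \<eta> * (q k \<bullet> gradient f (x k)) + l * (\<eta>\<^sup>2 * norm (q k) ^ 2)"
      using gradient_lipschitz_descent[OF gl, of "x (Suc k)" "x k"] \<eta>(1)
      by (simp add: x power_mult_distrib)
    have d2: "\<eta> * ((norm (q k) ^ 2 - norm e ^ 2) / 2) \<le> \<eta> * (q k \<bullet> gradient f (x k))"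
      using \<eta>(1) eq unfolding gq by (intro mult_left_mono) (simp_all add: field_simps)
    have "\<eta> * ((norm (q k) ^ 2 - norm e ^ 2) / 2) - l * (\<eta>\<^sup>2 * norm (q k) ^ 2) =
        b * norm (q k) ^ 2 - \<eta> / 2 * norm e ^ 2"
      by (simp add: b_def field_simps power2_eq_square)
    with d1 d2 have "f (x (Suc k)) \<le> f (x k) - b * norm (q k) ^ 2 + \<eta> / 2 * norm e ^ 2" by linarith
    also have "\<dots> \<le> f (x k) - b * norm (q k) ^ 2 + \<eta> / 2 * (A\<^sup>2 * (\<rho>\<^sup>2) ^ k)"
      using e \<eta>(1) by (intro add_left_mono mult_left_mono) auto
    also have "\<eta> / 2 * (A\<^sup>2 * (\<rho>\<^sup>2) ^ k) = T k - T (Suc k)"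
    proof -
      have "1 - \<rho>\<^sup>2 \<noteq> 0" using \<rho>2 by simp
      then have "S * (1 - \<rho>\<^sup>2) = \<eta> / 2 * A\<^sup>2"
        unfolding S_def by (rule nonzero_divide_eq_eq[THEN iffD1, OF _ refl, symmetric])
      moreover have "T k - T (Suc k) = S * (1 - \<rho>\<^sup>2) * (\<rho>\<^sup>2) ^ k" by (simp add: T_def algebra_simps)
      ultimately show ?thesis by (simp only: mult.assoc)
    qed
    finally show ?thesis by (simp add: V_def)
  qed
  have V_le: "V (Suc k) \<le> V k" for k
    using step[of k] b by (smt (verit) mult_nonneg_nonneg zero_le_power2)
  then have decV: "decseq V" by (rule decseq_SucI)
  define K0 where "K0 = {x. f x \<le> V 0}"
  have K0: "compact K0" unfolding K0_def by (rule sub)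
  have xK: "x k \<in> K0" for k
  proof -
    have "f (x k) \<le> V k" using T0[of k] by (simp add: V_def)
    also have "\<dots> \<le> V 0" using decV by (simp add: decseq_def)
    finally show ?thesis by (simp add: K0_def)
  qed
  obtain m where m: "\<And>y. y \<in> K0 \<Longrightarrow> m \<le> f y"
    using continuous_attains_inf[OF K0 _ continuous_on_subset[OF contf]] xK by blast
  have "m \<le> V k" for k using m[OF xK[of k]] T0[of k] by (simp add: V_def)
  then obtain V' where V': "V \<longlonglongrightarrow> V'" "\<And>k. V' \<le> V k"
    using decseq_convergent[OF decV, of m] by blast
  obtain a r where r: "strict_mono r" "(x \<circ> r) \<longlonglongrightarrow> a"
    using compact_imp_seq_compact[OF K0] xK unfolding seq_compact_def by blast
  have fx_lim: "(\<lambda>k. f (x k)) \<longlonglongrightarrow> V'"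
    using tendsto_diff[OF V'(1) T_lim] by (simp add: V_def)
  have "(\<lambda>k. f ((x \<circ> r) k)) \<longlonglongrightarrow> f a"
    by (rule isCont_tendsto_compose[OF _ r(2)]) (use contf in \<open>simp add: continuous_on_eq_continuous_at\<close>)
  moreover have "(\<lambda>k. f ((x \<circ> r) k)) \<longlonglongrightarrow> V'"
    using LIMSEQ_subseq_LIMSEQ[OF fx_lim r(1)] by (simp add: o_def)
  ultimately have fa: "f a = V'" by (rule LIMSEQ_unique)
  have "(\<lambda>k. V k - V (Suc k)) \<longlonglongrightarrow> V' - V'" by (intro tendsto_diff V' LIMSEQ_Suc)
  from tendsto_divide[OF this tendsto_const[of b]] b
  have V_diff_lim: "(\<lambda>k. (V k - V (Suc k)) / b) \<longlonglongrightarrow> 0" by simp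
  have "norm (q k) ^ 2 \<le> (V k - V (Suc k)) / b" for k
    using step[of k] b by (simp add: field_simps)
  then have "(\<lambda>k. norm (q k) ^ 2) \<longlonglongrightarrow> 0"
    by (intro tendsto_sandwich[OF _ _ tendsto_const V_diff_lim] always_eventually allI) auto
  from tendsto_real_sqrt[OF this] have q_lim: "(\<lambda>k. norm (q k)) \<longlonglongrightarrow> 0" by simp
  have A_lim: "(\<lambda>k. A * \<rho> ^ k) \<longlonglongrightarrow> 0"
    using \<rho> by (intro tendsto_mult_right_zero LIMSEQ_power_zero) simp
  have g_le: "norm (gradient f (x k)) \<le> norm (q k) + A * \<rho> ^ k" for k
    using q[of k] norm_triangle_ineq3[of "gradient f (x k)" "q k"] by (simp add: norm_minus_commute)
  have qA_lim: "(\<lambda>k. norm (q k) + A * \<rho> ^ k) \<longlonglongrightarrow> 0" using tendsto_add[OF q_lim A_lim] by simp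
  have "(\<lambda>k. norm (gradient f (x k))) \<longlonglongrightarrow> 0"
    by (intro tendsto_sandwich[OF _ _ tendsto_const qA_lim] always_eventually allI g_le) simp
  then have "(\<lambda>k. gradient f (x k)) \<longlonglongrightarrow> 0" by (rule tendsto_norm_zero_cancel)
  from LIMSEQ_subseq_LIMSEQ[OF this r(1)] have "(\<lambda>k. gradient f ((x \<circ> r) k)) \<longlonglongrightarrow> 0"
    by (simp add: o_def)
  moreover have "(\<lambda>k. gradient f ((x \<circ> r) k)) \<longlonglongrightarrow> gradient f a"
    by (rule isCont_tendsto_compose[OF _ r(2)]) (use contg in \<open>simp add: continuous_on_eq_continuous_at\<close>)
  ultimately have ga: "gradient f a = 0" using LIMSEQ_unique by blast
  obtain p C where p: "0 < p" "p < 1" and C: "C > 0"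
    and ev: "\<forall>\<^sub>F x in nhds a. \<bar>f x - f a\<bar> powr p \<le> C * norm (gradient f x)"
    using loj by blast
  obtain \<delta> where \<delta>: "\<delta> > 0" "\<And>y. dist y a < \<delta> \<Longrightarrow> \<bar>f y - f a\<bar> powr p \<le> C * norm (gradient f y)"
    using ev unfolding eventually_nhds_metric by blast
  define w where "w k = V k - V'" for k
  have w: "w k \<ge> 0" "w (Suc k) \<le> w k" for k using V' V_le by (auto simp: w_def)
  \<comment> \<open>Both errors in one summable sequence: \<open>A * \<rho> ^ k\<close> separates
    the gradient from \<open>q k\<close>, and \<open>T k powr p / C\<close> separates
    \<open>V\<close> from \<open>f\<close> in Lojasiewicz's inequality.\<close>
  define s where "s k = A * \<rho> ^ k + S powr p / C * ((\<rho>\<^sup>2) powr p) ^ k" for k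
  have s0: "s k \<ge> 0" for k using A \<rho> C by (simp add: s_def)
  have sum_s: "summable s"
  proof -
    have "(\<rho>\<^sup>2) powr p < 1"
    proof (cases "\<rho> = 0")
      case False
      then show ?thesis using \<rho>2 p powr_less_mono2[of p "\<rho>\<^sup>2" 1] by simp
    qed simp
    then show ?thesis unfolding s_def using \<rho> by (intro summable_add summable_mult summable_geometric) auto
  qed
  define K where "K = C / ((1 - p) * b)"
  have K: "K > 0" using C p b by (simp add: K_def)
  have q_le: "norm (q k) \<le> s k + K * (w k powr (1 - p) - w (Suc k) powr (1 - p))" if "dist (x k) a < \<delta>" for k
  proof (cases "norm (q k) = 0")
    case True
    have "w (Suc k) powr (1 - p) \<le> w k powr (1 - p)" using w[of k] w(1)[of "Suc k"] p by (intro powr_mono2) auto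
    with True s0[of k] K show ?thesis by simp
  next
    case False
    then have nq: "norm (q k) > 0" by simp
    have dw: "b * norm (q k) ^ 2 \<le> w k - w (Suc k)" using step[of k] by (simp add: w_def)
    moreover have "b * norm (q k) ^ 2 > 0" using b nq by simp
    \<comment> \<open>A nonzero step strictly decreases \<open>V\<close>, so dividing by
      \<open>w k powr p\<close> is legitimate.\<close>
    ultimately have wk: "w k > 0" using w(1)[of "Suc k"] by linarith
    have Tp: "T k powr p = S powr p * ((\<rho>\<^sup>2) powr p) ^ k"
    proof -
      have "((\<rho>\<^sup>2) ^ k) powr p = ((\<rho>\<^sup>2) powr p) ^ k"
        by (induction k) (use \<rho>2 in \<open>simp_all add: powr_mult\<close>)
      then show ?thesis using S \<rho>2 by (simp add: T_def powr_mult)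
    qed
    have "w k \<le> \<bar>f (x k) - f a\<bar> + T k" by (simp add: w_def V_def fa)
    then have "w k powr p \<le> (\<bar>f (x k) - f a\<bar> + T k) powr p" using w(1) p by (intro powr_mono2) auto
    also have "\<dots> \<le> \<bar>f (x k) - f a\<bar> powr p + T k powr p" using T0 p by (intro powr_add_le) auto
    also have "\<dots> \<le> C * norm (gradient f (x k)) + T k powr p" using \<delta>(2)[OF that] by simp
    also have "\<dots> \<le> C * (norm (q k) + A * \<rho> ^ k) + T k powr p" using g_le[of k] C by simp
    also have "\<dots> = C * (norm (q k) + s k)" using C by (simp add: s_def Tp field_simps)
    finally have wp: "w k powr p \<le> C * (norm (q k) + s k)" .
    have "(1 - p) * w k powr ((1 - p) - 1) * (w k - w (Suc k)) \<le> w k powr (1 - p) - w (Suc k) powr (1 - p)"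
      using w[of k] w(1)[of "Suc k"] wk p by (intro powr_diff_ge) auto
    moreover have "(1 - p) * w k powr ((1 - p) - 1) * (w k - w (Suc k)) \<ge> (1 - p) * w k powr ((1 - p) - 1) * (b * norm (q k) ^ 2)"
      using dw p by (intro mult_left_mono) auto
    moreover have "w k powr ((1 - p) - 1) = 1 / w k powr p" by (simp add: powr_minus_divide)
    ultimately have "(1 - p) * b * norm (q k) ^ 2 / w k powr p \<le> w k powr (1 - p) - w (Suc k) powr (1 - p)"
      by (simp add: mult_ac)
    moreover have "(1 - p) * b * norm (q k) ^ 2 / (C * (norm (q k) + s k)) \<le> (1 - p) * b * norm (q k) ^ 2 / w k powr p"
      using wp wk p b C nq s0[of k] by (intro divide_left_mono mult_pos_pos add_pos_nonneg) auto
    ultimately have "(1 - p) * b / C * (norm (q k) ^ 2 / (norm (q k) + s k)) \<le> w k powr (1 - p) - w (Suc k) powr (1 - p)"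
      by simp
    then have "K * ((1 - p) * b / C * (norm (q k) ^ 2 / (norm (q k) + s k))) \<le> K * (w k powr (1 - p) - w (Suc k) powr (1 - p))"
      using K by (intro mult_left_mono) auto
    moreover have "K * ((1 - p) * b / C * (norm (q k) ^ 2 / (norm (q k) + s k))) = norm (q k) ^ 2 / (norm (q k) + s k)"
      using C p b by (simp add: K_def)
    \<comment> \<open>From \<open>(u - v) * (u + v) \<le> u\<^sup>2\<close>: the quotient becomes a
      length, and \<open>s k\<close> can move to the other side.\<close>
    moreover have "norm (q k) - s k \<le> norm (q k) ^ 2 / (norm (q k) + s k)"
    proof -
      have "(norm (q k) - s k) * (norm (q k) + s k) \<le> norm (q k) ^ 2"
        by (simp add: algebra_simps power2_eq_square)
      moreover have "norm (q k) + s k > 0" using nq s0[of k] by linarith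
      ultimately show ?thesis by (simp add: pos_le_divide_eq)
    qed
    ultimately show ?thesis by linarith
  qed
  have w_lim: "(\<lambda>k. w k powr (1 - p)) \<longlonglongrightarrow> 0"
  proof (rule tendsto_zero_powrI[OF _ tendsto_const])
    show "w \<longlonglongrightarrow> 0" unfolding w_def using LIM_zero[OF V'(1)] .
  qed (use w(1) p in \<open>auto intro!: always_eventually\<close>)
  have "x \<longlonglongrightarrow> a"
  proof (rule metric_LIMSEQ_I)
    fix \<epsilon>' :: real assume "\<epsilon>' > 0"
    define \<epsilon> where "\<epsilon> = min \<epsilon>' \<delta>"
    have \<epsilon>: "\<epsilon> > 0" "\<epsilon> \<le> \<epsilon>'" "\<epsilon> \<le> \<delta>" using \<open>\<epsilon>' > 0\<close> \<delta>(1) by (auto simp: \<epsilon>_def)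
    \<comment> \<open>A third of \<open>\<epsilon>\<close> each for the tail of \<open>s\<close>,
      the telescoped powers of \<open>w\<close> and the distance of the starting point from
      \<open>a\<close>; \<open>\<eta>\<close> and \<open>K\<close> convert to step lengths.\<close>
    obtain N1 where N1: "\<And>m n. m \<ge> N1 \<Longrightarrow> norm (sum s {m..<n}) < \<epsilon> / (3 * \<eta>)"
      using sum_s[unfolded summable_Cauchy, rule_format, of "\<epsilon> / (3 * \<eta>)"] \<epsilon> \<eta> by auto
    obtain N2 where N2: "\<And>n. n \<ge> N2 \<Longrightarrow> w n powr (1 - p) < \<epsilon> / (3 * \<eta> * K)"
      using order_tendstoD(2)[OF w_lim, of "\<epsilon> / (3 * \<eta> * K)"] \<epsilon> \<eta> K
      by (auto simp: eventually_sequentially)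
    obtain N3 where N3: "\<And>n. n \<ge> N3 \<Longrightarrow> dist (x (r n)) a < \<epsilon> / 3"
      using r(2)[unfolded lim_sequentially, rule_format, of "\<epsilon> / 3"] \<epsilon> by auto
    define N where "N = r (max N3 (max N1 N2))"
    have N: "N \<ge> N1" "N \<ge> N2" "dist (x N) a < \<epsilon> / 3"
      using seq_suble[OF r(1), of "max N3 (max N1 N2)"] N3[of "max N3 (max N1 N2)"] by (auto simp: N_def)
    \<comment> \<open>The estimate \<open>q_le\<close> is available only within
      \<open>\<delta>\<close> of \<open>a\<close>; strong induction provides this for all iterates
      from \<open>N\<close> up to \<open>n - 1\<close>.\<close>
    have bound: "dist (x n) a < \<epsilon>" if "n \<ge> N" for n
      using that
    proof (induction n rule: less_induct)
      case (less n)
      have "dist (x n) (x N) = norm (\<Sum>k=N..<n. x (Suc k) - x k)"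
        using sum_Suc_diff'[OF less.prems, of x] by (simp add: dist_norm)
      also have "\<dots> \<le> (\<Sum>k=N..<n. \<eta> * norm (q k))"
        using \<eta>(1) by (intro sum_norm_le) (simp add: x)
      also have "\<dots> \<le> (\<Sum>k=N..<n. \<eta> * (s k + K * (w k powr (1 - p) - w (Suc k) powr (1 - p))))"
        using less \<epsilon> \<eta>(1) by (intro sum_mono mult_left_mono q_le) (auto intro: less_le_trans)
      also have "\<dots> = \<eta> * (sum s {N..<n} + K * (w N powr (1 - p) - w n powr (1 - p)))"
        using less.prems sum_Suc_diff'[of N n "\<lambda>k. w k powr (1 - p)"]
        by (simp add: sum_distrib_left[symmetric] sum.distrib sum_subtractf)
      also have "\<dots> \<le> \<eta> * (sum s {N..<n} + K * w N powr (1 - p))"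
        using \<eta>(1) K by (intro mult_left_mono add_left_mono) auto
      also have "\<dots> = \<eta> * sum s {N..<n} + \<eta> * K * w N powr (1 - p)" by (simp add: algebra_simps)
      also have "\<eta> * sum s {N..<n} < \<epsilon> / 3"
      proof -
        have "sum s {N..<n} < \<epsilon> / (3 * \<eta>)" using N1[OF N(1), of n] by simp
        then show ?thesis using \<eta>(1) by (simp add: field_simps)
      qed
      also have "\<eta> * K * w N powr (1 - p) < \<epsilon> / 3" using N2[OF N(2)] \<eta>(1) K by (simp add: field_simps)
      finally have "dist (x n) (x N) < \<epsilon> / 3 + \<epsilon> / 3" by simp
      with N(3) dist_triangle[of "x n" a "x N"] show ?case by simp
    qed
    then show "\<exists>no. \<forall>n\<ge>no. dist (x n) a < \<epsilon>'" using \<epsilon>(2) by (intro exI[of _ N]) (auto intro: less_le_trans)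
  qed
  with ga show ?thesis by blast
qed

text \<open>The component \<open>h\<close> evolves by itself and contracts geometrically; hence the
  other component performs gradient descent with geometrically decaying error.\<close>

theorem theorem9:
  fixes f :: "real ^ 'n \<Rightarrow> real"
    and g\<^sub>0 :: "(real ^ 'n) \<times> real \<Rightarrow> (real ^ 'n) \<times> real"
    and l L B c \<eta> \<beta> h\<^sub>0 :: real
    and x\<^sub>0 :: "real ^ 'n"
  assumes "gradient_lipschitz l f"
    and "real_analytic f"
    and "\<And>t. compact {x. f x \<le> t}"
    and "well_behaved L B c \<eta> \<beta> f g\<^sub>0"
    and "\<eta> < 1 / (2 * l)"
    and "\<beta> < (1 - 2 * \<eta> * l) / B"
  shows "\<exists>x. (\<lambda>k. fst ((g\<^sub>0 ^^ k) (x\<^sub>0, h\<^sub>0))) \<longlonglongrightarrow> x \<and> stationary_point f x"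
proof -
  obtain q\<^sub>x q\<^sub>h where pos: "\<eta> > 0" "\<beta> > 0" and g: "g\<^sub>0 = step_map \<eta> \<beta> q\<^sub>x q\<^sub>h"
    and qh: "q\<^sub>h C1_differentiable_on UNIV" "q\<^sub>h 0 = 0" "\<And>h. 0 < deriv q\<^sub>h h" "\<And>h. deriv q\<^sub>h h \<le> B"
    and qx: "\<And>x h. norm (q\<^sub>x (x, h) - gradient f x) \<le> c * \<bar>h\<bar>"
    using assms(4) unfolding well_behaved_def by blast
  have "l \<ge> 0" using assms(1) lipschitz_on_nonneg by (auto simp: gradient_lipschitz_def)
  \<comment> \<open>For \<open>l = 0\<close> the default \<open>1 / (2 * l) = 0\<close> would
    contradict \<open>0 < \<eta>\<close>.\<close>
  moreover have "l \<noteq> 0" using assms(5) pos(1) by auto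
  ultimately have l: "l > 0" by simp
  then have \<eta>l: "2 * \<eta> * l < 1" using assms(5) by (simp add: field_simps)
  have B: "B > 0" using qh(3,4)[of 0] by linarith
  have c: "c \<ge> 0" using qx[of 0 1] norm_ge_zero[of "q\<^sub>x (0, 1) - gradient f 0"] by linarith
  \<comment> \<open>The contraction factor of \<open>h\<close>: the mean value inequality and
    \<open>q\<^sub>h 0 = 0\<close> bound \<open>\<bar>q\<^sub>h h\<bar>\<close> by
    \<open>B * \<bar>h\<bar>\<close>.\<close>
  define \<rho> where "\<rho> = \<beta> * B"
  have \<rho>: "0 \<le> \<rho>" using pos(2) B by (simp add: \<rho>_def)
  have "\<rho> < 1 - 2 * \<eta> * l" using assms(6) B by (simp add: \<rho>_def field_simps)
  then have \<rho>1: "\<rho> < 1" using pos(1) l by (smt (verit) mult_pos_pos)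
  have qh_le: "\<bar>q\<^sub>h h\<bar> \<le> B * \<bar>h\<bar>" for h
  proof -
    have "(q\<^sub>h has_field_derivative deriv q\<^sub>h z) (at z)" for z
      using qh(1) unfolding C1_differentiable_on_def
      by (metis DERIV_imp_deriv UNIV_I has_real_derivative_iff_has_vector_derivative)
    then have "norm (q\<^sub>h h - q\<^sub>h 0) \<le> B * norm (h - 0)"
      by (intro field_differentiable_bound[of UNIV q\<^sub>h "deriv q\<^sub>h"])
         (use qh(3,4) in \<open>auto simp: less_imp_le abs_of_pos\<close>)
    then show ?thesis using qh(2) by simp
  qed
  define x where "x k = fst ((g\<^sub>0 ^^ k) (x\<^sub>0, h\<^sub>0))" for k
  define h where "h k = snd ((g\<^sub>0 ^^ k) (x\<^sub>0, h\<^sub>0))" for k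
  have xh: "x (Suc k) = x k - \<eta> *\<^sub>R q\<^sub>x (x k, h k)" "h (Suc k) = \<beta> * q\<^sub>h (h k)" for k
    by (simp_all add: x_def h_def g step_map_def case_prod_beta)
  have h: "\<bar>h k\<bar> \<le> \<bar>h\<^sub>0\<bar> * \<rho> ^ k" for k
  proof (induction k)
    case (Suc k)
    have "\<bar>h (Suc k)\<bar> \<le> \<beta> * (B * \<bar>h k\<bar>)"
      using qh_le[of "h k"] pos(2) by (simp add: xh abs_mult)
    also have "\<dots> \<le> \<rho> * (\<bar>h\<^sub>0\<bar> * \<rho> ^ k)"
      unfolding \<rho>_def mult.assoc[symmetric] using Suc pos(2) B
      by (simp add: \<rho>_def mult.assoc)
    finally show ?case by (simp add: mult_ac)
  qed (simp add: h_def)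
  have "\<exists>a. x \<longlonglongrightarrow> a \<and> gradient f a = 0"
  proof (rule perturbed_descent_convergent[where f = f and x = x and q = "\<lambda>k. q\<^sub>x (x k, h k)", OF assms(1,3) _ pos(1) \<eta>l xh(1) \<rho> \<rho>1])
    show "\<exists>\<theta> C. 0 < \<theta> \<and> \<theta> < 1 \<and> C > 0 \<and> (\<forall>\<^sub>F x in nhds a. \<bar>f x - f a\<bar> powr \<theta> \<le> C * norm (gradient f x))" for a
      by (rule real_analytic_lojasiewicz[OF assms(2)])
    show "0 \<le> c * \<bar>h\<^sub>0\<bar>" using c by simp
    show "norm (q\<^sub>x (x k, h k) - gradient f (x k)) \<le> c * \<bar>h\<^sub>0\<bar> * \<rho> ^ k" for k
      using order_trans[OF qx mult_left_mono[OF h c]] by (simp add: mult.assoc)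
  qed
  then show ?thesis
    using assms(1) unfolding x_def[abs_def] stationary_point_def gradient_lipschitz_def by blast
qed

end
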